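(* Let $c\in(0,\infty)$, $\alpha>1/2$ and $\sigma^2>0$. For each $N$, let $0\le\lambda_1(t)\le\cdots\le\lambda_N(t)$ be the (standard) beta Laguerre process with parameters $\alpha$ and $\beta=2c/N$ and given deterministic initial condition. Let $$x_i(t)=\gamma_N\left(\lambda_i\left(\tfrac{t}{\tau_N}\right)-E_N\right),\quad i=1,\dots,N,$$ where $\gamma_N,\tau_N,E_N>0$ are non-random. Let $\mu_t^{(N)}=\frac1N\sum_{i=1}^N\delta_{x_i(t)}$ be the empirical measure process and $S_n^{(N)}(t)=\frac1N\sum_{i=1}^Nx_i(t)^n$ its $n$th moment process. Assume that as $N\to\infty$ $$\epsilon_N=\frac{\gamma_N}{\tau_N}\to0\quad\text{and}\quad\sigma_N^2=\frac{2\gamma_N^2E_N}{\tau_N}\to\sigma^2 .$$ (1) Assume that for each $n$, $S_n^{(N)}(0)\to a_n$ as $N\to\infty$ for some real $a_n$. Then for every $n$ and every $T>0$, $S_n^{(N)}(t)\to m_n(t)$ as $N\to\infty$ in probability as random elements in $C([0,T])$, where $m_0(t)=1$, $m_1(t)=a_1$ and, for $n\ge2$, $$m_n(t)=a_n+\sigma^2\frac{cn}{2}\sum_{j=0}^{n-2}\int_0^tm_j(u)m_{n-2-j}(u)\,du+\sigma^2\frac12n(n-1)\int_0^tm_{n-2}(u)\,du.$$ (2) Assume further that there is a constant $\Lambda>0$ with $|a_n|\le(\Lambda n)^n$ for all $n\ge1$. Then for any $t\ge0$ there is a unique probability measure $\mu_t$ on $\mathbb R$ having moments $\{m_n(t)\}_{n\ge0}$.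 Moreover, the probability measure-valued process $\mu_t$ is continuous and, for every $T>0$, the empirical measure process $(\mu_t^{(N)})_{0\le t\le T}$ converges to $(\mu_t)_{0\le t\le T}$ in probability under the topology of uniform convergence.
   Context: Beta Laguerre process with parameters $\alpha>1/2$, $\beta>0$: the process $0\le\lambda_1(t)\le\cdots\le\lambda_N(t)$ satisfying $$d\lambda_i(t)=\sqrt{2\lambda_i(t)}\,db_i(t)+\alpha\,dt+\frac\beta2\sum_{j\ne i}\frac{2\lambda_i(t)}{\lambda_i(t)-\lambda_j(t)}\,dt,\quad i=1,\dots,N,$$ with $b_1,\dots,b_N$ independent standard Brownian motions. For $\beta\ge1$ this system has a unique strong solution; for $\beta\in(0,1)$ the process is defined through squares of type B radial Dunkl processes, i.e. $\lambda_i=y_i^2/2$ where $0\le y_1\le\cdots\le y_N$ is the strong solution of $dy_i=db_i+\frac{\alpha-1/2}{y_i}dt+\frac\beta2\sum_{j\ne i}\left(\frac1{y_i-y_j}+\frac1{y_i+y_j}\right)dt$. $C([0,T])$ carries the supremum norm; random elements $X^{(N)}$ of $C([0,T])$ converge in probability to a non-random $x$ if $\mathbb P(\|X^{(N)}-x\|_\infty\ge\varepsilon)\to0$ for all $\varepsilon>0$. The space of probability measures carries the weak topology (metrized by some metric $d$); continuity of $\mu_t$ is with respect to it, and convergence in probability under the topology of uniform convergence means $\sup_{0\le t\le T}d(\mu_t^{(N)},\mu_t)\to0$ in probability. *)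

theory Defs
  imports "HOL-Probability.Probability"
begin

section \<open>Brownian motion and the Ito integral\<close>

text \<open>Processes are functions \<open>X t \<omega>\<close> of which only the values at \<open>t \<ge> 0\<close> and
  \<open>\<omega> \<in> space M\<close> matter.\<close>

definition continuous_paths :: "'a measure \<Rightarrow> (real \<Rightarrow> 'a \<Rightarrow> real) \<Rightarrow> bool" where
  "continuous_paths M X \<longleftrightarrow> (\<forall>\<omega>\<in>space M. continuous_on {0..} (\<lambda>t. X t \<omega>))"

definition adapted :: "(real \<Rightarrow> 'a measure) \<Rightarrow> (real \<Rightarrow> 'a \<Rightarrow> real) \<Rightarrow> bool" where
  "adapted F X \<longleftrightarrow> (\<forall>t\<ge>0. X t \<in> borel_measurable (F t))"

definition standard_BM :: "'a measure \<Rightarrow> (real \<Rightarrow> 'a \<Rightarrow> real) \<Rightarrow> bool" where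
  "standard_BM M B \<longleftrightarrow>
     prob_space M \<and>
     (\<forall>t\<ge>0. B t \<in> borel_measurable M) \<and>
     continuous_paths M B \<and>
     (AE \<omega> in M. B 0 \<omega> = 0) \<and>
     (\<forall>s t. 0 \<le> s \<and> s < t \<longrightarrow>
        distributed M lborel (\<lambda>\<omega>. B t \<omega> - B s \<omega>) (normal_density 0 (sqrt (t - s)))) \<and>
     (\<forall>n (t :: nat \<Rightarrow> real). 0 \<le> t 0 \<and> strict_mono_on {..n} t \<longrightarrow>
        prob_space.indep_vars M (\<lambda>_. borel) (\<lambda>k \<omega>. B (t (Suc k)) \<omega> - B (t k) \<omega>) {..<n})"

definition independent_BMs :: "'a measure \<Rightarrow> nat \<Rightarrow> (nat \<Rightarrow> real \<Rightarrow> 'a \<Rightarrow> real) \<Rightarrow> bool" where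
  "independent_BMs M N b \<longleftrightarrow>
     (\<forall>i\<in>{1..N}. standard_BM M (b i)) \<and>
     prob_space.indep_vars M (\<lambda>_. \<Pi>\<^sub>M t\<in>{0..}. (borel :: real measure))
       (\<lambda>i \<omega>. \<lambda>t\<in>{0..}. b i t \<omega>) {1..N}"

text \<open>The filtration generated by \<open>b\<close>, augmented by the null sets of \<open>M\<close>. Strong solutions
  are those adapted to it.\<close>

definition BM_filtration ::
    "'a measure \<Rightarrow> nat \<Rightarrow> (nat \<Rightarrow> real \<Rightarrow> 'a \<Rightarrow> real) \<Rightarrow> real \<Rightarrow> 'a measure" where
  "BM_filtration M N b t =
     sigma (space M)
       ({b i s -` A \<inter> space M | i s A. i \<in> {1..N} \<and> 0 \<le> s \<and> s \<le> t \<and> A \<in> sets borel} \<union> null_sets M)"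

text \<open>Convergence to 0 in probability; the probability space may vary along the sequence.\<close>

definition null_in_prob :: "(nat \<Rightarrow> 'a measure) \<Rightarrow> (nat \<Rightarrow> 'a \<Rightarrow> real) \<Rightarrow> bool" where
  "null_in_prob M X \<longleftrightarrow>
     (\<forall>e>0. (\<lambda>n. measure (M n) {\<omega> \<in> space (M n). e \<le> \<bar>X n \<omega>\<bar>}) \<longlonglongrightarrow> 0)"

text \<open>Simple integrands \<open>H\<^sub>s = (\<Sum>k<n. \<xi>\<^sub>k 1\<^bsub>(p\<^sub>k, p\<^sub>k\<^sub>+\<^sub>1]\<^esub>(s))\<close> over a partition
  \<open>0 \<le> p\<^sub>0 < \<dots> < p\<^sub>n\<close>, with \<open>\<xi>\<^sub>k\<close> bounded and known at time \<open>p\<^sub>k\<close>.\<close>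

definition simple_integrand ::
    "(real \<Rightarrow> 'a measure) \<Rightarrow> nat \<Rightarrow> (nat \<Rightarrow> real) \<Rightarrow> (nat \<Rightarrow> 'a \<Rightarrow> real) \<Rightarrow> bool" where
  "simple_integrand F n p \<xi> \<longleftrightarrow>
     0 \<le> p 0 \<and> strict_mono_on {..n} p \<and>
     (\<forall>k<n. \<xi> k \<in> borel_measurable (F (p k)) \<and>
        (\<exists>C. \<forall>\<omega>\<in>space (F (p k)). \<bar>\<xi> k \<omega>\<bar> \<le> C))"

definition simple_value ::
    "nat \<Rightarrow> (nat \<Rightarrow> real) \<Rightarrow> (nat \<Rightarrow> 'a \<Rightarrow> real) \<Rightarrow> real \<Rightarrow> 'a \<Rightarrow> real" where
  "simple_value n p \<xi> s \<omega> = (\<Sum>k<n. \<xi> k \<omega> * indicator {p k<..p (Suc k)} s)"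

definition simple_integral ::
    "(real \<Rightarrow> 'a \<Rightarrow> real) \<Rightarrow> nat \<Rightarrow> (nat \<Rightarrow> real) \<Rightarrow> (nat \<Rightarrow> 'a \<Rightarrow> real) \<Rightarrow> real \<Rightarrow> 'a \<Rightarrow> real" where
  "simple_integral B n p \<xi> t \<omega> =
     (\<Sum>k<n. \<xi> k \<omega> * (B (min (p (Suc k)) t) \<omega> - B (min (p k) t) \<omega>))"

text \<open>\<open>I\<^sub>t = \<integral>\<^sub>0\<^sup>t H dB\<close> for a continuous adapted integrand \<open>H\<close>: there are simple
  integrands \<open>H\<^sup>m\<close> with \<open>\<integral>\<^sub>0\<^sup>T (H\<^sup>m - H)\<^sup>2 ds \<rightarrow> 0\<close> in probability whose integrals converge to \<open>I\<close>
  in probability, uniformly on compacts. \<open>B\<close> is meant to be a Brownian motion for \<open>F\<close>; then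
  \<open>I\<close> exists and is unique up to indistinguishability.\<close>

definition is_Ito_integral ::
    "'a measure \<Rightarrow> (real \<Rightarrow> 'a measure) \<Rightarrow> (real \<Rightarrow> 'a \<Rightarrow> real) \<Rightarrow> (real \<Rightarrow> 'a \<Rightarrow> real) \<Rightarrow>
     (real \<Rightarrow> 'a \<Rightarrow> real) \<Rightarrow> bool" where
  "is_Ito_integral M F B H I \<longleftrightarrow>
     adapted F H \<and> continuous_paths M H \<and> adapted F I \<and> continuous_paths M I \<and>
     (\<exists>n p \<xi>.
        (\<forall>m. simple_integrand F (n m) (p m) (\<xi> m)) \<and>
        (\<forall>T>0.
           null_in_prob (\<lambda>_. M)
             (\<lambda>m \<omega>. LBINT s:{0..T}. (simple_value (n m) (p m) (\<xi> m) s \<omega> - H s \<omega>)\<^sup>2) \<and>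
           null_in_prob (\<lambda>_. M)
             (\<lambda>m \<omega>. SUP t\<in>{0..T}. \<bar>simple_integral B (n m) (p m) (\<xi> m) t \<omega> - I t \<omega>\<bar>)))"


section \<open>Beta Laguerre processes\<close>

definition ordered_nonneg :: "'a measure \<Rightarrow> nat \<Rightarrow> (nat \<Rightarrow> real \<Rightarrow> 'a \<Rightarrow> real) \<Rightarrow> bool" where
  "ordered_nonneg M N X \<longleftrightarrow>
     (\<forall>\<omega>\<in>space M. \<forall>t\<ge>0. (\<forall>i\<in>{1..N}. 0 \<le> X i t \<omega>) \<and>
        (\<forall>i\<in>{1..N}. \<forall>j\<in>{1..N}. i \<le> j \<longrightarrow> X i t \<omega> \<le> X j t \<omega>))"

definition Laguerre_drift :: "nat \<Rightarrow> real \<Rightarrow> real \<Rightarrow> (nat \<Rightarrow> real) \<Rightarrow> nat \<Rightarrow> real" where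
  "Laguerre_drift N \<alpha> \<beta> x i =
     \<alpha> + \<beta> / 2 * (\<Sum>j\<in>{1..N} - {i}. 2 * x i / (x i - x j))"

definition Dunkl_B_drift :: "nat \<Rightarrow> real \<Rightarrow> real \<Rightarrow> (nat \<Rightarrow> real) \<Rightarrow> nat \<Rightarrow> real" where
  "Dunkl_B_drift N \<alpha> \<beta> y i =
     (\<alpha> - 1/2) / y i + \<beta> / 2 * (\<Sum>j\<in>{1..N} - {i}. 1 / (y i - y j) + 1 / (y i + y j))"

text \<open>In both equations \<open>l\<close> is the deterministic initial position, attained almost surely by the
  integral equation at time \<open>0\<close>. As usual, the drift has to be Lebesgue integrable on compact time
  intervals. Since \<open>1 / 0 = 0\<close> in HOL, the requirement that the drift be defined for almost every
  time is spelled out: the particles are distinct (and, for \<open>y\<close>, nonzero) at almost all times.\<close>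

definition Laguerre_SDE_solution ::
    "'a measure \<Rightarrow> nat \<Rightarrow> (nat \<Rightarrow> real \<Rightarrow> 'a \<Rightarrow> real) \<Rightarrow> real \<Rightarrow> real \<Rightarrow> (nat \<Rightarrow> real) \<Rightarrow>
     (nat \<Rightarrow> real \<Rightarrow> 'a \<Rightarrow> real) \<Rightarrow> bool" where
  "Laguerre_SDE_solution M N b \<alpha> \<beta> l x \<longleftrightarrow>
     (\<forall>i\<in>{1..N}. adapted (BM_filtration M N b) (x i) \<and> continuous_paths M (x i)) \<and>
     ordered_nonneg M N x \<and>
     (AE \<omega> in M. AE s in lborel. 0 \<le> s \<longrightarrow> inj_on (\<lambda>i. x i s \<omega>) {1..N}) \<and>
     (\<forall>i\<in>{1..N}. \<exists>I.
        is_Ito_integral M (BM_filtration M N b) (b i) (\<lambda>s \<omega>. sqrt (2 * x i s \<omega>)) I \<and>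
        (AE \<omega> in M. \<forall>t\<ge>0.
           set_integrable lborel {0..t} (\<lambda>s. Laguerre_drift N \<alpha> \<beta> (\<lambda>j. x j s \<omega>) i) \<and>
           x i t \<omega> = l i + I t \<omega> + (LBINT s:{0..t}. Laguerre_drift N \<alpha> \<beta> (\<lambda>j. x j s \<omega>) i)))"

definition Dunkl_B_SDE_solution ::
    "'a measure \<Rightarrow> nat \<Rightarrow> (nat \<Rightarrow> real \<Rightarrow> 'a \<Rightarrow> real) \<Rightarrow> real \<Rightarrow> real \<Rightarrow> (nat \<Rightarrow> real) \<Rightarrow>
     (nat \<Rightarrow> real \<Rightarrow> 'a \<Rightarrow> real) \<Rightarrow> bool" where
  "Dunkl_B_SDE_solution M N b \<alpha> \<beta> l y \<longleftrightarrow>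
     (\<forall>i\<in>{1..N}. adapted (BM_filtration M N b) (y i) \<and> continuous_paths M (y i)) \<and>
     ordered_nonneg M N y \<and>
     (AE \<omega> in M. AE s in lborel. 0 \<le> s \<longrightarrow>
        inj_on (\<lambda>i. y i s \<omega>) {1..N} \<and> (\<forall>i\<in>{1..N}. y i s \<omega> \<noteq> 0)) \<and>
     (\<forall>i\<in>{1..N}. AE \<omega> in M. \<forall>t\<ge>0.
        set_integrable lborel {0..t} (\<lambda>s. Dunkl_B_drift N \<alpha> \<beta> (\<lambda>j. y j s \<omega>) i) \<and>
        y i t \<omega> = l i + b i t \<omega> + (LBINT s:{0..t}. Dunkl_B_drift N \<alpha> \<beta> (\<lambda>j. y j s \<omega>) i))"

text \<open>\<open>lam\<close> is a beta Laguerre process with \<open>N\<close> particles, started at \<open>l\<close>.\<close>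

definition beta_Laguerre_process ::
    "'a measure \<Rightarrow> nat \<Rightarrow> real \<Rightarrow> real \<Rightarrow> (nat \<Rightarrow> real) \<Rightarrow> (nat \<Rightarrow> real \<Rightarrow> 'a \<Rightarrow> real) \<Rightarrow> bool" where
  "beta_Laguerre_process M N \<alpha> \<beta> l lam \<longleftrightarrow>
     (\<exists>b. independent_BMs M N b \<and>
        (if \<beta> \<ge> 1 then Laguerre_SDE_solution M N b \<alpha> \<beta> l lam
         else \<exists>y. Dunkl_B_SDE_solution M N b \<alpha> \<beta> (\<lambda>i. sqrt (2 * l i)) y \<and>
                (\<forall>i\<in>{1..N}. \<forall>t\<ge>0. \<forall>\<omega>\<in>space M. lam i t \<omega> = (y i t \<omega>)\<^sup>2 / 2)))"


section \<open>Empirical measures and moments\<close>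

definition empirical_moment :: "nat \<Rightarrow> (nat \<Rightarrow> real) \<Rightarrow> nat \<Rightarrow> real" where
  "empirical_moment N x n = (1 / real N) * (\<Sum>i=1..N. x i ^ n)"

definition empirical_measure :: "nat \<Rightarrow> (nat \<Rightarrow> real) \<Rightarrow> real measure" where
  "empirical_measure N x = distr (uniform_count_measure {1..N}) borel x"

text \<open>The moment recursion; the third equation is the one for \<open>m\<^sub>n\<close> with \<open>n = k + 2\<close>.\<close>

fun limit_moment :: "real \<Rightarrow> real \<Rightarrow> (nat \<Rightarrow> real) \<Rightarrow> nat \<Rightarrow> real \<Rightarrow> real" where
  "limit_moment c s a 0 t = 1"
| "limit_moment c s a (Suc 0) t = a 1"
| "limit_moment c s a (Suc (Suc k)) t =
     a (k + 2)
     + s * (c * real (k + 2) / 2) *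
         (\<Sum>j=0..k. integral {0..t} (\<lambda>u. limit_moment c s a j u * limit_moment c s a (k - j) u))
     + s * (1/2) * real (k + 2) * real (k + 1) * integral {0..t} (\<lambda>u. limit_moment c s a k u)"

definition has_moments :: "real measure \<Rightarrow> (nat \<Rightarrow> real) \<Rightarrow> bool" where
  "has_moments \<nu> m \<longleftrightarrow> (\<forall>n. integrable \<nu> (\<lambda>x. x ^ n) \<and> (\<integral>x. x ^ n \<partial>\<nu>) = m n)"


section \<open>Modes of convergence\<close>

text \<open>Convergence in probability of random elements of \<open>C([0,T])\<close> to a non-random element. The
  Borel sets of \<open>C([0,T])\<close> are generated by the evaluations.\<close>

definition random_element_C :: "real \<Rightarrow> 'a measure \<Rightarrow> (real \<Rightarrow> 'a \<Rightarrow> real) \<Rightarrow> bool" where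
  "random_element_C T M X \<longleftrightarrow>
     (\<forall>t\<in>{0..T}. X t \<in> borel_measurable M) \<and>
     (\<forall>\<omega>\<in>space M. continuous_on {0..T} (\<lambda>t. X t \<omega>))"

definition converges_in_prob_C ::
    "real \<Rightarrow> (nat \<Rightarrow> 'a measure) \<Rightarrow> (nat \<Rightarrow> real \<Rightarrow> 'a \<Rightarrow> real) \<Rightarrow> (real \<Rightarrow> real) \<Rightarrow> bool" where
  "converges_in_prob_C T M X x \<longleftrightarrow>
     (\<forall>N\<ge>1. random_element_C T (M N) (X N)) \<and> continuous_on {0..T} x \<and>
     null_in_prob M (\<lambda>N \<omega>. SUP t\<in>{0..T}. \<bar>X N t \<omega> - x t\<bar>)"

text \<open>The weak topology on the probability measures on the real line is the coarsest one making
  \<open>\<nu> \<mapsto> \<integral>f d\<nu>\<close> continuous for every bounded continuous \<open>f\<close>.\<close>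

definition weak_topology :: "real measure topology" where
  "weak_topology = topology_generated_by
     {{\<nu>. real_distribution \<nu> \<and> (\<integral>x. f x \<partial>\<nu>) \<in> U} | f U.
        continuous_on UNIV (f :: real \<Rightarrow> real) \<and> bounded (range f) \<and> open U}"

definition metrizes_weak_topology :: "(real measure \<Rightarrow> real measure \<Rightarrow> real) \<Rightarrow> bool" where
  "metrizes_weak_topology d \<longleftrightarrow>
     Metric_space {\<nu>. real_distribution \<nu>} d \<and>
     Metric_space.mtopology {\<nu>. real_distribution \<nu>} d = weak_topology"

text \<open>The Borel sigma-algebra of the weak topology is the one of \<open>prob_algebra borel\<close>.\<close>

definition random_element_CP :: "real \<Rightarrow> 'a measure \<Rightarrow> (real \<Rightarrow> 'a \<Rightarrow> real measure) \<Rightarrow> bool" where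
  "random_element_CP T M X \<longleftrightarrow>
     (\<forall>t\<in>{0..T}. X t \<in> M \<rightarrow>\<^sub>M prob_algebra borel) \<and>
     (\<forall>\<omega>\<in>space M. continuous_map (top_of_set {0..T}) weak_topology (\<lambda>t. X t \<omega>))"

definition converges_in_prob_CP ::
    "(real measure \<Rightarrow> real measure \<Rightarrow> real) \<Rightarrow> real \<Rightarrow> (nat \<Rightarrow> 'a measure) \<Rightarrow>
     (nat \<Rightarrow> real \<Rightarrow> 'a \<Rightarrow> real measure) \<Rightarrow> (real \<Rightarrow> real measure) \<Rightarrow> bool" where
  "converges_in_prob_CP d T M X \<mu> \<longleftrightarrow>
     (\<forall>N\<ge>1. random_element_CP T (M N) (X N)) \<and>
     continuous_map (top_of_set {0..T}) weak_topology \<mu> \<and>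
     null_in_prob M (\<lambda>N \<omega>. SUP t\<in>{0..T}. d (X N t \<omega>) (\<mu> t))"

lemma topspace_weak_topology: "topspace weak_topology = {\<nu>. real_distribution \<nu>}"
proof -
  have "{\<nu>. real_distribution \<nu> \<and> (\<integral>x. 0 \<partial>\<nu>) \<in> (UNIV :: real set)} \<in>
     {{\<nu>. real_distribution \<nu> \<and> (\<integral>x. f x \<partial>\<nu>) \<in> U} | f U.
        continuous_on UNIV (f :: real \<Rightarrow> real) \<and> bounded (range f) \<and> open U}"
    by (intro CollectI exI[of _ "\<lambda>_. 0"] exI[of _ UNIV]) auto
  then show ?thesis
    unfolding weak_topology_def topology_generated_by_topspace by blast
qed

lemma measure_empirical_measure:
  assumes "N \<ge> 1" "A \<in> sets borel"
  shows "measure (empirical_measure N x) A = (1 / real N) * (\<Sum>i=1..N. indicator A (x i))"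
proof -
  have "measure (empirical_measure N x) A = real (card {i\<in>{1..N}. x i \<in> A}) / real N"
    unfolding empirical_measure_def using assms
    by (subst measure_distr)
      (auto simp: space_uniform_count_measure measurable_def sets_uniform_count_measure
        measure_uniform_count_measure intro!: arg_cong[where f=card])
  also have "real (card {i\<in>{1..N}. x i \<in> A}) = (\<Sum>i=1..N. indicator A (x i))"
    by (simp add: indicator_def of_bool_def sum.If_cases Int_def)
  finally show ?thesis by simp
qed

end

theory Submission
  imports Defs "HOL-Computational_Algebra.Polynomial"
begin

text \<open>As \<open>\<beta> = 2c/N < 1\<close> for large \<open>N\<close>, only the Dunkl representation \<open>y\<^sub>i = y\<^sub>i(0) + b\<^sub>i + \<integral>a\<^sub>i\<close>
  matters in the limit, and no stochastic integral is needed: along the partitions of mesh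
  \<open>T/4\<^sup>m\<close>, a pathwise second order Taylor expansion writes the moments of the empirical measure as
  a discrete martingale plus \<open>\<integral>\<close>drift plus an error vanishing almost surely as \<open>m \<rightarrow> \<infinity>\<close>, and
  the martingales are controlled by Kolmogorov's maximal inequality.
  The singular interaction, antisymmetrised, is a polynomial in the moments, and the drift of \<open>S\<^sub>n\<close>
  only involves \<open>S\<^sub>0, \<dots>, S\<^sub>n\<^sub>-\<^sub>1\<close>. Applying the expansion to \<open>ln (1 + S\<^sub>2\<^sub>r)\<close> bounds the moments
  uniformly in \<open>N\<close>; the bracket of \<open>S\<^sub>r\<close> is then \<open>O(1/N)\<close>, so the noise disappears and the limits
  are found by induction on \<open>n\<close>.
  The growth condition is inherited by the limiting moments and makes the characteristic
  function analytic in a strip, so that they determine \<open>\<mu>\<^sub>t\<close>; the method of moments and compactness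
  of \<open>[0,T]\<close> turn convergence of the moments into uniform weak convergence.\<close>

section \<open>A discrete maximal inequality\<close>

text \<open>The bracket of \<open>S_n\<close> involves \<open>S_(2n-1)\<close>, so bounding the
  noise of one moment calls for a higher one, without end. The logarithm breaks this chain. For even
  \<open>n\<close>, \<open>sum x_i^(2n) \<le> (sum x_i^n)^2\<close> bounds the bracket of
  \<open>V = 1 + S_n\<close> by a constant times \<open>V^2\<close>; its drift is at most a constant
  times \<open>V\<close>, because a product \<open>S_k S_l\<close> with \<open>k + l \<le> n\<close>
  is an average over pairs of particles. So the drift of \<open>ln V\<close> is bounded above and
  its bracket is bounded, with constants free of \<open>N\<close>. A second obstacle is adaptedness:
  Brownian motion is defined path by path, with independent paths, while solutions are adapted to
  the joint augmented filtration. Independence of an increment from that filtration, and from the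
  other paths at all times, has to be derived. For a given mesh the martingale maxima are only
  bounded in probability. Outside a set of small probability the estimates therefore hold for
  infinitely many \<open>m\<close>, and continuity of the paths carries them to all times.\<close>

lemma abs_le_one_plus_square: "\<bar>x\<bar> \<le> 1 + x\<^sup>2" for x :: real
  using zero_le_power2[of "\<bar>x\<bar> - 1/2"] unfolding power2_diff power2_abs by (simp add: power_divide)

text \<open>The martingale property is expressed as orthogonality of \<open>d k\<close> to bounded
  \<open>F k\<close>-measurable variables, which avoids conditional expectations. The second moment
  of the stopped sum is at most the sum of the second moments of the increments; Markov's inequality
  for its square then gives the maximal bound.\<close>

lemma (in prob_space) kolmogorov_martingale_inequality:
  fixes d :: "nat \<Rightarrow> 'a \<Rightarrow> real" and F :: "nat \<Rightarrow> 'a measure"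
  assumes sub: "\<And>k. subalgebra M (F k)" and mono: "\<And>k. sets (F k) \<subseteq> sets (F (Suc k))"
    and meas: "\<And>k. d k \<in> borel_measurable (F (Suc k))"
    and int: "\<And>k. integrable M (\<lambda>\<omega>. (d k \<omega>)\<^sup>2)"
    and mart: "\<And>k Z. Z \<in> borel_measurable (F k) \<Longrightarrow> (\<exists>C. \<forall>\<omega>. \<bar>Z \<omega>\<bar> \<le> C) \<Longrightarrow>
                 expectation (\<lambda>\<omega>. Z \<omega> * d k \<omega>) = 0"
    and "e > 0"
  shows "{\<omega>\<in>space M. \<exists>k\<le>n. e \<le> \<bar>\<Sum>j<k. d j \<omega>\<bar>} \<in> events"
    and "prob {\<omega>\<in>space M. \<exists>k\<le>n. e \<le> \<bar>\<Sum>j<k. d j \<omega>\<bar>}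
           \<le> (\<Sum>j<n. expectation (\<lambda>\<omega>. (d j \<omega>)\<^sup>2)) / e\<^sup>2"
proof -
  have spF: "space (F k) = space M" for k
    using sub by (auto simp: subalgebra_def)
  have FM: "sets (F k) \<subseteq> sets M" for k
    using sub by (auto simp: subalgebra_def)
  have measM[measurable]: "d k \<in> borel_measurable M" for k
    using measurable_from_subalg[OF sub meas] .
  show ev[measurable]: "{\<omega>\<in>space M. \<exists>k\<le>n. e \<le> \<bar>\<Sum>j<k. d j \<omega>\<bar>} \<in> events" by measurable
  \<comment> \<open>\<open>Y\<close> follows the partial sums of \<open>d\<close> and freezes once
    its absolute value reaches \<open>e\<close>.\<close>
  define Y where "Y = rec_nat (\<lambda>_. 0) (\<lambda>k y \<omega>. y \<omega> + (if \<bar>y \<omega>\<bar> < e then d k \<omega> else 0))"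
  have Y0: "Y 0 = (\<lambda>_. 0)" and YS: "Y (Suc k) = (\<lambda>\<omega>. Y k \<omega> + (if \<bar>Y k \<omega>\<bar> < e then d k \<omega> else 0))" for k
    by (simp_all add: Y_def)
  have dF: "f \<in> borel_measurable (F (Suc k))" if "f \<in> borel_measurable (F k)" for f :: "'a \<Rightarrow> real" and k
    using that mono[of k] spF by (auto simp: measurable_def)
  have Ym: "Y k \<in> borel_measurable (F k)" for k
  proof (induction k)
    case (Suc k)
    note [measurable] = dF[OF Suc] meas[of k]
    show ?case unfolding YS by measurable
  qed (simp add: Y0)
  have YM[measurable]: "Y k \<in> borel_measurable M" for k
    using measurable_from_subalg[OF sub Ym] .
  have E: "integrable M (\<lambda>\<omega>. (Y k \<omega>)\<^sup>2) \<and>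
     expectation (\<lambda>\<omega>. (Y k \<omega>)\<^sup>2) \<le> (\<Sum>j<k. expectation (\<lambda>\<omega>. (d j \<omega>)\<^sup>2))" for k
  proof (induction k)
    case (Suc k)
    \<comment> \<open>While the walk is running it is bounded by \<open>e\<close>, so the cross term
      in \<open>(Y (Suc k))^2\<close> involves a bounded \<open>Z\<close> and vanishes by
      \<open>mart\<close>, although \<open>Y\<close> itself is unbounded after the last
      jump.\<close>
    define Z where "Z \<omega> = (if \<bar>Y k \<omega>\<bar> < e then Y k \<omega> else 0)" for \<omega>
    define c where "c \<omega> = (if \<bar>Y k \<omega>\<bar> < e then 1 else 0 :: real)" for \<omega>
    have ZF: "Z \<in> borel_measurable (F k)" unfolding Z_def using Ym[of k] by measurable
    have ZM[measurable]: "Z \<in> borel_measurable M" unfolding Z_def by measurable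
    have cM[measurable]: "c \<in> borel_measurable M" unfolding c_def by measurable
    have Zb: "\<bar>Z \<omega>\<bar> \<le> e" for \<omega> using \<open>e > 0\<close> by (auto simp: Z_def)
    have Zd: "expectation (\<lambda>\<omega>. Z \<omega> * d k \<omega>) = 0" using mart[OF ZF] Zb by blast
    have iZd: "integrable M (\<lambda>\<omega>. Z \<omega> * d k \<omega>)"
    proof (rule Bochner_Integration.integrable_bound[where f="\<lambda>\<omega>. e * (1 + (d k \<omega>)\<^sup>2)"])
      show "AE \<omega> in M. norm (Z \<omega> * d k \<omega>) \<le> norm (e * (1 + (d k \<omega>)\<^sup>2))"
      proof (intro AE_I2)
        fix \<omega>
        have "\<bar>d k \<omega>\<bar> \<le> 1 + (d k \<omega>)\<^sup>2"
          by (rule abs_le_one_plus_square)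
        then have "\<bar>Z \<omega>\<bar> * \<bar>d k \<omega>\<bar> \<le> e * (1 + (d k \<omega>)\<^sup>2)"
          using Zb[of \<omega>] by (intro mult_mono) auto
        then show "norm (Z \<omega> * d k \<omega>) \<le> norm (e * (1 + (d k \<omega>)\<^sup>2))" using \<open>e > 0\<close> by (simp add: abs_mult)
      qed
    qed (use int in auto)
    have icd: "integrable M (\<lambda>\<omega>. c \<omega> * (d k \<omega>)\<^sup>2)"
      by (rule Bochner_Integration.integrable_bound[OF int[of k]]) (auto simp: c_def)
    have eq: "(Y (Suc k) \<omega>)\<^sup>2 = (Y k \<omega>)\<^sup>2 + 2 * (Z \<omega> * d k \<omega>) + c \<omega> * (d k \<omega>)\<^sup>2" for \<omega>
      by (simp add: YS Z_def c_def power2_sum)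
    have "expectation (\<lambda>\<omega>. c \<omega> * (d k \<omega>)\<^sup>2) \<le> expectation (\<lambda>\<omega>. (d k \<omega>)\<^sup>2)"
      by (rule integral_mono[OF icd int]) (auto simp: c_def)
    then show ?case unfolding eq using Suc iZd icd Zd by simp
  qed (simp add: Y0)
  have stop: "Y k \<omega> = Y j \<omega>" if "e \<le> \<bar>Y j \<omega>\<bar>" "j \<le> k" for j k :: nat and \<omega>
    using that(2)
  proof (induction k rule: dec_induct)
    case (step k) then show ?case using that(1) by (simp add: YS)
  qed simp
  \<comment> \<open>A walk that has not been frozen up to \<open>k\<close> still agrees with the
    partial sums, so a large partial sum forces \<open>Y\<close> to have stopped at a large
    value.\<close>
  have hit: "e \<le> \<bar>Y k \<omega>\<bar>" if "e \<le> \<bar>\<Sum>j<k. d j \<omega>\<bar>" for k \<omega>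
  proof (rule ccontr)
    assume "\<not> e \<le> \<bar>Y k \<omega>\<bar>"
    then have lt: "\<bar>Y j \<omega>\<bar> < e" if "j \<le> k" for j using stop[of j \<omega> k] that by fastforce
    have "j \<le> k \<Longrightarrow> Y j \<omega> = (\<Sum>i<j. d i \<omega>)" for j
    proof (induction j)
      case (Suc j) then show ?case using lt[of j] by (simp add: YS)
    qed (simp add: Y0)
    then show False using that lt[of k] by simp
  qed
  have "{\<omega>\<in>space M. \<exists>k\<le>n. e \<le> \<bar>\<Sum>j<k. d j \<omega>\<bar>} \<subseteq> {\<omega>\<in>space M. e\<^sup>2 \<le> (Y n \<omega>)\<^sup>2}"
  proof safe
    fix \<omega> k assume "k \<le> n" "e \<le> \<bar>\<Sum>j<k. d j \<omega>\<bar>"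
    then have "e \<le> \<bar>Y n \<omega>\<bar>" using hit[of \<omega> k] stop[of k \<omega> n] by simp
    then show "e\<^sup>2 \<le> (Y n \<omega>)\<^sup>2" using \<open>e > 0\<close> by (metis abs_le_square_iff abs_of_pos)
  qed
  then have "prob {\<omega>\<in>space M. \<exists>k\<le>n. e \<le> \<bar>\<Sum>j<k. d j \<omega>\<bar>} \<le> prob {\<omega>\<in>space M. e\<^sup>2 \<le> (Y n \<omega>)\<^sup>2}"
    by (intro finite_measure_mono) measurable
  also have "\<dots> \<le> expectation (\<lambda>\<omega>. (Y n \<omega>)\<^sup>2) / e\<^sup>2"
    using integral_Markov_inequality_measure[of M "\<lambda>\<omega>. (Y n \<omega>)\<^sup>2" "space M" "e\<^sup>2"] E[of n] \<open>e > 0\<close> by simp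
  also have "\<dots> \<le> (\<Sum>j<n. expectation (\<lambda>\<omega>. (d j \<omega>)\<^sup>2)) / e\<^sup>2"
    using E[of n] by (simp add: divide_right_mono)
  finally show "prob {\<omega>\<in>space M. \<exists>k\<le>n. e \<le> \<bar>\<Sum>j<k. d j \<omega>\<bar>}
           \<le> (\<Sum>j<n. expectation (\<lambda>\<omega>. (d j \<omega>)\<^sup>2)) / e\<^sup>2" .
qed

text \<open>The first two moments make the discrete increments centred, the fourth gives the
  variance of \<open>X^2 - h\<close>, and the absolute third enters the cubic variation; there the
  exact constant \<open>2 * sqrt (2 / pi)\<close> is rounded up to 2.\<close>

lemma centred_normal_moments:
  assumes D: "distributed M lborel X (normal_density 0 (sqrt h))" and "h > 0"
  shows "integrable M X" "integral\<^sup>L M X = 0"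
    "integrable M (\<lambda>\<omega>. (X \<omega>)\<^sup>2)" "integral\<^sup>L M (\<lambda>\<omega>. (X \<omega>)\<^sup>2) = h"
    "integrable M (\<lambda>\<omega>. (X \<omega>) ^ 4)" "integral\<^sup>L M (\<lambda>\<omega>. (X \<omega>) ^ 4) = 3 * h\<^sup>2"
    "integrable M (\<lambda>\<omega>. \<bar>X \<omega>\<bar> ^ 3)" "integral\<^sup>L M (\<lambda>\<omega>. \<bar>X \<omega>\<bar> ^ 3) \<le> 2 * sqrt h ^ 3"
proof -
  have s: "sqrt h > 0" using \<open>h > 0\<close> by simp
  have tr: "integrable M (\<lambda>\<omega>. g (X \<omega>)) \<and> integral\<^sup>L M (\<lambda>\<omega>. g (X \<omega>)) = v"
    if "g \<in> borel_measurable borel" "has_bochner_integral lborel (\<lambda>x. normal_density 0 (sqrt h) x * g x) v"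
    for g :: "real \<Rightarrow> real" and v
    using distributed_integrable[OF D, of g] distributed_integral[OF D, of g] that
    by (auto simp: has_bochner_integral_iff)
  show "integrable M X" "integral\<^sup>L M X = 0"
    using tr[OF _ normal_moment_odd[OF s, of 0 0, simplified]] by simp_all
  show "integrable M (\<lambda>\<omega>. (X \<omega>)\<^sup>2)" "integral\<^sup>L M (\<lambda>\<omega>. (X \<omega>)\<^sup>2) = h"
    using tr[of "\<lambda>x. x\<^sup>2" h] normal_moment_even[OF s, of 0 1] \<open>h > 0\<close> by (simp_all add: eval_nat_numeral)
  show "integrable M (\<lambda>\<omega>. (X \<omega>) ^ 4)" "integral\<^sup>L M (\<lambda>\<omega>. (X \<omega>) ^ 4) = 3 * h\<^sup>2"
    using tr[of "\<lambda>x. x ^ 4" "3 * h\<^sup>2"] normal_moment_even[OF s, of 0 2] \<open>h > 0\<close>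
    by (simp_all add: fact_numeral field_simps)
  have "2 * sqrt h ^ 3 * sqrt (2 / pi) \<le> 2 * sqrt h ^ 3"
    using pi_ge_two s by (intro mult_left_le) (auto simp: real_sqrt_le_1_iff)
  then show "integrable M (\<lambda>\<omega>. \<bar>X \<omega>\<bar> ^ 3)" "integral\<^sup>L M (\<lambda>\<omega>. \<bar>X \<omega>\<bar> ^ 3) \<le> 2 * sqrt h ^ 3"
    using tr[of "\<lambda>x. \<bar>x\<bar> ^ 3"] normal_moment_abs_odd[OF s, of 0 1] by (simp_all add: numeral_3_eq_3)
qed

text \<open>The sum over \<open>m\<close> of the \<open>Z m\<close> has finite expectation, hence
  converges almost surely, and the terms of a convergent series tend to 0.\<close>

lemma (in prob_space) AE_LIMSEQ_0_of_geometric_expectation: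
  fixes Z :: "nat \<Rightarrow> 'a \<Rightarrow> real"
  assumes int: "\<And>m. integrable M (Z m)" and pos: "\<And>m \<omega>. 0 \<le> Z m \<omega>"
    and le: "\<And>m. expectation (Z m) \<le> C * (1/2) ^ m"
  shows "AE \<omega> in M. (\<lambda>m. Z m \<omega>) \<longlonglongrightarrow> 0"
proof -
  have [measurable]: "Z m \<in> borel_measurable M" for m using int by auto
  have "0 \<le> expectation (Z 0)" using pos by (intro Bochner_Integration.integral_nonneg) auto
  then have "C \<ge> 0" using le[of 0] by simp
  have "(\<integral>\<^sup>+\<omega>. (\<Sum>m. ennreal (Z m \<omega>)) \<partial>M) = (\<Sum>m. \<integral>\<^sup>+\<omega>. ennreal (Z m \<omega>) \<partial>M)"
    by (rule nn_integral_suminf) simp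
  also have "\<dots> \<le> (\<Sum>m. ennreal (C * (1/2) ^ m))"
    using le pos int by (intro suminf_le) (auto simp: nn_integral_eq_integral intro!: ennreal_leI)
  also have "\<dots> = ennreal (\<Sum>m. C * (1/2) ^ m)"
    using \<open>C \<ge> 0\<close> by (intro suminf_ennreal2 summable_mult summable_geometric) auto
  also have "\<dots> < \<infinity>" by simp
  finally have "AE \<omega> in M. (\<Sum>m. ennreal (Z m \<omega>)) \<noteq> \<infinity>"
    by (intro nn_integral_noteq_infinite) auto
  then show ?thesis
  proof eventually_elim
    case (elim \<omega>)
    then have "summable (\<lambda>m. Z m \<omega>)" by (intro summable_suminf_not_top) (auto simp: pos)
    then show ?case by (rule summable_LIMSEQ_zero)
  qed
qed

section \<open>Increments of independent Brownian motions\<close>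

locale independent_brownian_motions = prob_space M for M :: "'a measure" +
  fixes N :: nat and b :: "nat \<Rightarrow> real \<Rightarrow> 'a \<Rightarrow> real"
  assumes BMs: "independent_BMs M N b"
begin

lemma BM: "i \<in> {1..N} \<Longrightarrow> standard_BM M (b i)"
  using BMs by (simp add: independent_BMs_def)

lemma BM_measurable [measurable (raw)]: "i \<in> {1..N} \<Longrightarrow> 0 \<le> t \<Longrightarrow> b i t \<in> borel_measurable M"
  using BM by (simp add: standard_BM_def)

definition path :: "nat \<Rightarrow> 'a \<Rightarrow> real \<Rightarrow> real" where
  "path i \<omega> = (\<lambda>t\<in>{0..}. b i t \<omega>)"

definition path_events :: "nat \<Rightarrow> 'a set set" where
  "path_events i = {path i -` A \<inter> space M | A. A \<in> sets (\<Pi>\<^sub>M t\<in>{0..}. borel)}"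

definition others_events :: "nat \<Rightarrow> 'a set set" where
  "others_events i = sigma_sets (space M) (\<Union>j\<in>{1..N} - {i}. path_events j)"

lemma null_sets_subset_Pow: "null_sets M \<subseteq> Pow (space M)"
  using sets.sets_into_space by blast

text \<open>The information on which the increments of \<open>b i\<close> after time \<open>s\<close> do not depend.\<close>

definition past_and_others :: "nat \<Rightarrow> real \<Rightarrow> 'a measure" where
  "past_and_others i s = sigma (space M)
     ({b i u -` A \<inter> space M | u A. 0 \<le> u \<and> u \<le> s \<and> A \<in> sets borel} \<union>
      {b j u -` A \<inter> space M | j u A. j \<in> {1..N} - {i} \<and> 0 \<le> u \<and> A \<in> sets borel} \<union> null_sets M)"

lemma path_in_space: "path i \<omega> \<in> space (\<Pi>\<^sub>M t\<in>{0..}. borel)"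
  by (simp add: path_def space_PiM)

lemma path_eval: "0 \<le> t \<Longrightarrow> b i t -` A \<inter> space M = path i -` ((\<lambda>f. f t) -` A \<inter> space (\<Pi>\<^sub>M t\<in>{0..}. borel)) \<inter> space M"
  using path_in_space by (auto simp: path_def)

lemma eval_in_path_events: "0 \<le> t \<Longrightarrow> A \<in> sets borel \<Longrightarrow> b i t -` A \<inter> space M \<in> path_events i"
  unfolding path_events_def
  by (intro CollectI exI conjI, erule path_eval) (auto intro!: measurable_sets[OF measurable_component_singleton])

lemma Int_stable_path_events: "Int_stable (path_events i)"
proof (rule Int_stableI)
  fix A B assume "A \<in> path_events i" "B \<in> path_events i"
  then obtain A' B' where "A' \<in> sets (\<Pi>\<^sub>M t\<in>{0..}. borel)" "B' \<in> sets (\<Pi>\<^sub>M t\<in>{0..}. borel)"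
    "A = path i -` A' \<inter> space M" "B = path i -` B' \<inter> space M" unfolding path_events_def by auto
  then show "A \<inter> B \<in> path_events i"
    unfolding path_events_def by (intro CollectI exI[of _ "A' \<inter> B'"]) auto
qed

text \<open>The independent paths are regrouped into the two blocks \<open>{i}\<close> and
  \<open>{1..N} - {i}\<close>, indexed by booleans because \<open>indep_set\<close> is a family over
  \<open>bool\<close>.\<close>

lemma indep_others:
  assumes i: "i \<in> {1..N}" and A: "A \<in> others_events i" and B: "B \<in> path_events i"
  shows "A \<in> events" "B \<in> events" "prob (A \<inter> B) = prob A * prob B"
proof -
  define J where "J c = (if c then {1..N} - {i} else {i})" for c
  have U: "(\<Union>c\<in>UNIV. J c) = {1..N}" using i by (auto simp: J_def UNIV_bool simp del: One_nat_def)
  have "indep_sets path_events {1..N}"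
    using BMs unfolding independent_BMs_def indep_vars_def2 path_events_def path_def[abs_def] by simp
  then have "indep_sets path_events (\<Union>c\<in>UNIV. J c)" unfolding U .
  then have "indep_sets (\<lambda>c. sigma_sets (space M) (\<Union>j\<in>J c. path_events j)) UNIV"
    by (rule indep_sets_collect_sigma) (auto simp: Int_stable_path_events disjoint_family_on_def J_def)
  then have "indep_set (others_events i) (sigma_sets (space M) (path_events i))"
    unfolding indep_set_def others_events_def
    by (rule indep_sets_mono_sets) (auto split: bool.split simp: J_def)
  moreover have "B \<in> sigma_sets (space M) (path_events i)" using B by (rule sigma_sets.Basic)
  ultimately show "A \<in> events" "B \<in> events" "prob (A \<inter> B) = prob A * prob B"
    using A unfolding indep_sets2_eq by auto
qed

text \<open>Up to a null set, a cylinder event of the past is a function of increments that precede \<open>s\<close>.\<close>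

lemma indep_past_increment:
  assumes i: "i \<in> {1..N}" and st: "0 \<le> s" "s < t" and U: "finite U" "U \<subseteq> {0..s}"
    and A: "\<And>u. u \<in> U \<Longrightarrow> A u \<in> sets borel" and D: "D \<in> sets borel"
  shows "prob {\<omega>\<in>space M. (\<forall>u\<in>U. b i u \<omega> \<in> A u) \<and> b i t \<omega> - b i s \<omega> \<in> D}
       = prob {\<omega>\<in>space M. \<forall>u\<in>U. b i u \<omega> \<in> A u} * prob {\<omega>\<in>space M. b i t \<omega> - b i s \<omega> \<in> D}"
proof -
  \<comment> \<open>With 0 and \<open>s\<close> added to the grid, every \<open>b i u\<close> with
    \<open>u\<close> in \<open>U\<close> is a sum of grid increments, and the step beyond the last
    grid point is the one from \<open>s\<close> to \<open>t\<close>.\<close>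
  define U' where "U' = insert 0 (insert s U)"
  have U': "finite U'" "U' \<subseteq> {0..s}" "0 \<in> U'" "s \<in> U'" using U st by (auto simp: U'_def)
  define n where "n = card U'"
  have "n > 0" using U' by (auto simp: n_def card_gt_0_iff)
  define xs where "xs = sorted_list_of_set U'"
  have xs: "length xs = n" "set xs = U'" "sorted_wrt (<) xs"
    using U' by (simp_all add: xs_def n_def)
  define p where "p k = (if k < n then xs ! k else t)" for k
  have pU: "p k \<in> U'" if "k < n" for k using that xs by (auto simp: p_def)
  have p0: "p 0 = 0"
  proof -
    obtain k where k: "k < n" "xs ! k = 0" using U'(3) xs by (metis in_set_conv_nth)
    have "xs ! 0 \<le> xs ! k" using k xs by (intro sorted_nth_mono) (auto simp: strict_sorted_iff simp del: sorted_wrt.simps)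
    moreover have "xs ! 0 \<ge> 0" using pU[of 0] \<open>n > 0\<close> U' by (auto simp: p_def)
    ultimately show ?thesis using k \<open>n > 0\<close> by (simp add: p_def)
  qed
  have pl: "p (n - 1) = s"
  proof -
    obtain k where k: "k < n" "xs ! k = s" using U'(4) xs by (metis in_set_conv_nth)
    have "xs ! k \<le> xs ! (n - 1)" using k xs by (intro sorted_nth_mono) (auto simp: strict_sorted_iff simp del: sorted_wrt.simps)
    moreover have "xs ! (n - 1) \<le> s" using pU[of "n - 1"] \<open>n > 0\<close> U' by (auto simp: p_def)
    ultimately show ?thesis using k \<open>n > 0\<close> by (simp add: p_def)
  qed
  have pn: "p n = t" by (simp add: p_def)
  have pmono: "strict_mono_on {..n} p"
  proof (rule strict_mono_onI)
    fix k l assume kl: "k \<in> {..n}" "l \<in> {..n}" "k < l"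
    show "p k < p l"
    proof (cases "l < n")
      case True
      then show ?thesis using kl xs by (simp add: p_def sorted_wrt_nth_less)
    next
      case False
      then have "p l = t" "k < n" using kl by (auto simp: p_def)
      then show ?thesis using pU[of k] U' st by force
    qed
  qed
  define X where "X k \<omega> = b i (p (Suc k)) \<omega> - b i (p k) \<omega>" for k \<omega>
  have "indep_vars (\<lambda>_. borel) X {..<n}"
    using BM[OF i] pmono p0 unfolding standard_BM_def X_def[abs_def] by auto
  \<comment> \<open>The increments with index below \<open>n - 1\<close> make up the past; the one
    with index \<open>n - 1\<close> is \<open>b i t - b i s\<close>.\<close>
  then have ind: "indep_var (PiM {..<n-1} (\<lambda>_. borel)) (\<lambda>\<omega>. restrict (\<lambda>k. X k \<omega>) {..<n-1})
      (PiM {n-1} (\<lambda>_. borel)) (\<lambda>\<omega>. restrict (\<lambda>k. X k \<omega>) {n-1})"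
    using \<open>n > 0\<close> by (intro indep_var_restrict) auto
  define idx where "idx u = (SOME k. k < n \<and> p k = u)" for u
  have idx: "idx u < n" "p (idx u) = u" if "u \<in> U" for u
  proof -
    have "\<exists>k. k < n \<and> p k = u" using that xs by (metis U'_def insertCI in_set_conv_nth p_def)
    then show "idx u < n" "p (idx u) = u" unfolding idx_def by (metis (mono_tags, lifting) someI_ex)+
  qed
  \<comment> \<open>The cylinder event rewritten in terms of increments. It agrees with the original
    only where \<open>b i 0 = 0\<close>, hence up to a null set.\<close>
  define P where "P f \<longleftrightarrow> (\<forall>u\<in>U. (\<Sum>k<idx u. f k) \<in> A u)" for f :: "nat \<Rightarrow> real"
  have mP: "{f \<in> space (PiM {..<n-1} (\<lambda>_. borel)). P f} \<in> sets (PiM {..<n-1} (\<lambda>_. borel))"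
    unfolding P_def
  proof (rule sets.sets_Collect_finite_All[OF _ U(1)])
    fix u assume u: "u \<in> U"
    have "(\<lambda>f. \<Sum>k<idx u. f k) \<in> borel_measurable (PiM {..<n-1} (\<lambda>_. borel :: real measure))"
      using idx(1)[OF u] by (intro borel_measurable_sum measurable_component_singleton) auto
    from measurable_sets[OF this A[OF u]]
    show "{f \<in> space (PiM {..<n-1} (\<lambda>_. borel)). (\<Sum>k<idx u. f k) \<in> A u} \<in> sets (PiM {..<n-1} (\<lambda>_. borel))"
      by (simp add: vimage_def Int_def conj_commute)
  qed
  have PX: "P (restrict (\<lambda>k. X k \<omega>) {..<n-1}) \<longleftrightarrow> (\<forall>u\<in>U. b i u \<omega> \<in> A u)" if "b i 0 \<omega> = 0" for \<omega>
  proof -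
    have "(\<Sum>k<idx u. restrict (\<lambda>k. X k \<omega>) {..<n-1} k) = b i u \<omega>" if "u \<in> U" for u
    proof -
      have "(\<Sum>k<idx u. restrict (\<lambda>k. X k \<omega>) {..<n-1} k) = (\<Sum>k<idx u. X k \<omega>)"
        using idx(1)[OF that] by (intro sum.cong) auto
      also have "\<dots> = b i u \<omega>" unfolding X_def using sum_lessThan_telescope[of "\<lambda>k. b i (p k) \<omega>" "idx u"] idx(2)[OF that] \<open>b i 0 \<omega> = 0\<close> p0
        by simp
      finally show ?thesis .
    qed
    then show ?thesis by (simp add: P_def)
  qed
  have AE0: "AE \<omega> in M. b i 0 \<omega> = 0" using BM[OF i] by (simp add: standard_BM_def)
  define E1 where "E1 = {\<omega>\<in>space M. P (restrict (\<lambda>k. X k \<omega>) {..<n-1})}"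
  define E2 where "E2 = {\<omega>\<in>space M. b i t \<omega> - b i s \<omega> \<in> D}"
  define E3 where "E3 = {\<omega>\<in>space M. \<forall>u\<in>U. b i u \<omega> \<in> A u}"
  have e1: "E1 = (\<lambda>\<omega>. restrict (\<lambda>k. X k \<omega>) {..<n-1}) -` {f \<in> space (PiM {..<n-1} (\<lambda>_. borel)). P f} \<inter> space M"
    by (auto simp: E1_def space_PiM)
  have e2: "E2 = (\<lambda>\<omega>. restrict (\<lambda>k. X k \<omega>) {n-1}) -` {f \<in> space (PiM {n-1} (\<lambda>_. borel)). f (n-1) \<in> D} \<inter> space M"
    using \<open>n > 0\<close> pn pl by (auto simp: E2_def space_PiM X_def)
  have mD: "{f \<in> space (PiM {n-1} (\<lambda>_. borel :: real measure)). f (n-1) \<in> D} \<in> sets (PiM {n-1} (\<lambda>_. borel))"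
    using D by measurable
  have "prob (E1 \<inter> E2) = prob E1 * prob E2"
  proof -
    have "indep_set {X1 -` A \<inter> space M | A. A \<in> sets (PiM {..<n-1} (\<lambda>_. borel))}
       {X2 -` A \<inter> space M | A. A \<in> sets (PiM {n-1} (\<lambda>_. borel))}" if
      "X1 = (\<lambda>\<omega>. restrict (\<lambda>k. X k \<omega>) {..<n-1})" "X2 = (\<lambda>\<omega>. restrict (\<lambda>k. X k \<omega>) {n-1})" for X1 X2
      using ind unfolding that indep_var_eq indep_sets2_eq by (auto 0 3)
    from indep_setD[OF this[OF refl refl]] show ?thesis using mP mD unfolding e1 e2 by blast
  qed
  moreover have ev: "E1 \<in> events" "E2 \<in> events" "E3 \<in> events"
  proof -
    show "E1 \<in> events" unfolding e1 using indep_var_rv1[OF ind] mP by (rule measurable_sets)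
    show "E2 \<in> events" unfolding e2 using indep_var_rv2[OF ind] mD by (rule measurable_sets)
    show "E3 \<in> events" unfolding E3_def using U i A
      by (intro sets.sets_Collect_finite_All) (auto intro!: measurable_sets_Collect[OF BM_measurable])
  qed
  moreover have "prob E1 = prob E3"
    by (rule finite_measure_eq_AE[OF _ ev(1,3)]) (use AE0 in eventually_elim, auto simp: E1_def E3_def PX simp del: One_nat_def)
  moreover have "prob (E1 \<inter> E2) = prob (E3 \<inter> E2)"
    by (rule finite_measure_eq_AE[OF _ sets.Int[OF ev(1,2)] sets.Int[OF ev(3,2)]])
      (use AE0 in eventually_elim, auto simp: E1_def E3_def PX simp del: One_nat_def)
  moreover have "{\<omega>\<in>space M. (\<forall>u\<in>U. b i u \<omega> \<in> A u) \<and> b i t \<omega> - b i s \<omega> \<in> D} = E3 \<inter> E2"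
    by (auto simp: E3_def E2_def)
  ultimately show ?thesis by (simp add: E2_def E3_def)
qed

text \<open>Membership is required only up to a null set, so that the null sets augmenting the
  filtration lie in this pi-system too and Dynkin's argument covers them.\<close>

definition past_cylinders :: "nat \<Rightarrow> real \<Rightarrow> 'a set set" where
  "past_cylinders i s = {C \<in> events. \<exists>A\<in>others_events i. \<exists>U B. finite U \<and> U \<subseteq> {0..s} \<and>
     (\<forall>u\<in>U. B u \<in> sets borel) \<and> (AE \<omega> in M. \<omega> \<in> C \<longleftrightarrow> \<omega> \<in> A \<and> (\<forall>u\<in>U. b i u \<omega> \<in> B u))}"

lemma others_sigma_algebra: "sigma_algebra (space M) (others_events i)"
  unfolding others_events_def by (rule sigma_algebra_sigma_sets) (auto simp: path_events_def)

lemma Int_stable_past_cylinders: "Int_stable (past_cylinders i s)"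
proof (rule Int_stableI)
  fix C C' assume "C \<in> past_cylinders i s" "C' \<in> past_cylinders i s"
  then obtain A U B A' U' B' where
    1: "C \<in> events" "A \<in> others_events i" "finite U" "U \<subseteq> {0..s}" "\<forall>u\<in>U. B u \<in> sets borel"
      "AE \<omega> in M. \<omega> \<in> C \<longleftrightarrow> \<omega> \<in> A \<and> (\<forall>u\<in>U. b i u \<omega> \<in> B u)" and
    2: "C' \<in> events" "A' \<in> others_events i" "finite U'" "U' \<subseteq> {0..s}" "\<forall>u\<in>U'. B' u \<in> sets borel"
      "AE \<omega> in M. \<omega> \<in> C' \<longleftrightarrow> \<omega> \<in> A' \<and> (\<forall>u\<in>U'. b i u \<omega> \<in> B' u)"
    unfolding past_cylinders_def by blast
  interpret O: sigma_algebra "space M" "others_events i" by (rule others_sigma_algebra)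
  \<comment> \<open>At a time that carries a constraint from only one of the two cylinders the other
    constraint is \<open>UNIV\<close>.\<close>
  define B'' where "B'' u = (if u \<in> U then B u else UNIV) \<inter> (if u \<in> U' then B' u else UNIV)" for u
  have "AE \<omega> in M. \<omega> \<in> C \<inter> C' \<longleftrightarrow> \<omega> \<in> A \<inter> A' \<and> (\<forall>u\<in>U\<union>U'. b i u \<omega> \<in> B'' u)"
    using 1(6) 2(6) by eventually_elim (auto simp: B''_def split: if_splits)
  moreover have "\<forall>u\<in>U\<union>U'. B'' u \<in> sets borel" using 1 2 by (auto simp: B''_def)
  moreover have "C \<inter> C' \<in> events" "A \<inter> A' \<in> others_events i" "finite (U \<union> U')" "U \<union> U' \<subseteq> {0..s}"
    using 1 2 by auto
  ultimately show "C \<inter> C' \<in> past_cylinders i s" unfolding past_cylinders_def by blast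
qed

lemma past_and_others_subset: "sets (past_and_others i s) \<subseteq> sigma_sets (space M) (past_cylinders i s)"
  if i: "i \<in> {1..N}"
proof -
  interpret O: sigma_algebra "space M" "others_events i" by (rule others_sigma_algebra)
  have "({b i u -` A \<inter> space M | u A. 0 \<le> u \<and> u \<le> s \<and> A \<in> sets borel} \<union>
      {b j u -` A \<inter> space M | j u A. j \<in> {1..N} - {i} \<and> 0 \<le> u \<and> A \<in> sets borel} \<union> null_sets M)
      \<subseteq> past_cylinders i s"
  proof (intro Un_least subsetI)
    fix C assume "C \<in> {b i u -` A \<inter> space M | u A. 0 \<le> u \<and> u \<le> s \<and> A \<in> sets borel}"
    then obtain u A where u: "C = b i u -` A \<inter> space M" "0 \<le> u" "u \<le> s" "A \<in> sets borel" by blast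
    have "C \<in> events" unfolding u(1) using u i by (intro measurable_sets[OF BM_measurable])
    then show "C \<in> past_cylinders i s"
      unfolding past_cylinders_def using u
      by (intro CollectI conjI bexI[of _ "space M"] exI[of _ "{u}"] exI[of _ "\<lambda>_. A"]) auto
  next
    fix C assume "C \<in> {b j u -` A \<inter> space M | j u A. j \<in> {1..N} - {i} \<and> 0 \<le> u \<and> A \<in> sets borel}"
    then obtain j u A where u: "C = b j u -` A \<inter> space M" "j \<in> {1..N} - {i}" "0 \<le> u" "A \<in> sets borel" by blast
    have 1: "C \<in> others_events i"
      unfolding others_events_def u(1) using eval_in_path_events[OF u(3,4), of j] u(2) by (intro sigma_sets.Basic) auto
    have "C \<in> events" unfolding u(1) using u by (intro measurable_sets[OF BM_measurable]) auto
    then show "C \<in> past_cylinders i s"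
      unfolding past_cylinders_def
      by (intro CollectI conjI bexI[OF _ 1] exI[of _ "{}"] exI[of _ "\<lambda>_. {}"]) auto
  next
    fix A assume "A \<in> null_sets M"
    then show "A \<in> past_cylinders i s"
      unfolding past_cylinders_def using AE_not_in[of A M]
      by (intro CollectI conjI bexI[of _ "{}"] exI[of _ "{}"] exI[of _ "\<lambda>_. {}"]) (auto elim: eventually_mono)
  qed
  from sigma_sets_mono'[OF this] show ?thesis unfolding past_and_others_def
    using null_sets_subset_Pow by (subst sets_measure_of) auto
qed

lemma space_past_and_others [simp]: "space (past_and_others i s) = space M"
  unfolding past_and_others_def using null_sets_subset_Pow by (intro space_measure_of) auto

lemma subalgebra_past_and_others: "i \<in> {1..N} \<Longrightarrow> subalgebra M (past_and_others i s)"
proof -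
  assume i: "i \<in> {1..N}"
  have "sigma_sets (space M) (past_cylinders i s) \<subseteq> events"
    by (rule sets.sigma_sets_subset) (auto simp: past_cylinders_def)
  then show ?thesis using past_and_others_subset[OF i] by (auto simp: subalgebra_def)
qed

text \<open>It suffices to treat a cylinder \<open>A \<inter> S\<close>, with \<open>A\<close> from
  the other paths and \<open>S\<close> from the past of \<open>b i\<close>. Independence of the
  paths splits \<open>A\<close> from \<open>S \<inter> E\<close>, independence of increments splits
  \<open>S\<close> from \<open>E\<close>, and independence of the paths recombines \<open>A\<close>
  with \<open>S\<close>.\<close>

lemma indep_increment:
  assumes i: "i \<in> {1..N}" and st: "0 \<le> s" "s < t" and Z: "Z \<in> borel_measurable (past_and_others i s)"
  shows "indep_var borel Z borel (\<lambda>\<omega>. b i t \<omega> - b i s \<omega>)"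
proof -
  let ?D = "{(\<lambda>\<omega>. b i t \<omega> - b i s \<omega>) -` D \<inter> space M | D. D \<in> sets borel}"
  have mD: "(\<lambda>\<omega>. b i t \<omega> - b i s \<omega>) \<in> borel_measurable M"
    using i st by (intro borel_measurable_diff BM_measurable) auto
  have "indep_set (past_cylinders i s) ?D"
  proof (rule indep_setI)
    show "past_cylinders i s \<subseteq> events" by (auto simp: past_cylinders_def)
    show D_ev: "?D \<subseteq> events" using measurable_sets[OF mD] by auto
    fix C E assume C: "C \<in> past_cylinders i s" and "E \<in> ?D"
    then obtain D where D: "D \<in> sets borel" "E = (\<lambda>\<omega>. b i t \<omega> - b i s \<omega>) -` D \<inter> space M" by auto
    then have E: "E = {\<omega>\<in>space M. b i t \<omega> - b i s \<omega> \<in> D}" by auto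
    obtain A U B where
      1: "C \<in> events" "A \<in> others_events i" "finite U" "U \<subseteq> {0..s}" "\<forall>u\<in>U. B u \<in> sets borel"
      "AE \<omega> in M. \<omega> \<in> C \<longleftrightarrow> \<omega> \<in> A \<and> (\<forall>u\<in>U. b i u \<omega> \<in> B u)"
      using C unfolding past_cylinders_def by blast
    define S where "S = {\<omega>\<in>space M. \<forall>u\<in>U. b i u \<omega> \<in> B u}"
    define Q where "Q = {f \<in> space (\<Pi>\<^sub>M t\<in>{0..}. borel :: real measure). \<forall>u\<in>U. f u \<in> B u}"
    define R where "R = {f \<in> space (\<Pi>\<^sub>M t\<in>{0..}. borel :: real measure). f t - f s \<in> D}"
    have Q: "Q \<in> sets (\<Pi>\<^sub>M t\<in>{0..}. borel)" unfolding Q_def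
    proof (rule sets.sets_Collect_finite_All[OF _ 1(3)])
      fix u assume u: "u \<in> U"
      then have "(\<lambda>f. f u) \<in> borel_measurable (\<Pi>\<^sub>M t\<in>{0..}. borel :: real measure)"
        using 1(4) by (intro measurable_component_singleton) auto
      from measurable_sets_Collect[OF this, of "\<lambda>x. x \<in> B u"]
      show "{f \<in> space (\<Pi>\<^sub>M t\<in>{0..}. borel). f u \<in> B u} \<in> sets (\<Pi>\<^sub>M t\<in>{0..}. borel)"
        using 1(5) u by simp
    qed
    have "(\<lambda>f. f t - f s) \<in> borel_measurable (\<Pi>\<^sub>M t\<in>{0..}. borel :: real measure)"
      using st by (intro borel_measurable_diff measurable_component_singleton) auto
    from measurable_sets_Collect[OF this, of "\<lambda>x. x \<in> D"] have R: "R \<in> sets (\<Pi>\<^sub>M t\<in>{0..}. borel)"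
      unfolding R_def using D(1) by simp
    have Seq: "S = path i -` Q \<inter> space M" using 1(4) by (auto simp: S_def Q_def path_def space_PiM)
    have Eeq: "E = path i -` R \<inter> space M" using st by (auto simp: E R_def path_def space_PiM)
    have S: "S \<in> path_events i" using Seq Q unfolding path_events_def by blast
    have SE: "S \<inter> E \<in> path_events i"
      unfolding path_events_def Seq Eeq using Q R by (intro CollectI exI[of _ "Q \<inter> R"]) auto
    have Ee: "E \<in> events" using D_ev D by blast
    note i1 = indep_others[OF i 1(2) S] and i2 = indep_others[OF i 1(2) SE]
    have "AE \<omega> in M. \<omega> \<in> C \<inter> E \<longleftrightarrow> \<omega> \<in> A \<inter> (S \<inter> E)"
      using 1(6) AE_space by eventually_elim (auto simp: S_def)
    then have "prob (C \<inter> E) = prob (A \<inter> (S \<inter> E))"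
      by (rule finite_measure_eq_AE[OF _ sets.Int[OF 1(1) Ee] sets.Int[OF i1(1) sets.Int[OF i1(2) Ee]]])
    also have "\<dots> = prob A * prob (S \<inter> E)" by (rule i2(3))
    also have "prob (S \<inter> E) = prob S * prob E"
      using indep_past_increment[OF i st 1(3,4) _ D(1), of B] 1(5)
      by (simp add: S_def E Int_def conj_ac)
    also have "prob A * (prob S * prob E) = prob (A \<inter> S) * prob E" using i1(3) by simp
    also have "prob (A \<inter> S) = prob C"
    proof (rule finite_measure_eq_AE[OF _ sets.Int[OF i1(1,2)] 1(1)])
      show "AE \<omega> in M. \<omega> \<in> A \<inter> S \<longleftrightarrow> \<omega> \<in> C"
        using 1(6) AE_space by eventually_elim (auto simp: S_def)
    qed
    finally show "prob (C \<inter> E) = prob C * prob E" .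
  qed
  moreover have "Int_stable ?D"
  proof (rule Int_stableI)
    fix A B assume "A \<in> ?D" "B \<in> ?D"
    then obtain A' B' where "A' \<in> sets borel" "B' \<in> sets borel"
      "A = (\<lambda>\<omega>. b i t \<omega> - b i s \<omega>) -` A' \<inter> space M" "B = (\<lambda>\<omega>. b i t \<omega> - b i s \<omega>) -` B' \<inter> space M" by auto
    then show "A \<inter> B \<in> ?D" by (intro CollectI exI[of _ "A' \<inter> B'"]) auto
  qed
  ultimately have "indep_set (sigma_sets (space M) (past_cylinders i s)) (sigma_sets (space M) ?D)"
    by (intro indep_set_sigma_sets Int_stable_past_cylinders)
  moreover have "sigma_sets (space M) {Z -` A \<inter> space M | A. A \<in> sets borel} \<subseteq> sigma_sets (space M) (past_cylinders i s)"
  proof (rule sigma_sets_mono)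
    show "{Z -` A \<inter> space M | A. A \<in> sets borel} \<subseteq> sigma_sets (space M) (past_cylinders i s)"
      using measurable_sets[OF Z] past_and_others_subset[OF i, of s] by auto
  qed
  ultimately show ?thesis
    unfolding indep_var_eq indep_sets2_eq
    using measurable_from_subalg[OF subalgebra_past_and_others[OF i] Z] mD by blast
qed

section \<open>The augmented Brownian filtration\<close>

lemma BM_filtration_mono: "s \<le> t \<Longrightarrow> sets (BM_filtration M N b s) \<subseteq> sets (BM_filtration M N b t)"
proof -
  assume "s \<le> t"
  then have "{b i u -` A \<inter> space M | i u A. i \<in> {1..N} \<and> 0 \<le> u \<and> u \<le> s \<and> A \<in> sets borel} \<union> null_sets M
    \<subseteq> {b i u -` A \<inter> space M | i u A. i \<in> {1..N} \<and> 0 \<le> u \<and> u \<le> t \<and> A \<in> sets borel} \<union> null_sets M"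
    by (intro Un_mono order_refl) force
  from sigma_sets_mono'[OF this, of "space M"] show ?thesis
    unfolding BM_filtration_def using null_sets_subset_Pow by (subst (1 2) sets_measure_of) auto
qed

lemma space_BM_filtration [simp]: "space (BM_filtration M N b s) = space M"
  unfolding BM_filtration_def using null_sets_subset_Pow by (intro space_measure_of) auto

lemma BM_filtration_subset_past_and_others:
  assumes "i \<in> {1..N}" shows "sets (BM_filtration M N b s) \<subseteq> sets (past_and_others i s)"
proof -
  have "{b j u -` A \<inter> space M | j u A. j \<in> {1..N} \<and> 0 \<le> u \<and> u \<le> s \<and> A \<in> sets borel} \<union> null_sets M
    \<subseteq> {b i u -` A \<inter> space M | u A. 0 \<le> u \<and> u \<le> s \<and> A \<in> sets borel} \<union>
      {b j u -` A \<inter> space M | j u A. j \<in> {1..N} - {i} \<and> 0 \<le> u \<and> A \<in> sets borel} \<union> null_sets M"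
  proof (intro Un_least subsetI)
    fix C assume "C \<in> {b j u -` A \<inter> space M | j u A. j \<in> {1..N} \<and> 0 \<le> u \<and> u \<le> s \<and> A \<in> sets borel}"
    then obtain j u A where u: "C = b j u -` A \<inter> space M" "j \<in> {1..N}" "0 \<le> u" "u \<le> s" "A \<in> sets borel" by blast
    then show "C \<in> {b i u -` A \<inter> space M | u A. 0 \<le> u \<and> u \<le> s \<and> A \<in> sets borel} \<union>
      {b j u -` A \<inter> space M | j u A. j \<in> {1..N} - {i} \<and> 0 \<le> u \<and> A \<in> sets borel} \<union> null_sets M"
      by (cases "j = i") blast+
  qed auto
  from sigma_sets_mono'[OF this, of "space M"] show ?thesis
    unfolding BM_filtration_def past_and_others_def using null_sets_subset_Pow
    by (subst (1 2) sets_measure_of) auto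
qed

lemma subalgebra_BM_filtration: "subalgebra M (BM_filtration M N b s)"
proof -
  have "sigma_sets (space M) ({b i s' -` A \<inter> space M | i s' A. i \<in> {1..N} \<and> 0 \<le> s' \<and> s' \<le> s \<and> A \<in> sets borel} \<union> null_sets M) \<subseteq> events"
    by (rule sets.sigma_sets_subset) (auto intro!: measurable_sets[OF BM_measurable])
  then show ?thesis
    using null_sets_subset_Pow unfolding subalgebra_def space_BM_filtration unfolding BM_filtration_def
    by (subst sets_measure_of) auto
qed

lemma BM_filtration_measurable:
  assumes "i \<in> {1..N}" "0 \<le> u" "u \<le> s" shows "b i u \<in> borel_measurable (BM_filtration M N b s)"
proof (rule measurableI)
  fix A :: "real set" assume "A \<in> sets borel"
  then have "b i u -` A \<inter> space M \<in> ({b i s' -` A \<inter> space M | i s' A. i \<in> {1..N} \<and> 0 \<le> s' \<and> s' \<le> s \<and> A \<in> sets borel} \<union> null_sets M)"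
    using assms by blast
  then show "b i u -` A \<inter> space (BM_filtration M N b s) \<in> sets (BM_filtration M N b s)"
    unfolding space_BM_filtration unfolding BM_filtration_def
    using null_sets_subset_Pow by (subst sets_measure_of) (blast intro: sigma_sets.Basic)+
qed simp

text \<open>Here \<open>u\<close> may exceed \<open>s\<close>: future increments of
  \<open>b j\<close> count as known for \<open>b i\<close>. This removes the off-diagonal terms from
  the variance of a martingale increment.\<close>

lemma past_and_others_measurable_other:
  assumes "j \<in> {1..N}" "j \<noteq> i" "0 \<le> u" shows "b j u \<in> borel_measurable (past_and_others i s)"
proof (rule measurableI)
  fix A :: "real set" assume "A \<in> sets borel"
  then have "b j u -` A \<inter> space M \<in> {b j u -` A \<inter> space M | j u A. j \<in> {1..N} - {i} \<and> 0 \<le> u \<and> A \<in> sets borel}"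
    using assms by blast
  then show "b j u -` A \<inter> space (past_and_others i s) \<in> sets (past_and_others i s)"
    unfolding space_past_and_others unfolding past_and_others_def
    using null_sets_subset_Pow by (subst sets_measure_of) (blast intro: sigma_sets.Basic)+
qed simp

end

section \<open>Martingale increments built from Brownian increments\<close>

context independent_brownian_motions begin

lemma increment_distributed:
  "i \<in> {1..N} \<Longrightarrow> 0 \<le> s \<Longrightarrow> s < t \<Longrightarrow>
    distributed M lborel (\<lambda>\<omega>. b i t \<omega> - b i s \<omega>) (normal_density 0 (sqrt (t - s)))"
  using BM by (auto simp: standard_BM_def)

lemma expectation_past_times_increment:
  fixes Z :: "'a \<Rightarrow> real" and \<phi> :: "real \<Rightarrow> real"
  assumes "i \<in> {1..N}" "0 \<le> s" "s < t" and Z: "Z \<in> borel_measurable (past_and_others i s)" "integrable M Z"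
    and \<phi>: "\<phi> \<in> borel_measurable borel" "integrable M (\<lambda>\<omega>. \<phi> (b i t \<omega> - b i s \<omega>))"
  shows "integrable M (\<lambda>\<omega>. Z \<omega> * \<phi> (b i t \<omega> - b i s \<omega>))"
    "expectation (\<lambda>\<omega>. Z \<omega> * \<phi> (b i t \<omega> - b i s \<omega>)) = expectation Z * expectation (\<lambda>\<omega>. \<phi> (b i t \<omega> - b i s \<omega>))"
proof -
  have "indep_var borel (id \<circ> Z) borel (\<phi> \<circ> (\<lambda>\<omega>. b i t \<omega> - b i s \<omega>))"
    by (rule indep_var_compose[OF indep_increment[OF assms(1-3) Z(1)]]) (use \<phi> in auto)
  then have "indep_var borel Z borel (\<lambda>\<omega>. \<phi> (b i t \<omega> - b i s \<omega>))" by (simp add: comp_def)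
  from indep_var_integrable[OF this Z(2) \<phi>(2)] indep_var_lebesgue_integral[OF this Z(2) \<phi>(2)]
  show "integrable M (\<lambda>\<omega>. Z \<omega> * \<phi> (b i t \<omega> - b i s \<omega>))"
    "expectation (\<lambda>\<omega>. Z \<omega> * \<phi> (b i t \<omega> - b i s \<omega>)) = expectation Z * expectation (\<lambda>\<omega>. \<phi> (b i t \<omega> - b i s \<omega>))"
    by auto
qed

lemma filtration_to_past:
  "i \<in> {1..N} \<Longrightarrow> Z \<in> borel_measurable (BM_filtration M N b s) \<Longrightarrow> Z \<in> borel_measurable (past_and_others i s)"
  using BM_filtration_subset_past_and_others[of i s] by (auto simp: measurable_def)

lemma filtration_bounded_integrable:
  assumes Z: "Z \<in> borel_measurable (BM_filtration M N b s)" and "\<And>\<omega>. \<omega> \<in> space M \<Longrightarrow> \<bar>Z \<omega>\<bar> \<le> (C::real)"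
  shows "integrable M Z"
proof (rule integrable_const_bound)
  show "AE \<omega> in M. norm (Z \<omega>) \<le> C" using assms(2) by auto
  show "Z \<in> borel_measurable M" using measurable_from_subalg[OF subalgebra_BM_filtration Z] .
qed

text \<open>\<open>d\<close> has the shape of the martingale part of a second order Taylor expansion
  over one time step. The two terms of the variance bound live on different scales: the one with
  \<open>q\<close> survives summation over a mesh, while the one with \<open>C\<close> is quadratic
  in the step and disappears in the limit, so that \<open>C\<close> may be as crude as the
  localisation makes it. The factors 2 and 4 come from \<open>(A + B)^2 \<le> 2 A^2 + 2 B^2\<close>
  and from the variance \<open>2 h^2\<close> of \<open>D^2\<close>.\<close>

lemma martingale_increment:
  fixes \<xi> \<eta> :: "nat \<Rightarrow> 'a \<Rightarrow> real"
  assumes st: "0 \<le> s" "s < t"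
    and \<xi>: "\<And>i. i \<in> {1..N} \<Longrightarrow> \<xi> i \<in> borel_measurable (BM_filtration M N b s)"
      "\<And>i \<omega>. i \<in> {1..N} \<Longrightarrow> \<omega> \<in> space M \<Longrightarrow> \<bar>\<xi> i \<omega>\<bar> \<le> C"
    and \<eta>: "\<And>i. i \<in> {1..N} \<Longrightarrow> \<eta> i \<in> borel_measurable (BM_filtration M N b s)"
      "\<And>i \<omega>. i \<in> {1..N} \<Longrightarrow> \<omega> \<in> space M \<Longrightarrow> \<bar>\<eta> i \<omega>\<bar> \<le> C"
    and q: "\<And>\<omega>. \<omega> \<in> space M \<Longrightarrow> (\<Sum>i\<in>{1..N}. (\<xi> i \<omega>)\<^sup>2) \<le> q"
  defines "d \<equiv> \<lambda>\<omega>. \<Sum>i\<in>{1..N}. \<xi> i \<omega> * (b i t \<omega> - b i s \<omega>) + \<eta> i \<omega> * ((b i t \<omega> - b i s \<omega>)\<^sup>2 - (t - s))"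
  shows "d \<in> borel_measurable (BM_filtration M N b t)"
    and "integrable M (\<lambda>\<omega>. (d \<omega>)\<^sup>2)"
    and "expectation (\<lambda>\<omega>. (d \<omega>)\<^sup>2) \<le> 2 * q * (t - s) + 4 * (real N)\<^sup>2 * C\<^sup>2 * (t - s)\<^sup>2"
    and "Z \<in> borel_measurable (BM_filtration M N b s) \<Longrightarrow> (\<exists>K. \<forall>\<omega>. \<bar>Z \<omega>\<bar> \<le> K) \<Longrightarrow>
           expectation (\<lambda>\<omega>. Z \<omega> * d \<omega>) = 0"
proof -
  let ?F = "BM_filtration M N b s"
  define h where "h = t - s"
  have h: "h > 0" using st by (simp add: h_def)
  define D where "D i \<omega> = b i t \<omega> - b i s \<omega>" for i \<omega>
  have d_def': "d = (\<lambda>\<omega>. \<Sum>i\<in>{1..N}. \<xi> i \<omega> * D i \<omega> + \<eta> i \<omega> * ((D i \<omega>)\<^sup>2 - h))"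
    by (simp add: d_def D_def h_def)
  note dist = increment_distributed[OF _ st, folded D_def h_def]
  note mom = centred_normal_moments[OF dist h]
  note pt = expectation_past_times_increment[OF _ st, folded D_def]
  have up: "f \<in> borel_measurable (BM_filtration M N b t)" if "f \<in> borel_measurable ?F" for f :: "'a \<Rightarrow> real"
    using that BM_filtration_mono[of s t] st by (auto simp: measurable_def)
  show "d \<in> borel_measurable (BM_filtration M N b t)"
  proof -
    have [measurable]: "D i \<in> borel_measurable (BM_filtration M N b t)" if "i \<in> {1..N}" for i
      unfolding D_def using st that by (intro borel_measurable_diff BM_filtration_measurable) auto
    note [measurable] = up[OF \<xi>(1)] up[OF \<eta>(1)]
    show ?thesis unfolding d_def' by measurable
  qed
  have FM: "f \<in> borel_measurable M" if "f \<in> borel_measurable ?F" for f :: "'a \<Rightarrow> real"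
    using measurable_from_subalg[OF subalgebra_BM_filtration that] .
  note [measurable] = FM[OF \<xi>(1)] FM[OF \<eta>(1)]
  have DM[measurable]: "D i \<in> borel_measurable M" if "i \<in> {1..N}" for i using mom(1)[OF that] by auto
  have C0: "C \<ge> 0" if "i \<in> {1..N}" for i using \<xi>(2)[OF that] not_empty by force
  have var: "integrable M (\<lambda>\<omega>. ((D i \<omega>)\<^sup>2 - h)\<^sup>2)" "expectation (\<lambda>\<omega>. ((D i \<omega>)\<^sup>2 - h)\<^sup>2) = 2 * h\<^sup>2" if i: "i \<in> {1..N}" for i
  proof -
    have eq: "((D i \<omega>)\<^sup>2 - h)\<^sup>2 = (D i \<omega>)^4 - 2 * h * (D i \<omega>)\<^sup>2 + h\<^sup>2" for \<omega>
      by (simp add: power2_eq_square power4_eq_xxxx algebra_simps)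
    show "integrable M (\<lambda>\<omega>. ((D i \<omega>)\<^sup>2 - h)\<^sup>2)" "expectation (\<lambda>\<omega>. ((D i \<omega>)\<^sup>2 - h)\<^sup>2) = 2 * h\<^sup>2"
      unfolding eq using mom[OF i] by (simp_all add: prob_space power2_eq_square)
  qed
  have prodF: "integrable M (\<lambda>\<omega>. f \<omega> * g \<omega>)"
    if "f \<in> borel_measurable ?F" "\<And>\<omega>. \<omega> \<in> space M \<Longrightarrow> \<bar>f \<omega>\<bar> \<le> K" "integrable M g" for f g :: "'a \<Rightarrow> real" and K
  proof (rule Bochner_Integration.integrable_bound[of M "\<lambda>\<omega>. K * g \<omega>"])
    show "integrable M (\<lambda>\<omega>. K * g \<omega>)" using that by auto
    show "(\<lambda>\<omega>. f \<omega> * g \<omega>) \<in> borel_measurable M" using FM[OF that(1)] that(3) by auto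
    show "AE \<omega> in M. norm (f \<omega> * g \<omega>) \<le> norm (K * g \<omega>)"
    proof (intro AE_I2)
      fix \<omega> assume "\<omega> \<in> space M"
      from that(2)[OF this] have "\<bar>f \<omega>\<bar> \<le> \<bar>K\<bar>" by simp
      then show "norm (f \<omega> * g \<omega>) \<le> norm (K * g \<omega>)" by (simp add: abs_mult mult_right_mono)
    qed
  qed
  show "expectation (\<lambda>\<omega>. Z \<omega> * d \<omega>) = 0" if Z: "Z \<in> borel_measurable ?F" "\<exists>K. \<forall>\<omega>. \<bar>Z \<omega>\<bar> \<le> K"
  proof -
    obtain K where K: "\<bar>Z \<omega>\<bar> \<le> K" for \<omega> using Z by auto
    have zz: "integrable M (\<lambda>\<omega>. Z \<omega> * (f i \<omega> * \<phi> (D i \<omega>)))" "expectation (\<lambda>\<omega>. Z \<omega> * (f i \<omega> * \<phi> (D i \<omega>))) = 0"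
      if i: "i \<in> {1..N}" and f: "f i \<in> borel_measurable ?F" "\<And>\<omega>. \<omega> \<in> space M \<Longrightarrow> \<bar>f i \<omega>\<bar> \<le> C"
        and \<phi>: "\<phi> \<in> borel_measurable borel" "integrable M (\<lambda>\<omega>. \<phi> (D i \<omega>))" "expectation (\<lambda>\<omega>. \<phi> (D i \<omega>)) = 0" for i f \<phi>
    proof -
      have m: "(\<lambda>\<omega>. Z \<omega> * f i \<omega>) \<in> borel_measurable ?F" using Z f by measurable
      have "integrable M (\<lambda>\<omega>. Z \<omega> * f i \<omega>)"
        by (rule filtration_bounded_integrable[OF m, of "K * C"])
          (use K f(2) in \<open>auto simp: abs_mult intro!: mult_mono' order_trans[OF abs_ge_zero K]\<close>)
      from pt[OF i filtration_to_past[OF i m] this \<phi>(1,2)] \<phi>(3)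
      show "integrable M (\<lambda>\<omega>. Z \<omega> * (f i \<omega> * \<phi> (D i \<omega>)))" "expectation (\<lambda>\<omega>. Z \<omega> * (f i \<omega> * \<phi> (D i \<omega>))) = 0"
        by (simp_all add: mult.assoc)
    qed
    have 1: "integrable M (\<lambda>\<omega>. Z \<omega> * (\<xi> i \<omega> * D i \<omega>))" "expectation (\<lambda>\<omega>. Z \<omega> * (\<xi> i \<omega> * D i \<omega>)) = 0" if i: "i \<in> {1..N}" for i
      using zz[of i \<xi> "\<lambda>x. x"] i \<xi> mom[OF i] by auto
    have 2: "integrable M (\<lambda>\<omega>. Z \<omega> * (\<eta> i \<omega> * ((D i \<omega>)\<^sup>2 - h)))" "expectation (\<lambda>\<omega>. Z \<omega> * (\<eta> i \<omega> * ((D i \<omega>)\<^sup>2 - h))) = 0" if i: "i \<in> {1..N}" for i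
      using zz[of i \<eta> "\<lambda>x. x\<^sup>2 - h"] i \<eta> mom[OF i] by (auto simp: prob_space)
    have eq: "Z \<omega> * d \<omega> = (\<Sum>i\<in>{1..N}. Z \<omega> * (\<xi> i \<omega> * D i \<omega>) + Z \<omega> * (\<eta> i \<omega> * ((D i \<omega>)\<^sup>2 - h)))" for \<omega>
      by (simp add: d_def' sum_distrib_left distrib_left)
    show ?thesis unfolding eq
      by (subst Bochner_Integration.integral_sum) (auto simp: 1 2 Bochner_Integration.integral_add)
  qed
  define A where "A \<omega> = (\<Sum>i\<in>{1..N}. \<xi> i \<omega> * D i \<omega>)" for \<omega>
  define B where "B \<omega> = (\<Sum>i\<in>{1..N}. \<eta> i \<omega> * ((D i \<omega>)\<^sup>2 - h))" for \<omega>
  have dAB: "d \<omega> = A \<omega> + B \<omega>" for \<omega> by (simp add: d_def' A_def B_def sum.distrib)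
  have cross: "integrable M (\<lambda>\<omega>. \<xi> i \<omega> * D i \<omega> * (\<xi> j \<omega> * D j \<omega>)) \<and>
     expectation (\<lambda>\<omega>. \<xi> i \<omega> * D i \<omega> * (\<xi> j \<omega> * D j \<omega>)) = (if i = j then h * expectation (\<lambda>\<omega>. (\<xi> i \<omega>)\<^sup>2) else 0)"
    if i: "i \<in> {1..N}" and j: "j \<in> {1..N}" for i j
  proof (cases "i = j")
    case True
    have m: "(\<lambda>\<omega>. (\<xi> i \<omega>)\<^sup>2) \<in> borel_measurable ?F" using \<xi>(1)[OF i] by measurable
    have "integrable M (\<lambda>\<omega>. (\<xi> i \<omega>)\<^sup>2)"
      by (rule filtration_bounded_integrable[OF m, of "C\<^sup>2"]) (use \<xi>(2)[OF i] C0[OF i] in \<open>simp add: power2_le_iff_abs_le\<close>)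
    from pt[OF i filtration_to_past[OF i m] this, of "\<lambda>x. x\<^sup>2"] mom[OF i] True
    show ?thesis by (simp add: power2_eq_square mult_ac)
  next
    case False
    \<comment> \<open>The increment of \<open>b j\<close> is absorbed into
      \<open>past_and_others i s\<close>, so \<open>Y\<close> is independent of the centred
      increment of \<open>b i\<close>.\<close>
    define Y where "Y \<omega> = \<xi> i \<omega> * (\<xi> j \<omega> * D j \<omega>)" for \<omega>
    have "D j \<in> borel_measurable (past_and_others i s)"
      unfolding D_def using False i j st by (intro borel_measurable_diff past_and_others_measurable_other) auto
    then have m: "Y \<in> borel_measurable (past_and_others i s)"
      unfolding Y_def using filtration_to_past[OF i \<xi>(1)[OF i]] filtration_to_past[OF i \<xi>(1)[OF j]] by measurable
    have "integrable M Y" unfolding Y_def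
      by (intro prodF[OF \<xi>(1)[OF i] \<xi>(2)[OF i]] prodF[OF \<xi>(1)[OF j] \<xi>(2)[OF j]] mom(1)[OF j])
    from pt[OF i m this, of "\<lambda>x. x"] mom[OF i] False
    show ?thesis by (simp add: Y_def mult_ac)
  qed
  have A2: "(A \<omega>)\<^sup>2 = (\<Sum>i\<in>{1..N}. \<Sum>j\<in>{1..N}. \<xi> i \<omega> * D i \<omega> * (\<xi> j \<omega> * D j \<omega>))" for \<omega>
    by (simp add: A_def power2_eq_square sum_product)
  have iA: "integrable M (\<lambda>\<omega>. (A \<omega>)\<^sup>2)" unfolding A2 using cross by (intro Bochner_Integration.integrable_sum) auto
  have xi2: "integrable M (\<lambda>\<omega>. (\<xi> i \<omega>)\<^sup>2)" if i: "i \<in> {1..N}" for i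
  proof -
    have m: "(\<lambda>\<omega>. (\<xi> i \<omega>)\<^sup>2) \<in> borel_measurable ?F" using \<xi>(1)[OF i] by measurable
    show ?thesis
      by (rule filtration_bounded_integrable[OF m, of "C\<^sup>2"]) (use \<xi>(2)[OF i] C0[OF i] in \<open>simp add: power2_le_iff_abs_le\<close>)
  qed
  have "expectation (\<lambda>\<omega>. (A \<omega>)\<^sup>2) = (\<Sum>i\<in>{1..N}. \<Sum>j\<in>{1..N}. if i = j then h * expectation (\<lambda>\<omega>. (\<xi> i \<omega>)\<^sup>2) else 0)"
  proof -
    have "expectation (\<lambda>\<omega>. (A \<omega>)\<^sup>2) = (\<Sum>i\<in>{1..N}. \<Sum>j\<in>{1..N}. expectation (\<lambda>\<omega>. \<xi> i \<omega> * D i \<omega> * (\<xi> j \<omega> * D j \<omega>)))"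
      unfolding A2
    proof (subst Bochner_Integration.integral_sum)
      show "integrable M (\<lambda>\<omega>. \<Sum>j\<in>{1..N}. \<xi> i \<omega> * D i \<omega> * (\<xi> j \<omega> * D j \<omega>))" if "i \<in> {1..N}" for i
        using cross[OF that] by (intro Bochner_Integration.integrable_sum) (rule conjunct1)
      show "(\<Sum>i\<in>{1..N}. expectation (\<lambda>\<omega>. \<Sum>j\<in>{1..N}. \<xi> i \<omega> * D i \<omega> * (\<xi> j \<omega> * D j \<omega>)))
        = (\<Sum>i\<in>{1..N}. \<Sum>j\<in>{1..N}. expectation (\<lambda>\<omega>. \<xi> i \<omega> * D i \<omega> * (\<xi> j \<omega> * D j \<omega>)))"
      proof (rule sum.cong[OF refl])
        fix i assume "i \<in> {1..N}"
        from cross[OF this] show "expectation (\<lambda>\<omega>. \<Sum>j\<in>{1..N}. \<xi> i \<omega> * D i \<omega> * (\<xi> j \<omega> * D j \<omega>))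
          = (\<Sum>j\<in>{1..N}. expectation (\<lambda>\<omega>. \<xi> i \<omega> * D i \<omega> * (\<xi> j \<omega> * D j \<omega>)))"
          by (intro Bochner_Integration.integral_sum) (rule conjunct1)
      qed
    qed
    also have "\<dots> = (\<Sum>i\<in>{1..N}. \<Sum>j\<in>{1..N}. if i = j then h * expectation (\<lambda>\<omega>. (\<xi> i \<omega>)\<^sup>2) else 0)"
      using cross by (intro sum.cong refl) blast
    finally show ?thesis .
  qed
  also have "\<dots> = h * expectation (\<lambda>\<omega>. \<Sum>i\<in>{1..N}. (\<xi> i \<omega>)\<^sup>2)"
    using xi2 by (simp add: Bochner_Integration.integral_sum sum_distrib_left)
  also have "\<dots> \<le> h * q"
  proof (intro mult_left_mono)
    show "expectation (\<lambda>\<omega>. \<Sum>i\<in>{1..N}. (\<xi> i \<omega>)\<^sup>2) \<le> q"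
      using q xi2 by (intro integral_le_const Bochner_Integration.integrable_sum) auto
  qed (use h in simp)
  finally have EA: "expectation (\<lambda>\<omega>. (A \<omega>)\<^sup>2) \<le> h * q" .
  \<comment> \<open>Cauchy-Schwarz in place of independence: the factor \<open>N^2\<close> that it
    costs only meets the square of the time step.\<close>
  have B2: "(B \<omega>)\<^sup>2 \<le> N * (\<Sum>i\<in>{1..N}. C\<^sup>2 * ((D i \<omega>)\<^sup>2 - h)\<^sup>2)" if "\<omega> \<in> space M" for \<omega>
  proof -
    have "(B \<omega>)\<^sup>2 \<le> (\<Sum>i\<in>{1..N}. (\<eta> i \<omega> * ((D i \<omega>)\<^sup>2 - h))\<^sup>2) * card {1..N}"
      unfolding B_def by (rule sum_squared_le_sum_of_squares)
    also have "\<dots> \<le> N * (\<Sum>i\<in>{1..N}. C\<^sup>2 * ((D i \<omega>)\<^sup>2 - h)\<^sup>2)"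
      using \<eta>(2) that by (auto simp: power_mult_distrib mult.commute power2_le_iff_abs_le C0 intro!: mult_left_mono sum_mono mult_right_mono)
    finally show ?thesis .
  qed
  have iBB: "integrable M (\<lambda>\<omega>. N * (\<Sum>i\<in>{1..N}. C\<^sup>2 * ((D i \<omega>)\<^sup>2 - h)\<^sup>2))"
    using var by auto
  have mB[measurable]: "B \<in> borel_measurable M" unfolding B_def by measurable
  have mA[measurable]: "A \<in> borel_measurable M" unfolding A_def by measurable
  have iB: "integrable M (\<lambda>\<omega>. (B \<omega>)\<^sup>2)"
    by (rule Bochner_Integration.integrable_bound[OF iBB]) (auto intro!: order_trans[OF B2] AE_I2)
  have "expectation (\<lambda>\<omega>. (B \<omega>)\<^sup>2) \<le> expectation (\<lambda>\<omega>. N * (\<Sum>i\<in>{1..N}. C\<^sup>2 * ((D i \<omega>)\<^sup>2 - h)\<^sup>2))"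
    using iB iBB B2 by (intro integral_mono) auto
  also have "\<dots> = N * (\<Sum>i\<in>{1..N}. C\<^sup>2 * (2 * h\<^sup>2))"
    using var by (simp add: Bochner_Integration.integral_sum)
  also have "\<dots> = 2 * (real N)\<^sup>2 * C\<^sup>2 * h\<^sup>2" by (simp add: power2_eq_square)
  finally have EB: "expectation (\<lambda>\<omega>. (B \<omega>)\<^sup>2) \<le> 2 * (real N)\<^sup>2 * C\<^sup>2 * h\<^sup>2" .
  have AB: "(A \<omega> + B \<omega>)\<^sup>2 \<le> 2 * (A \<omega>)\<^sup>2 + 2 * (B \<omega>)\<^sup>2" for \<omega>
    using sum_squares_bound[of "A \<omega>" "B \<omega>"] by (simp add: power2_sum)
  have iAB: "integrable M (\<lambda>\<omega>. 2 * (A \<omega>)\<^sup>2 + 2 * (B \<omega>)\<^sup>2)" using iA iB by auto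
  show i2: "integrable M (\<lambda>\<omega>. (d \<omega>)\<^sup>2)" unfolding dAB
    by (rule Bochner_Integration.integrable_bound[OF iAB]) (use AB in auto)
  have "expectation (\<lambda>\<omega>. (d \<omega>)\<^sup>2) \<le> expectation (\<lambda>\<omega>. 2 * (A \<omega>)\<^sup>2 + 2 * (B \<omega>)\<^sup>2)"
    using i2 iAB AB unfolding dAB by (intro integral_mono) auto
  also have "\<dots> \<le> 2 * q * h + 4 * (real N)\<^sup>2 * C\<^sup>2 * h\<^sup>2" using iA iB EA EB by (simp add: mult_ac)
  finally show "expectation (\<lambda>\<omega>. (d \<omega>)\<^sup>2) \<le> 2 * q * (t - s) + 4 * (real N)\<^sup>2 * C\<^sup>2 * (t - s)\<^sup>2" by (simp add: h_def)
qed

end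

section \<open>A pathwise Ito formula along refining partitions\<close>

lemma poly_bounded_on_interval:
  fixes P :: "real poly" shows "\<exists>B\<ge>0. \<forall>x. \<bar>x\<bar> \<le> R \<longrightarrow> \<bar>poly P x\<bar> \<le> B"
proof (induction P)
  case (pCons a P)
  then obtain B where B: "B \<ge> 0" "\<And>x. \<bar>x\<bar> \<le> R \<Longrightarrow> \<bar>poly P x\<bar> \<le> B" by auto
  show ?case
  proof (intro exI[of _ "\<bar>a\<bar> + \<bar>R\<bar> * B"] conjI allI impI)
    fix x assume x: "\<bar>x\<bar> \<le> R"
    have "\<bar>x * poly P x\<bar> \<le> \<bar>R\<bar> * B" unfolding abs_mult using B x by (intro mult_mono) auto
    then show "\<bar>poly (pCons a P) x\<bar> \<le> \<bar>a\<bar> + \<bar>R\<bar> * B" by simp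
  qed (use B in simp)
qed (auto intro: exI[of _ 0])

text \<open>Induction along Horner's scheme: if \<open>r\<close> is the remainder of
  \<open>P\<close>, then that of \<open>a + x P\<close> is \<open>z * r\<close> plus the term
  \<open>P''(x) / 2 * (z - x)^3\<close>.\<close>

lemma poly_Taylor_2:
  fixes P :: "real poly"
  shows "\<exists>C\<ge>0. \<forall>x z. \<bar>x\<bar> \<le> R \<longrightarrow> \<bar>z\<bar> \<le> R \<longrightarrow>
    \<bar>poly P z - poly P x - poly (pderiv P) x * (z - x) - poly (pderiv (pderiv P)) x / 2 * (z - x)\<^sup>2\<bar> \<le> C * \<bar>z - x\<bar> ^ 3"
proof (induction P)
  case (pCons a P)
  define r where "r x z = poly P z - poly P x - poly (pderiv P) x * (z - x) - poly (pderiv (pderiv P)) x / 2 * (z - x)\<^sup>2" for x z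
  obtain C where C: "C \<ge> 0" "\<And>x z. \<bar>x\<bar> \<le> R \<Longrightarrow> \<bar>z\<bar> \<le> R \<Longrightarrow> \<bar>r x z\<bar> \<le> C * \<bar>z - x\<bar> ^ 3"
    using pCons unfolding r_def by auto
  obtain B where B: "B \<ge> 0" "\<And>x. \<bar>x\<bar> \<le> R \<Longrightarrow> \<bar>poly (pderiv (pderiv P)) x\<bar> \<le> B"
    using poly_bounded_on_interval[of R "pderiv (pderiv P)"] by auto
  show ?case
  proof (intro exI[of _ "B / 2 + \<bar>R\<bar> * C"] conjI allI impI)
    fix x z assume x: "\<bar>x\<bar> \<le> R" and z: "\<bar>z\<bar> \<le> R"
    have eq: "poly (pCons a P) z - poly (pCons a P) x - poly (pderiv (pCons a P)) x * (z - x) - poly (pderiv (pderiv (pCons a P))) x / 2 * (z - x)\<^sup>2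
      = poly (pderiv (pderiv P)) x / 2 * (z - x) ^ 3 + z * r x z"
      by (simp add: r_def pderiv_pCons pderiv_add field_simps power2_eq_square power3_eq_cube)
    have "\<bar>poly (pderiv (pderiv P)) x / 2 * (z - x) ^ 3 + z * r x z\<bar> \<le> \<bar>poly (pderiv (pderiv P)) x\<bar> / 2 * \<bar>z - x\<bar> ^ 3 + \<bar>z\<bar> * \<bar>r x z\<bar>"
      by (rule order_trans[OF abs_triangle_ineq]) (simp add: abs_mult power_abs)
    also have "\<dots> \<le> B / 2 * \<bar>z - x\<bar> ^ 3 + \<bar>R\<bar> * (C * \<bar>z - x\<bar> ^ 3)"
      using B C x z by (intro add_mono mult_mono divide_right_mono) auto
    finally show "\<bar>poly (pCons a P) z - poly (pCons a P) x - poly (pderiv (pCons a P)) x * (z - x) - poly (pderiv (pderiv (pCons a P))) x / 2 * (z - x)\<^sup>2\<bar>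
      \<le> (B / 2 + \<bar>R\<bar> * C) * \<bar>z - x\<bar> ^ 3"
      unfolding eq by (simp add: algebra_simps)
  qed (use B C in simp)
qed (auto intro: exI[of _ 0])

text \<open>With steps \<open>T / 4^m\<close> a Brownian increment has standard deviation
  \<open>sqrt T / 2^m\<close>. The expected cubic variation, \<open>4^m\<close> terms of order
  \<open>8^-m\<close>, is then summable over \<open>m\<close>.\<close>

definition mesh :: "real \<Rightarrow> nat \<Rightarrow> nat \<Rightarrow> real" where
  "mesh T m k = T * real k / 4 ^ m"

lemma mesh_0 [simp]: "mesh T m 0 = 0" by (simp add: mesh_def)

lemma mesh_last [simp]: "mesh T m (4 ^ m) = T" by (simp add: mesh_def)

lemma mesh_Suc: "mesh T m (Suc k) = mesh T m k + T / 4 ^ m"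
  by (simp add: mesh_def field_simps)

lemma mesh_mono: "0 \<le> T \<Longrightarrow> k \<le> l \<Longrightarrow> mesh T m k \<le> mesh T m l"
  by (simp add: mesh_def divide_right_mono mult_left_mono)

lemma mesh_in: "0 \<le> T \<Longrightarrow> k \<le> 4 ^ m \<Longrightarrow> mesh T m k \<in> {0..T}"
  using mesh_mono[of T 0 k m] mesh_mono[of T k "4 ^ m" m] by simp

lemma eventually_mesh_small: "0 < e \<Longrightarrow> \<forall>\<^sub>F m in sequentially. T / 4 ^ m < (e::real)"
proof -
  assume "0 < e"
  have "(\<lambda>m. T * (1 / 4) ^ m) \<longlonglongrightarrow> T * 0"
    by (intro tendsto_mult_left LIMSEQ_realpow_zero) auto
  then show ?thesis using order_tendstoD(2)[of "\<lambda>m. T * (1 / 4) ^ m" 0 sequentially e] \<open>0 < e\<close>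
    by (simp add: power_divide)
qed

lemma mesh_oscillation:
  fixes f :: "real \<Rightarrow> real"
  assumes "continuous_on {0..T} f" "0 < T" "0 < e"
  shows "\<forall>\<^sub>F m in sequentially. \<forall>k<4 ^ m. \<forall>s\<in>{mesh T m k..mesh T m (Suc k)}. \<bar>f s - f (mesh T m k)\<bar> \<le> e"
proof -
  have "uniformly_continuous_on {0..T} f" using assms(1) by (intro compact_uniformly_continuous) auto
  then obtain d where d: "d > 0" "\<And>x y. x \<in> {0..T} \<Longrightarrow> y \<in> {0..T} \<Longrightarrow> dist y x < d \<Longrightarrow> dist (f y) (f x) < e"
    using \<open>0 < e\<close> unfolding uniformly_continuous_on_def by metis
  from eventually_mesh_small[OF d(1), of T] show ?thesis
  proof eventually_elim
    case (elim m)
    show ?case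
    proof (intro allI impI ballI)
      fix k s assume k: "k < 4 ^ m" and s: "s \<in> {mesh T m k..mesh T m (Suc k)}"
      have "mesh T m k \<in> {0..T}" "mesh T m (Suc k) \<in> {0..T}" using k \<open>0 < T\<close> by (intro mesh_in; simp)+
      then show "\<bar>f s - f (mesh T m k)\<bar> \<le> e"
        using d(2)[of "mesh T m k" s] s elim by (auto simp: dist_real_def mesh_Suc)
    qed
  qed
qed

lemma sum_integral_mesh:
  fixes f :: "real \<Rightarrow> real"
  assumes f: "f integrable_on {0..T}" and "0 < T" "n \<le> 4 ^ m"
  shows "(\<Sum>k<n. integral {mesh T m k..mesh T m (Suc k)} f) = integral {0..mesh T m n} f"
  using assms(3)
proof (induction n)
  case (Suc n)
  have "f integrable_on {0..mesh T m (Suc n)}"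
    using mesh_in[of T "Suc n" m] Suc.prems \<open>0 < T\<close> by (intro integrable_subinterval_real[OF f]) auto
  from Henstock_Kurzweil_Integration.integral_combine[OF _ _ this, of "mesh T m n"] mesh_mono[of T n "Suc n" m] mesh_mono[of T 0 n m] Suc \<open>0 < T\<close>
  show ?case by simp
qed simp

lemma absolutely_integrable_continuous_times:
  fixes f g :: "real \<Rightarrow> real"
  assumes "continuous_on {0..T} f" "g absolutely_integrable_on {0..T}"
  shows "(\<lambda>s. f s * g s) absolutely_integrable_on {0..T}"
  using assms by (intro absolutely_integrable_bounded_measurable_product_real continuous_imp_measurable_on_sets_lebesgue
      compact_imp_bounded compact_continuous_image) auto

lemma abs_integral_le:
  fixes f g :: "real \<Rightarrow> real"
  assumes "f integrable_on {u..v}" "g integrable_on {u..v}" "\<And>x. x \<in> {u..v} \<Longrightarrow> \<bar>f x\<bar> \<le> g x"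
  shows "\<bar>integral {u..v} f\<bar> \<le> integral {u..v} g"
  using integral_norm_bound_integral[of f "{u..v}" g] assms by simp

lemma cube_sum_le: "\<bar>u + v\<bar> ^ 3 \<le> 4 * (\<bar>u\<bar> ^ 3 + \<bar>v\<bar> ^ 3)" for u v :: real
proof -
  have "\<bar>u + v\<bar> ^ 3 \<le> (\<bar>u\<bar> + \<bar>v\<bar>) ^ 3" by (intro power_mono) auto
  also have "\<dots> = 4 * (\<bar>u\<bar> ^ 3 + \<bar>v\<bar> ^ 3) - 3 * ((\<bar>u\<bar> + \<bar>v\<bar>) * (\<bar>u\<bar> - \<bar>v\<bar>)\<^sup>2)"
    by (simp add: power2_eq_square power3_eq_cube algebra_simps)
  also have "\<dots> \<le> 4 * (\<bar>u\<bar> ^ 3 + \<bar>v\<bar> ^ 3)" by simp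
  finally show ?thesis .
qed

text \<open>A pathwise Ito formula for \<open>y = y0 + \<beta> + \<integral>a\<close>: only the cubic variation of \<open>\<beta>\<close> has to vanish.\<close>

lemma mesh_Ito_remainder:
  fixes P :: "real poly" and y \<beta> a :: "real \<Rightarrow> real"
  assumes T: "0 < T" and y: "continuous_on {0..T} y" and a: "a absolutely_integrable_on {0..T}"
    and eq: "\<And>t. t \<in> {0..T} \<Longrightarrow> y t = y0 + \<beta> t + integral {0..t} a"
    and cub: "(\<lambda>m. \<Sum>k<4^m. \<bar>\<beta> (mesh T m (Suc k)) - \<beta> (mesh T m k)\<bar> ^ 3) \<longlonglongrightarrow> 0"
  shows "(\<lambda>m. \<Sum>k<4^m. \<bar>poly P (y (mesh T m (Suc k))) - poly P (y (mesh T m k))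
      - integral {mesh T m k..mesh T m (Suc k)} (\<lambda>s. poly (pderiv P) (y s) * a s + poly (pderiv (pderiv P)) (y s) / 2)
      - (poly (pderiv P) (y (mesh T m k)) * (\<beta> (mesh T m (Suc k)) - \<beta> (mesh T m k))
         + poly (pderiv (pderiv P)) (y (mesh T m k)) / 2 * ((\<beta> (mesh T m (Suc k)) - \<beta> (mesh T m k))\<^sup>2 - T / 4 ^ m))\<bar>) \<longlonglongrightarrow> 0"
    (is "(\<lambda>m. \<Sum>k<4^m. \<bar>?t m k\<bar>) \<longlonglongrightarrow> 0")
proof -
  define g1 where "g1 s = poly (pderiv P) (y s)" for s
  define g2 where "g2 s = poly (pderiv (pderiv P)) (y s)" for s
  define A where "A t = integral {0..t} a" for t
  have "bounded (y ` {0..T})" using y by (intro compact_imp_bounded compact_continuous_image) auto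
  then obtain R where R: "\<And>t. t \<in> {0..T} \<Longrightarrow> \<bar>y t\<bar> \<le> R" unfolding bounded_iff by (metis imageI real_norm_def)
  obtain C3 where C3: "C3 \<ge> 0" "\<And>x z. \<bar>x\<bar> \<le> R \<Longrightarrow> \<bar>z\<bar> \<le> R \<Longrightarrow>
    \<bar>poly P z - poly P x - poly (pderiv P) x * (z - x) - poly (pderiv (pderiv P)) x / 2 * (z - x)\<^sup>2\<bar> \<le> C3 * \<bar>z - x\<bar> ^ 3"
    using poly_Taylor_2[of R P] by auto
  obtain C2 where C2: "C2 \<ge> 0" "\<And>x. \<bar>x\<bar> \<le> R \<Longrightarrow> \<bar>poly (pderiv (pderiv P)) x\<bar> \<le> C2"
    using poly_bounded_on_interval[of R "pderiv (pderiv P)"] by auto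
  have g1: "continuous_on {0..T} g1" unfolding g1_def using y by (intro continuous_intros)
  have g2: "continuous_on {0..T} g2" unfolding g2_def using y by (intro continuous_intros)
  have ai: "a integrable_on {0..T}" using a by (rule set_lebesgue_integral_eq_integral(1))
  have abs_ai: "(\<lambda>s. \<bar>a s\<bar>) integrable_on {0..T}"
    using a by (simp add: absolutely_integrable_on_def)
  have A: "continuous_on {0..T} A" unfolding A_def by (rule indefinite_integral_continuous_1[OF ai])
  have \<beta>: "continuous_on {0..T} \<beta>"
  proof (rule continuous_on_eq[of _ "\<lambda>t. y t - y0 - A t"])
    show "continuous_on {0..T} (\<lambda>t. y t - y0 - A t)" using y A by (intro continuous_intros)
    show "\<And>t. t \<in> {0..T} \<Longrightarrow> y t - y0 - A t = \<beta> t" using eq by (simp add: A_def)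
  qed
  have g1a: "(\<lambda>s. g1 s * a s) integrable_on {0..T}"
    using absolutely_integrable_continuous_times[OF g1 a] by (rule set_lebesgue_integral_eq_integral(1))
  have g2i: "(\<lambda>s. g2 s / 2) integrable_on {0..T}"
    using g2 by (intro integrable_continuous_real continuous_intros) auto
  define a1 where "a1 = integral {0..T} (\<lambda>s. \<bar>a s\<bar>)"
  have a1: "a1 \<ge> 0" unfolding a1_def by (rule Henstock_Kurzweil_Integration.integral_nonneg[OF abs_ai]) simp
  \<comment> \<open>The total coefficient of \<open>e\<close> once the bounds \<open>i1\<close> to
    \<open>i4\<close> below are summed over the mesh intervals.\<close>
  define K where "K = a1 + T / 2 + 2 * C2 * a1 + 4 * C3 * a1"
  have K: "K \<ge> 0" using a1 C2 C3 T by (simp add: K_def)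
  let ?cub = "\<lambda>m. \<Sum>k<4^m. \<bar>\<beta> (mesh T m (Suc k)) - \<beta> (mesh T m k)\<bar> ^ 3"
  \<comment> \<open>A single \<open>e\<close> bounds the oscillation of \<open>g1\<close>,
    \<open>g2\<close>, \<open>A\<close> and \<beta> on every mesh interval. Each error other than
    the cubic variation then carries a factor \<open>e\<close> times the length of the interval or
    the integral of the absolute drift over it, and these add up to fixed totals.\<close>
  have main: "\<forall>\<^sub>F m in sequentially. (\<Sum>k<4^m. \<bar>?t m k\<bar>) \<le> K * e + 4 * C3 * ?cub m" if e: "0 < e" "e \<le> 1" for e
    using mesh_oscillation[OF g1 T e(1)] mesh_oscillation[OF g2 T e(1)] mesh_oscillation[OF A T e(1)] mesh_oscillation[OF \<beta> T e(1)]
  proof eventually_elim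
    case (elim m)
    have summand: "\<bar>?t m k\<bar> \<le> (e + 2 * C2 * e + 4 * C3 * e) * integral {mesh T m k..mesh T m (Suc k)} (\<lambda>s. \<bar>a s\<bar>)
        + e / 2 * (T / 4 ^ m) + 4 * C3 * \<bar>\<beta> (mesh T m (Suc k)) - \<beta> (mesh T m k)\<bar> ^ 3" if k: "k < 4 ^ m" for k
    proof -
      define u v where "u = mesh T m k" and "v = mesh T m (Suc k)"
      have uv: "u \<in> {0..T}" "v \<in> {0..T}" "v = u + T / 4 ^ m" "u \<le> v"
        using k T mesh_in[of T k m] mesh_in[of T "Suc k" m] mesh_mono[of T k "Suc k" m] by (auto simp: u_def v_def mesh_Suc)
      then have sub: "{u..v} \<subseteq> {0..T}" by auto
      note sint = integrable_subinterval_real[OF _ sub]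
      define \<alpha> where "\<alpha> = integral {u..v} (\<lambda>s. \<bar>a s\<bar>)"
      define db where "db = \<beta> v - \<beta> u"
      define dA where "dA = integral {u..v} a"
      have \<alpha>0: "\<alpha> \<ge> 0" unfolding \<alpha>_def by (rule Henstock_Kurzweil_Integration.integral_nonneg[OF sint[OF abs_ai]]) simp
      have dA: "A v - A u = dA"
        using Henstock_Kurzweil_Integration.integral_combine[of 0 u v a] uv integrable_subinterval_real[OF ai, of 0 v] by (simp add: A_def dA_def)
      have dA\<alpha>: "\<bar>dA\<bar> \<le> \<alpha>" unfolding dA_def \<alpha>_def
        using integral_norm_bound_integral[OF sint[OF ai] sint[OF abs_ai]] by simp
      have dAe: "\<bar>dA\<bar> \<le> e" using elim k uv dA[symmetric] by (auto simp: u_def v_def)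
      have dbe: "\<bar>db\<bar> \<le> e" using elim k uv by (auto simp: u_def v_def db_def)
      have dy: "y v - y u = db + dA" using eq[OF uv(1)] eq[OF uv(2)] dA by (simp add: db_def A_def)
      have osc1: "\<bar>g1 s - g1 u\<bar> \<le> e" "\<bar>g2 s - g2 u\<bar> \<le> e" if "s \<in> {u..v}" for s
        using elim k that by (auto simp: u_def v_def)
      have i1: "\<bar>g1 u * dA - integral {u..v} (\<lambda>s. g1 s * a s)\<bar> \<le> e * \<alpha>"
      proof -
        have "g1 u * dA - integral {u..v} (\<lambda>s. g1 s * a s) = integral {u..v} (\<lambda>s. (g1 u - g1 s) * a s)"
          using sint[OF ai] sint[OF g1a]
          by (simp add: dA_def left_diff_distrib Henstock_Kurzweil_Integration.integral_diff integrable_on_mult_right)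
        moreover have "\<bar>integral {u..v} (\<lambda>s. (g1 u - g1 s) * a s)\<bar> \<le> integral {u..v} (\<lambda>s. e * \<bar>a s\<bar>)"
        proof (rule abs_integral_le)
          show "(\<lambda>s. (g1 u - g1 s) * a s) integrable_on {u..v}"
            unfolding left_diff_distrib using sint[OF ai] sint[OF g1a]
            by (intro integrable_diff integrable_on_mult_right)
          show "(\<lambda>s. e * \<bar>a s\<bar>) integrable_on {u..v}" using sint[OF abs_ai] by (intro integrable_on_mult_right)
          fix s assume "s \<in> {u..v}"
          then show "\<bar>(g1 u - g1 s) * a s\<bar> \<le> e * \<bar>a s\<bar>"
            using osc1(1)[of s] by (auto simp: abs_mult abs_minus_commute intro!: mult_right_mono)
        qed
        ultimately show ?thesis by (simp add: \<alpha>_def)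
      qed
      have i2: "\<bar>g2 u / 2 * (v - u) - integral {u..v} (\<lambda>s. g2 s / 2)\<bar> \<le> e / 2 * (v - u)"
      proof -
        have "g2 u / 2 * (v - u) - integral {u..v} (\<lambda>s. g2 s / 2) = integral {u..v} (\<lambda>s. g2 u / 2 - g2 s / 2)"
          using Henstock_Kurzweil_Integration.integral_diff[OF integrable_const_ivl[of "g2 u / 2" u v] sint[OF g2i]] uv(4)
          by (simp del: integral_divide)
        moreover have "\<bar>integral {u..v} (\<lambda>s. g2 u / 2 - g2 s / 2)\<bar> \<le> integral {u..v} (\<lambda>s. e / 2)"
        proof (rule abs_integral_le)
          show "(\<lambda>s. g2 u / 2 - g2 s / 2) integrable_on {u..v}"
            using sint[OF g2i] by (intro integrable_diff integrable_const_ivl)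
          fix s assume "s \<in> {u..v}"
          then show "\<bar>g2 u / 2 - g2 s / 2\<bar> \<le> e / 2" using osc1(2)[of s] by (auto simp: abs_if split: if_splits)
        qed (simp add: integrable_const_ivl)
        moreover have "integral {u..v} (\<lambda>s. e / 2) = e / 2 * (v - u)" using uv(4) by (simp del: integral_divide)
        ultimately show ?thesis by linarith
      qed
      \<comment> \<open>What \<open>(db + dA)^2\<close> contributes besides \<open>db^2\<close>;
        only \<open>db^2\<close> is kept in the martingale part.\<close>
      have i3: "\<bar>g2 u * (db * dA + dA\<^sup>2 / 2)\<bar> \<le> 2 * C2 * e * \<alpha>"
      proof -
        have "\<bar>db * dA + dA\<^sup>2 / 2\<bar> \<le> \<bar>db\<bar> * \<bar>dA\<bar> + \<bar>dA\<bar> * \<bar>dA\<bar> / 2"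
          by (rule order_trans[OF abs_triangle_ineq]) (simp add: abs_mult power2_eq_square)
        also have "\<dots> \<le> e * \<alpha> + e * \<alpha> / 2" using dbe dAe dA\<alpha> e by (intro add_mono divide_right_mono mult_mono) auto
        also have "\<dots> \<le> 2 * e * \<alpha>" using e \<alpha>0 by simp
        finally have "\<bar>g2 u\<bar> * \<bar>db * dA + dA\<^sup>2 / 2\<bar> \<le> C2 * (2 * e * \<alpha>)"
          using C2(2)[OF R[OF uv(1)]] C2(1) by (intro mult_mono) (auto simp: g2_def)
        then show ?thesis by (simp add: abs_mult mult_ac)
      qed
      \<comment> \<open>In the cube of \<open>dA\<close> one factor is bounded by the integral of
        the absolute drift, one by \<open>e\<close>, and one by 1 since
        \<open>e \<le> 1\<close>.\<close>
      have i4: "C3 * \<bar>db + dA\<bar> ^ 3 \<le> 4 * C3 * \<bar>db\<bar> ^ 3 + 4 * C3 * e * \<alpha>"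
      proof -
        have "\<bar>dA\<bar> ^ 3 = \<bar>dA\<bar> * \<bar>dA\<bar> * \<bar>dA\<bar>" by (simp add: power3_eq_cube)
        also have "\<dots> \<le> (e * 1) * \<alpha>" using dAe dA\<alpha> e by (intro mult_mono) auto
        finally have "\<bar>db + dA\<bar> ^ 3 \<le> 4 * (\<bar>db\<bar> ^ 3 + e * \<alpha>)" using cube_sum_le[of db dA] by simp
        from mult_left_mono[OF this C3(1)] show ?thesis by (simp add: algebra_simps)
      qed
      have "\<bar>poly P (y v) - poly P (y u) - g1 u * (db + dA) - g2 u / 2 * (db + dA)\<^sup>2\<bar> \<le> C3 * \<bar>db + dA\<bar> ^ 3"
        using C3(2)[OF R[OF uv(1)] R[OF uv(2)]] by (simp add: dy g1_def g2_def)
      moreover have "?t m k = (poly P (y v) - poly P (y u) - g1 u * (db + dA) - g2 u / 2 * (db + dA)\<^sup>2)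
         + (g1 u * dA - integral {u..v} (\<lambda>s. g1 s * a s)) + (g2 u / 2 * (v - u) - integral {u..v} (\<lambda>s. g2 s / 2))
         + g2 u * (db * dA + dA\<^sup>2 / 2)"
      proof -
        define I1 I2 where "I1 = integral {u..v} (\<lambda>s. g1 s * a s)" and "I2 = integral {u..v} (\<lambda>s. g2 s / 2)"
        have "integral {u..v} (\<lambda>s. g1 s * a s + g2 s / 2) = I1 + I2"
          unfolding I1_def I2_def using sint[OF g1a] sint[OF g2i] by (rule Henstock_Kurzweil_Integration.integral_add)
        moreover have "T / 4 ^ m = v - u" using uv(3) by simp
        ultimately have "?t m k = poly P (y v) - poly P (y u) - (I1 + I2) - (g1 u * db + g2 u / 2 * (db\<^sup>2 - (v - u)))"
          by (simp only: u_def v_def g1_def g2_def db_def)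
        then show ?thesis
          unfolding I1_def[symmetric] I2_def[symmetric] by (simp add: field_simps power2_eq_square)
      qed
      moreover have tri: "\<bar>x1 + x2 + x3 + x4\<bar> \<le> b1 + b2 + b3 + b4"
        if "\<bar>x1\<bar> \<le> b1" "\<bar>x2\<bar> \<le> b2" "\<bar>x3\<bar> \<le> b3" "\<bar>x4\<bar> \<le> b4" for x1 x2 x3 x4 b1 b2 b3 b4 :: real
        using that by linarith
      moreover have vu: "v - u = T / 4 ^ m" using uv(3) by simp
      ultimately have "\<bar>?t m k\<bar> \<le> (4 * C3 * \<bar>db\<bar> ^ 3 + 4 * C3 * e * \<alpha>) + e * \<alpha> + e / 2 * (T / 4 ^ m) + 2 * C2 * e * \<alpha>"
        using tri[OF order_trans[OF _ i4] i1 i2[unfolded vu] i3] by (simp only: vu)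
      then show ?thesis unfolding u_def[symmetric] v_def[symmetric] db_def[symmetric] \<alpha>_def[symmetric] by (simp add: algebra_simps)
    qed
    have "(\<Sum>k<4^m. \<bar>?t m k\<bar>) \<le> (\<Sum>k<4^m. (e + 2 * C2 * e + 4 * C3 * e) * integral {mesh T m k..mesh T m (Suc k)} (\<lambda>s. \<bar>a s\<bar>)
        + e / 2 * (T / 4 ^ m) + 4 * C3 * \<bar>\<beta> (mesh T m (Suc k)) - \<beta> (mesh T m k)\<bar> ^ 3)"
      using summand by (intro sum_mono) auto
    also have "\<dots> = (e + 2 * C2 * e + 4 * C3 * e) * a1 + e / 2 * T + 4 * C3 * ?cub m"
      using sum_integral_mesh[OF abs_ai T order_refl, of m]
      by (simp add: sum.distrib sum_distrib_left[symmetric] a1_def)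
    also have "\<dots> = K * e + 4 * C3 * ?cub m" by (simp add: K_def algebra_simps)
    finally show ?case .
  qed
  show ?thesis
  proof (rule LIMSEQ_I)
    fix r :: real assume r: "0 < r"
    \<comment> \<open>This leaves \<open>r / 4\<close> for the oscillation terms, next to less than
      \<open>r / 2\<close> for the cubic variation; \<open>K + 1\<close> replaces \<open>K\<close>
      because \<open>K\<close> may be close to 0 and has to be divided by.\<close>
    define e where "e = min 1 (r / (4 * (K + 1)))"
    have e: "0 < e" "e \<le> 1" using r K by (auto simp: e_def)
    have "K * e \<le> (K + 1) * (r / (4 * (K + 1)))" using K r by (intro mult_mono) (auto simp: e_def)
    also have "\<dots> = r / 4"
    proof -
      have k1: "K + 1 \<noteq> 0" using K by simp
      show ?thesis
        by (simp only: times_divide_eq_right mult.commute[of 4 "K + 1"] nonzero_mult_divide_mult_cancel_left[OF k1])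
    qed
    finally have Ke: "K * e \<le> r / 4" .
    have "(\<lambda>m. 4 * C3 * ?cub m) \<longlonglongrightarrow> 4 * C3 * 0" using cub by (intro tendsto_mult_left)
    then have "\<forall>\<^sub>F m in sequentially. 4 * C3 * ?cub m < r / 2" using r by (intro order_tendstoD(2)) auto
    with main[OF e] have "\<forall>\<^sub>F m in sequentially. (\<Sum>k<4^m. \<bar>?t m k\<bar>) < r"
    proof eventually_elim
      case (elim m) then show ?case using Ke r by linarith
    qed
    then show "\<exists>no. \<forall>n\<ge>no. norm ((\<Sum>k<4^n. \<bar>?t n k\<bar>) - 0) < r"
      by (simp add: eventually_sequentially sum_nonneg)
  qed
qed

section \<open>Processes driven by Brownian motions\<close>

lemma lborel_set_integral_Henstock:
  fixes f :: "real \<Rightarrow> real"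
  assumes "set_integrable lborel {u..v} f"
  shows "f absolutely_integrable_on {u..v}" "(LBINT s:{u..v}. f s) = integral {u..v} f"
proof -
  show "f absolutely_integrable_on {u..v}"
    using assms unfolding set_integrable_def by (simp add: integrable_completion)
  show "(LBINT s:{u..v}. f s) = integral {u..v} f"
    using set_borel_integral_eq_integral(2)[OF assms] .
qed

locale driven_by_brownian_motions = independent_brownian_motions M N b
  for M :: "'a measure" and N :: nat and b +
  fixes y :: "nat \<Rightarrow> real \<Rightarrow> 'a \<Rightarrow> real" and a :: "nat \<Rightarrow> 'a \<Rightarrow> real \<Rightarrow> real" and y0 :: "nat \<Rightarrow> real"
  assumes y_adapted: "i \<in> {1..N} \<Longrightarrow> adapted (BM_filtration M N b) (y i)"
    and y_paths: "i \<in> {1..N} \<Longrightarrow> continuous_paths M (y i)"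
    and y_drift: "i \<in> {1..N} \<Longrightarrow> AE \<omega> in M. \<forall>t\<ge>0. set_integrable lborel {0..t} (a i \<omega>) \<and>
       y i t \<omega> = y0 i + b i t \<omega> + (LBINT s:{0..t}. a i \<omega> s)"
begin

definition state :: "real \<Rightarrow> 'a \<Rightarrow> nat \<Rightarrow> real" where
  "state t \<omega> = (\<lambda>i. y i t \<omega>)"

definition generator_term :: "real poly \<Rightarrow> nat \<Rightarrow> 'a \<Rightarrow> real \<Rightarrow> real" where
  "generator_term P i \<omega> s = poly (pderiv P) (y i s \<omega>) * a i \<omega> s + poly (pderiv (pderiv P)) (y i s \<omega>) / 2"

text \<open>Convergence in mean would not do for a pathwise expansion; the geometric rate along this
  sequence of meshes makes it almost sure.\<close>

lemma cubic_variation_vanishes: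
  assumes i: "i \<in> {1..N}" and T: "0 < T"
  shows "AE \<omega> in M. (\<lambda>m. \<Sum>k<4^m. \<bar>b i (mesh T m (Suc k)) \<omega> - b i (mesh T m k) \<omega>\<bar> ^ 3) \<longlonglongrightarrow> 0"
proof (rule AE_LIMSEQ_0_of_geometric_expectation)
  fix m :: nat
  have h: "mesh T m k \<ge> 0" "mesh T m k < mesh T m (Suc k)" "mesh T m (Suc k) - mesh T m k = T / 4^m" "T / 4 ^ m > 0" for k
    using T mesh_mono[of T 0 _ m] by (auto simp: mesh_Suc)
  note D = increment_distributed[OF i h(1,2), unfolded h(3)]
  note mom = centred_normal_moments(7,8)[OF D h(4)]
  show "integrable M (\<lambda>\<omega>. \<Sum>k<4^m. \<bar>b i (mesh T m (Suc k)) \<omega> - b i (mesh T m k) \<omega>\<bar> ^ 3)"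
    using mom(1) by auto
  have s: "sqrt (T / 4 ^ m) = sqrt T / 2 ^ m"
    using T by (simp add: real_sqrt_divide real_sqrt_power)
  have "expectation (\<lambda>\<omega>. \<Sum>k<4^m. \<bar>b i (mesh T m (Suc k)) \<omega> - b i (mesh T m k) \<omega>\<bar> ^ 3)
     = (\<Sum>k<4^m. expectation (\<lambda>\<omega>. \<bar>b i (mesh T m (Suc k)) \<omega> - b i (mesh T m k) \<omega>\<bar> ^ 3))"
    by (rule Bochner_Integration.integral_sum) (rule mom(1))
  also have "\<dots> \<le> (\<Sum>k<(4::nat)^m. 2 * sqrt (T / 4 ^ m) ^ 3)"
    by (rule sum_mono) (rule mom(2))
  also have "\<dots> = 2 * sqrt T ^ 3 * ((2 ^ m * 2 ^ m) / (2 ^ m * 2 ^ m * 2 ^ m))"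
    unfolding s by (simp add: power_divide power3_eq_cube power_mult_distrib[symmetric])
  also have "\<dots> = 2 * sqrt T ^ 3 * (1/2) ^ m" by (simp add: power_divide)
  finally show "expectation (\<lambda>\<omega>. \<Sum>k<4^m. \<bar>b i (mesh T m (Suc k)) \<omega> - b i (mesh T m k) \<omega>\<bar> ^ 3) \<le> 2 * sqrt T ^ 3 * (1/2) ^ m" .
qed (simp add: sum_nonneg)

text \<open>The weight \<open>\<zeta>\<close> serves both to localise to bounded states and to normalise. The exceptional
  set is the event that the maxima of the discrete martingales are eventually large as the mesh
  is refined.\<close>

lemma weighted_Ito_deviation:
  fixes P :: "real poly" and \<zeta> :: "(nat \<Rightarrow> real) \<Rightarrow> real"
  assumes T: "0 < T" and e: "0 < e"
    and \<zeta>_meas: "\<And>t. 0 \<le> t \<Longrightarrow> (\<lambda>\<omega>. \<zeta> (state t \<omega>)) \<in> borel_measurable (BM_filtration M N b t)"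
    and \<zeta>_bounds: "\<And>z. 0 \<le> \<zeta> z" "\<And>z. \<zeta> z \<le> 1"
    and \<zeta>_local: "\<And>z i. \<zeta> z \<noteq> 0 \<Longrightarrow> i \<in> {1..N} \<Longrightarrow> \<bar>z i\<bar> \<le> R"
    and q: "\<And>z. (\<Sum>i\<in>{1..N}. (\<zeta> z * poly (pderiv P) (z i))\<^sup>2) \<le> q"
  shows "\<exists>A\<in>events. prob A \<le> 2 * q * T / e\<^sup>2 \<and> (\<forall>\<omega>\<in>space M - A.
     (\<forall>i\<in>{1..N}. y i 0 \<omega> = y0 i) \<and> (\<forall>i\<in>{1..N}. a i \<omega> absolutely_integrable_on {0..T}) \<and>
     (\<exists>\<^sub>F m in sequentially. \<forall>k\<le>4^m. \<bar>\<Sum>j<k. \<zeta> (state (mesh T m j) \<omega>) *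
        (\<Sum>i\<in>{1..N}. poly P (y i (mesh T m (Suc j)) \<omega>) - poly P (y i (mesh T m j) \<omega>)
           - integral {mesh T m j..mesh T m (Suc j)} (generator_term P i \<omega>))\<bar> \<le> 2 * e))"
proof -
  \<comment> \<open>Coefficients are evaluated at the left end of a mesh interval, hence adapted,
    and they are bounded because \<zeta> vanishes outside the box of radius
    \<open>R\<close>.\<close>
  define \<xi> where "\<xi> i z = \<zeta> z * poly (pderiv P) (z i)" for i z
  define \<eta> where "\<eta> i z = \<zeta> z * (poly (pderiv (pderiv P)) (z i) / 2)" for i z
  obtain B1 where B1: "B1 \<ge> 0" "\<And>x. \<bar>x\<bar> \<le> R \<Longrightarrow> \<bar>poly (pderiv P) x\<bar> \<le> B1"
    using poly_bounded_on_interval[of R "pderiv P"] by auto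
  obtain B2 where B2: "B2 \<ge> 0" "\<And>x. \<bar>x\<bar> \<le> R \<Longrightarrow> \<bar>poly (pderiv (pderiv P)) x\<bar> \<le> B2"
    using poly_bounded_on_interval[of R "pderiv (pderiv P)"] by auto
  define C where "C = B1 + B2"
  have \<xi>C: "\<bar>\<xi> i z\<bar> \<le> C" and \<eta>C: "\<bar>\<eta> i z\<bar> \<le> C" if "i \<in> {1..N}" for i z
  proof -
    have *: "\<bar>\<zeta> z * x\<bar> \<le> C" if "\<zeta> z \<noteq> 0 \<Longrightarrow> \<bar>x\<bar> \<le> C" for x
    proof (cases "\<zeta> z = 0")
      case False
      have "\<bar>\<zeta> z\<bar> * \<bar>x\<bar> \<le> 1 * C" using that[OF False] \<zeta>_bounds[of z] by (intro mult_mono) auto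
      then show ?thesis by (simp add: abs_mult)
    qed (use B1 B2 in \<open>simp add: C_def\<close>)
    show "\<bar>\<xi> i z\<bar> \<le> C" unfolding \<xi>_def
      by (rule *) (use B1(2)[OF \<zeta>_local[OF _ that]] B2(1) in \<open>force simp: C_def\<close>)
    have "\<bar>poly (pderiv (pderiv P)) (z i) / 2\<bar> \<le> C" if "\<zeta> z \<noteq> 0"
      using B2(2)[OF \<zeta>_local[OF that \<open>i \<in> {1..N}\<close>]] B1(1) B2(1) by (simp add: C_def)
    then show "\<bar>\<eta> i z\<bar> \<le> C" unfolding \<eta>_def by (rule *)
  qed
  define D where "D m k \<omega> = (\<Sum>i\<in>{1..N}. \<xi> i (state (mesh T m k) \<omega>) * (b i (mesh T m (Suc k)) \<omega> - b i (mesh T m k) \<omega>)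
     + \<eta> i (state (mesh T m k) \<omega>) * ((b i (mesh T m (Suc k)) \<omega> - b i (mesh T m k) \<omega>)\<^sup>2 - T / 4 ^ m))" for m k \<omega>
  define E where "E m = {\<omega>\<in>space M. \<exists>k\<le>4^m. e \<le> \<bar>\<Sum>j<k. D m j \<omega>\<bar>}" for m
  have yF: "(\<lambda>\<omega>. state t \<omega> i) \<in> borel_measurable (BM_filtration M N b t)" if "i \<in> {1..N}" "0 \<le> t" for i t
    using y_adapted[OF that(1)] that(2) by (simp add: adapted_def state_def)
  \<comment> \<open>\<open>C\<close> depends on \<open>R\<close> but is multiplied by
    \<open>4^-m\<close>; only \<open>q\<close> remains in the limit.\<close>
  have E: "E m \<in> events \<and> prob (E m) \<le> (2 * q * T + 4 * (real N)\<^sup>2 * C\<^sup>2 * T\<^sup>2 / 4 ^ m) / e\<^sup>2" for m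
  proof -
    define F where "F k = BM_filtration M N b (mesh T m k)" for k
    have h: "mesh T m k \<ge> 0" "mesh T m k < mesh T m (Suc k)" "mesh T m (Suc k) - mesh T m k = T / 4^m" for k
      using T mesh_mono[of T 0 _ m] by (auto simp: mesh_Suc)
    have mx: "(\<lambda>\<omega>. \<xi> i (state (mesh T m k) \<omega>)) \<in> borel_measurable (BM_filtration M N b (mesh T m k))"
      "(\<lambda>\<omega>. \<eta> i (state (mesh T m k) \<omega>)) \<in> borel_measurable (BM_filtration M N b (mesh T m k))" if "i \<in> {1..N}" for i k
    proof -
      have cp: "poly p \<in> borel_measurable borel" for p :: "real poly"
        by (intro borel_measurable_continuous_onI continuous_intros)
      note [measurable] = \<zeta>_meas[OF h(1)[of k]] measurable_compose[OF yF[OF that h(1)[of k]] cp]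
      show "(\<lambda>\<omega>. \<xi> i (state (mesh T m k) \<omega>)) \<in> borel_measurable (BM_filtration M N b (mesh T m k))"
        "(\<lambda>\<omega>. \<eta> i (state (mesh T m k) \<omega>)) \<in> borel_measurable (BM_filtration M N b (mesh T m k))"
        unfolding \<xi>_def \<eta>_def by measurable
    qed
    have q': "(\<Sum>i\<in>{1..N}. (\<xi> i (state (mesh T m k) \<omega>))\<^sup>2) \<le> q" for k \<omega>
      using q unfolding \<xi>_def by simp
    have D_eq: "D m k = (\<lambda>\<omega>. \<Sum>i\<in>{1..N}. \<xi> i (state (mesh T m k) \<omega>) * (b i (mesh T m (Suc k)) \<omega> - b i (mesh T m k) \<omega>)
     + \<eta> i (state (mesh T m k) \<omega>) * ((b i (mesh T m (Suc k)) \<omega> - b i (mesh T m k) \<omega>)\<^sup>2 - (mesh T m (Suc k) - mesh T m k)))" for k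
      unfolding h(3) by (simp add: D_def[abs_def])
    note incr = martingale_increment[where \<xi>="\<lambda>i \<omega>. \<xi> i (state (mesh T m k) \<omega>)" and \<eta>="\<lambda>i \<omega>. \<eta> i (state (mesh T m k) \<omega>)"
        and s="mesh T m k" and t="mesh T m (Suc k)" and C=C and q=q for k]
    have mi: "D m k \<in> borel_measurable (BM_filtration M N b (mesh T m (Suc k)))"
      "integrable M (\<lambda>\<omega>. (D m k \<omega>)\<^sup>2)"
      "expectation (\<lambda>\<omega>. (D m k \<omega>)\<^sup>2) \<le> 2 * q * (mesh T m (Suc k) - mesh T m k) + 4 * (real N)\<^sup>2 * C\<^sup>2 * (mesh T m (Suc k) - mesh T m k)\<^sup>2" for k
      unfolding D_eq by (rule incr(1) incr(2) incr(3); (rule h mx \<xi>C \<eta>C q' | assumption)+)+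
    have mi4: "expectation (\<lambda>\<omega>. Z \<omega> * D m k \<omega>) = 0"
      if "Z \<in> borel_measurable (BM_filtration M N b (mesh T m k))" "\<exists>K. \<forall>\<omega>. \<bar>Z \<omega>\<bar> \<le> K" for Z k
      unfolding D_eq by (rule incr(4)) ((rule h mx \<xi>C \<eta>C q' that | assumption)+)
    have kol: "{\<omega>\<in>space M. \<exists>k\<le>4^m. e \<le> \<bar>\<Sum>j<k. D m j \<omega>\<bar>} \<in> events"
        "prob {\<omega>\<in>space M. \<exists>k\<le>4^m. e \<le> \<bar>\<Sum>j<k. D m j \<omega>\<bar>} \<le> (\<Sum>j<4^m. expectation (\<lambda>\<omega>. (D m j \<omega>)\<^sup>2)) / e\<^sup>2"
    proof -
      have sub: "subalgebra M (F k)" "sets (F k) \<subseteq> sets (F (Suc k))" for k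
        unfolding F_def using subalgebra_BM_filtration BM_filtration_mono[OF less_imp_le[OF h(2)]] by simp_all
      note kol = kolmogorov_martingale_inequality[where F=F and d="D m" and e=e and n="4^m"]
      have F: "D m k \<in> borel_measurable (F (Suc k))" for k unfolding F_def by (rule mi(1))
      have Z: "expectation (\<lambda>\<omega>. Z \<omega> * D m k \<omega>) = 0"
        if "Z \<in> borel_measurable (F k)" "\<exists>C. \<forall>\<omega>. \<bar>Z \<omega>\<bar> \<le> C" for k Z
        using that unfolding F_def by (rule mi4)
      show "{\<omega>\<in>space M. \<exists>k\<le>4^m. e \<le> \<bar>\<Sum>j<k. D m j \<omega>\<bar>} \<in> events" by (rule kol(1)[OF sub F mi(2) Z e])
      show "prob {\<omega>\<in>space M. \<exists>k\<le>4^m. e \<le> \<bar>\<Sum>j<k. D m j \<omega>\<bar>} \<le> (\<Sum>j<4^m. expectation (\<lambda>\<omega>. (D m j \<omega>)\<^sup>2)) / e\<^sup>2"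
        by (rule kol(2)[OF sub F mi(2) Z e])
    qed
    have "(\<Sum>j<4^m. expectation (\<lambda>\<omega>. (D m j \<omega>)\<^sup>2)) \<le> (\<Sum>j<(4::nat)^m. 2 * q * (T / 4 ^ m) + 4 * (real N)\<^sup>2 * C\<^sup>2 * (T / 4 ^ m)\<^sup>2)"
      using mi(3) unfolding h(3) by (intro sum_mono)
    also have "\<dots> = 2 * q * T + 4 * (real N)\<^sup>2 * C\<^sup>2 * T\<^sup>2 / 4 ^ m"
      by (simp add: field_simps power2_eq_square)
    finally have "(\<Sum>j<4^m. expectation (\<lambda>\<omega>. (D m j \<omega>)\<^sup>2)) / e\<^sup>2 \<le> (2 * q * T + 4 * (real N)\<^sup>2 * C\<^sup>2 * T\<^sup>2 / 4 ^ m) / e\<^sup>2"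
      by (intro divide_right_mono) auto
    then show ?thesis unfolding E_def by (intro conjI kol(1) order_trans[OF kol(2)])
  qed
  \<comment> \<open>A lower limit of events: \<open>prob (E m)\<close> is bounded but not summable,
    so an upper limit could not be controlled. The price is that a good path avoids
    \<open>E m\<close> for infinitely many \<open>m\<close> only.\<close>
  define A0 where "A0 = (\<Union>n. \<Inter>m\<in>{n..}. E m)"
  have inter_ev: "(\<Inter>m\<in>{n..}. E m) \<in> events" for n
    using E by (intro sets.countable_INT) auto
  then have A0_ev: "A0 \<in> events" unfolding A0_def by auto
  have prob_A0: "prob A0 \<le> 2 * q * T / e\<^sup>2"
  proof (rule LIMSEQ_le)
    show "(\<lambda>n. prob (\<Inter>m\<in>{n..}. E m)) \<longlonglongrightarrow> prob A0"
      unfolding A0_def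
    proof (rule finite_Lim_measure_incseq)
      show "range (\<lambda>n. \<Inter>m\<in>{n..}. E m) \<subseteq> events" using inter_ev by auto
      show "incseq (\<lambda>n. \<Inter>m\<in>{n..}. E m)" unfolding incseq_def by (intro allI impI INF_superset_mono) auto
    qed
    have "(\<lambda>n. (2 * q * T + 4 * (real N)\<^sup>2 * C\<^sup>2 * T\<^sup>2 * (1/4) ^ n) / e\<^sup>2) \<longlonglongrightarrow> (2 * q * T + 4 * (real N)\<^sup>2 * C\<^sup>2 * T\<^sup>2 * 0) / e\<^sup>2"
      using e by (intro tendsto_intros LIMSEQ_realpow_zero) auto
    then show "(\<lambda>n. (2 * q * T + 4 * (real N)\<^sup>2 * C\<^sup>2 * T\<^sup>2 / 4 ^ n) / e\<^sup>2) \<longlonglongrightarrow> 2 * q * T / e\<^sup>2"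
      by (simp add: power_divide)
    have "prob (\<Inter>m\<in>{n..}. E m) \<le> prob (E n)" for n
      using E by (intro finite_measure_mono) auto
    then show "\<exists>n0. \<forall>n\<ge>n0. prob (\<Inter>m\<in>{n..}. E m) \<le> (2 * q * T + 4 * (real N)\<^sup>2 * C\<^sup>2 * T\<^sup>2 / 4 ^ n) / e\<^sup>2"
      using E order_trans by blast
  qed
  define good where "good \<omega> \<longleftrightarrow> (\<forall>i\<in>{1..N}. b i 0 \<omega> = 0 \<and>
     (\<lambda>m. \<Sum>k<4^m. \<bar>b i (mesh T m (Suc k)) \<omega> - b i (mesh T m k) \<omega>\<bar> ^ 3) \<longlonglongrightarrow> 0 \<and>
     (\<forall>t\<ge>0. set_integrable lborel {0..t} (a i \<omega>) \<and> y i t \<omega> = y0 i + b i t \<omega> + (LBINT s:{0..t}. a i \<omega> s)))" for \<omega>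
  have "AE \<omega> in M. good \<omega>"
    unfolding good_def
  proof (rule AE_finite_allI)
    fix i assume i: "i \<in> {1..N}"
    have "AE \<omega> in M. b i 0 \<omega> = 0" using BM[OF i] by (simp add: standard_BM_def)
    with cubic_variation_vanishes[OF i T] y_drift[OF i]
    show "AE \<omega> in M. b i 0 \<omega> = 0 \<and>
     (\<lambda>m. \<Sum>k<4^m. \<bar>b i (mesh T m (Suc k)) \<omega> - b i (mesh T m k) \<omega>\<bar> ^ 3) \<longlonglongrightarrow> 0 \<and>
     (\<forall>t\<ge>0. set_integrable lborel {0..t} (a i \<omega>) \<and> y i t \<omega> = y0 i + b i t \<omega> + (LBINT s:{0..t}. a i \<omega> s))"
      by eventually_elim auto
  qed simp
  then obtain Nl where Nl: "{\<omega>\<in>space M. \<not> good \<omega>} \<subseteq> Nl" "emeasure M Nl = 0" "Nl \<in> events"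
    by (rule AE_E)
  have N0: "Nl \<in> null_sets M" using Nl by auto
  show ?thesis
  proof (intro bexI[of _ "A0 \<union> Nl"] conjI ballI)
    show "A0 \<union> Nl \<in> events" using A0_ev Nl by auto
    show "prob (A0 \<union> Nl) \<le> 2 * q * T / e\<^sup>2"
      using prob_A0 measure_Un_null_set[OF A0_ev N0] by simp
    fix \<omega> assume \<omega>: "\<omega> \<in> space M - (A0 \<union> Nl)"
    then have good: "good \<omega>" and \<omega>M: "\<omega> \<in> space M" using Nl by auto
    have integ: "a i \<omega> absolutely_integrable_on {0..t}" "y i t \<omega> = y0 i + b i t \<omega> + integral {0..t} (a i \<omega>)"
      if "i \<in> {1..N}" "0 \<le> t" for i t
    proof -
      have s: "set_integrable lborel {0..t} (a i \<omega>)" and y: "y i t \<omega> = y0 i + b i t \<omega> + (LBINT s:{0..t}. a i \<omega> s)"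
        using good that unfolding good_def by auto
      show "a i \<omega> absolutely_integrable_on {0..t}" "y i t \<omega> = y0 i + b i t \<omega> + integral {0..t} (a i \<omega>)"
        using lborel_set_integral_Henstock[OF s] y by auto
    qed
    show "y i 0 \<omega> = y0 i" if "i \<in> {1..N}" for i
      using integ(2)[OF that, of 0] good that unfolding good_def by simp
    show "a i \<omega> absolutely_integrable_on {0..T}" if "i \<in> {1..N}" for i
      using integ(1)[OF that] T by simp
    define rem where "rem i m k = poly P (y i (mesh T m (Suc k)) \<omega>) - poly P (y i (mesh T m k) \<omega>)
      - integral {mesh T m k..mesh T m (Suc k)} (generator_term P i \<omega>)
      - (poly (pderiv P) (y i (mesh T m k) \<omega>) * (b i (mesh T m (Suc k)) \<omega> - b i (mesh T m k) \<omega>)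
         + poly (pderiv (pderiv P)) (y i (mesh T m k) \<omega>) / 2 * ((b i (mesh T m (Suc k)) \<omega> - b i (mesh T m k) \<omega>)\<^sup>2 - T / 4 ^ m))" for i m k
    have "(\<lambda>m. \<Sum>k<4^m. \<bar>rem i m k\<bar>) \<longlonglongrightarrow> 0" if i: "i \<in> {1..N}" for i
      unfolding rem_def generator_term_def
    proof (rule mesh_Ito_remainder[OF T])
      show "continuous_on {0..T} (\<lambda>t. y i t \<omega>)"
        using y_paths[OF i] \<omega>M unfolding continuous_paths_def by (auto intro: continuous_on_subset)
      show "a i \<omega> absolutely_integrable_on {0..T}" using integ(1)[OF i] T by simp
      show "y i t \<omega> = y0 i + b i t \<omega> + integral {0..t} (a i \<omega>)" if "t \<in> {0..T}" for t
        using integ(2)[OF i] that by simp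
      show "(\<lambda>m. \<Sum>k<4^m. \<bar>b i (mesh T m (Suc k)) \<omega> - b i (mesh T m k) \<omega>\<bar> ^ 3) \<longlonglongrightarrow> 0"
        using good i unfolding good_def by blast
    qed
    then have "(\<lambda>m. \<Sum>i\<in>{1..N}. \<Sum>k<4^m. \<bar>rem i m k\<bar>) \<longlonglongrightarrow> (\<Sum>i\<in>{1..N}. 0)"
      by (intro tendsto_sum) auto
    then have ev: "\<forall>\<^sub>F m in sequentially. (\<Sum>i\<in>{1..N}. \<Sum>k<4^m. \<bar>rem i m k\<bar>) < e"
      using e by (intro order_tendstoD(2)) auto
    have "\<exists>\<^sub>F m in sequentially. \<omega> \<notin> E m"
      using \<omega> unfolding A0_def frequently_sequentially by auto
    \<comment> \<open>The remainders are small for all large \<open>m\<close>, so they can be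
      combined with the infinitely many good \<open>m\<close>. Martingale and remainders contribute
      one \<open>e\<close> each, whence \<open>2 * e\<close>.\<close>
    then have "\<exists>\<^sub>F m in sequentially. \<omega> \<notin> E m \<and> (\<Sum>i\<in>{1..N}. \<Sum>k<4^m. \<bar>rem i m k\<bar>) < e"
    proof (rule frequently_rev_mp)
      show "\<forall>\<^sub>F m in sequentially. \<omega> \<notin> E m \<longrightarrow> \<omega> \<notin> E m \<and> (\<Sum>i\<in>{1..N}. \<Sum>k<4^m. \<bar>rem i m k\<bar>) < e"
        using ev by eventually_elim simp
    qed
    then show "\<exists>\<^sub>F m in sequentially. \<forall>k\<le>4^m. \<bar>\<Sum>j<k. \<zeta> (state (mesh T m j) \<omega>) *
        (\<Sum>i\<in>{1..N}. poly P (y i (mesh T m (Suc j)) \<omega>) - poly P (y i (mesh T m j) \<omega>)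
           - integral {mesh T m j..mesh T m (Suc j)} (generator_term P i \<omega>))\<bar> \<le> 2 * e"
    proof (rule frequently_elim1)
      fix m assume m: "\<omega> \<notin> E m \<and> (\<Sum>i\<in>{1..N}. \<Sum>k<4^m. \<bar>rem i m k\<bar>) < e"
      show "\<forall>k\<le>4^m. \<bar>\<Sum>j<k. \<zeta> (state (mesh T m j) \<omega>) *
        (\<Sum>i\<in>{1..N}. poly P (y i (mesh T m (Suc j)) \<omega>) - poly P (y i (mesh T m j) \<omega>)
           - integral {mesh T m j..mesh T m (Suc j)} (generator_term P i \<omega>))\<bar> \<le> 2 * e"
      proof (intro allI impI)
        fix k :: nat assume k: "k \<le> 4^m"
        have eq: "\<zeta> (state (mesh T m j) \<omega>) * (\<Sum>i\<in>{1..N}. poly P (y i (mesh T m (Suc j)) \<omega>) - poly P (y i (mesh T m j) \<omega>)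
           - integral {mesh T m j..mesh T m (Suc j)} (generator_term P i \<omega>))
           = D m j \<omega> + (\<Sum>i\<in>{1..N}. \<zeta> (state (mesh T m j) \<omega>) * rem i m j)" for j
          unfolding D_def sum.distrib[symmetric] sum_distrib_left rem_def \<xi>_def \<eta>_def
          by (intro sum.cong refl) (simp add: state_def algebra_simps)
        have D: "\<bar>\<Sum>j<k. D m j \<omega>\<bar> < e" using m k \<omega>M unfolding E_def by force
        have "\<bar>\<Sum>j<k. \<Sum>i\<in>{1..N}. \<zeta> (state (mesh T m j) \<omega>) * rem i m j\<bar> \<le> (\<Sum>j<k. \<Sum>i\<in>{1..N}. \<bar>rem i m j\<bar>)"
        proof (intro order_trans[OF sum_abs] sum_mono)
          fix j i show "\<bar>\<zeta> (state (mesh T m j) \<omega>) * rem i m j\<bar> \<le> \<bar>rem i m j\<bar>"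
            using \<zeta>_bounds[of "state (mesh T m j) \<omega>"] by (simp add: abs_mult mult_left_le_one_le)
        qed
        also have "\<dots> \<le> (\<Sum>j<4^m. \<Sum>i\<in>{1..N}. \<bar>rem i m j\<bar>)"
          using k by (intro sum_mono2) (auto intro!: sum_nonneg)
        also have "\<dots> = (\<Sum>i\<in>{1..N}. \<Sum>j<4^m. \<bar>rem i m j\<bar>)" by (rule sum.swap)
        finally show "\<bar>\<Sum>j<k. \<zeta> (state (mesh T m j) \<omega>) *
          (\<Sum>i\<in>{1..N}. poly P (y i (mesh T m (Suc j)) \<omega>) - poly P (y i (mesh T m j) \<omega>)
           - integral {mesh T m j..mesh T m (Suc j)} (generator_term P i \<omega>))\<bar> \<le> 2 * e"
          unfolding eq sum.distrib using D m by linarith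
      qed
    qed
  qed
qed

end

section \<open>The drift of the moments\<close>

text \<open>Exchanging \<open>i\<close> and \<open>j\<close> turns the singular sum into half the
  sum of the difference quotients \<open>(x_i^m - x_j^m) / (x_i - x_j)\<close>, which are
  polynomials. Completing the double sum by its diagonal, where the quotient becomes
  \<open>m x^(m-1)\<close>, produces the products of power sums and the subtracted term.\<close>

lemma sum_power_div_diff:
  fixes x :: "'i \<Rightarrow> real"
  assumes I: "finite I" and inj: "inj_on x I"
  shows "(\<Sum>i\<in>I. \<Sum>j\<in>I - {i}. x i ^ m / (x i - x j)) =
    ((\<Sum>k<m. (\<Sum>i\<in>I. x i ^ k) * (\<Sum>i\<in>I. x i ^ (m - 1 - k))) - real m * (\<Sum>i\<in>I. x i ^ (m - 1))) / 2"
proof -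
  define f where "f i j = x i ^ m / (x i - x j)" for i j
  have off: "(\<Sum>i\<in>I. \<Sum>j\<in>I - {i}. g i j) = (\<Sum>i\<in>I. \<Sum>j\<in>I. if i = j then 0 else g i j)" for g :: "'i \<Rightarrow> 'i \<Rightarrow> real"
  proof (rule sum.cong[OF refl])
    fix i assume "i \<in> I"
    from sum.remove[OF I this, of "\<lambda>j. if i = j then 0 else g i j"]
    have "(\<Sum>j\<in>I. if i = j then 0 else g i j) = (\<Sum>j\<in>I - {i}. if i = j then 0 else g i j)" by simp
    also have "\<dots> = (\<Sum>j\<in>I - {i}. g i j)" by (intro sum.cong) auto
    finally show "(\<Sum>j\<in>I - {i}. g i j) = (\<Sum>j\<in>I. if i = j then 0 else g i j)" by simp
  qed
  have "2 * (\<Sum>i\<in>I. \<Sum>j\<in>I - {i}. f i j) = (\<Sum>i\<in>I. \<Sum>j\<in>I. if i = j then 0 else f i j) + (\<Sum>j\<in>I. \<Sum>i\<in>I. if i = j then 0 else f i j)"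
    unfolding off by (subst sum.swap) simp
  also have "\<dots> = (\<Sum>i\<in>I. \<Sum>j\<in>I. if i = j then 0 else f i j + f j i)"
    unfolding sum.distrib[symmetric] by (intro sum.cong refl) auto
  also have "\<dots> = (\<Sum>i\<in>I. \<Sum>j\<in>I. (\<Sum>k<m. x j ^ (m - Suc k) * x i ^ k) - (if i = j then real m * x i ^ (m - 1) else 0))"
  proof (intro sum.cong refl)
    fix i j assume ij: "i \<in> I" "j \<in> I"
    show "(if i = j then 0 else f i j + f j i) = (\<Sum>k<m. x j ^ (m - Suc k) * x i ^ k) - (if i = j then real m * x i ^ (m - 1) else 0)"
    proof (cases "i = j")
      case True
      have "x i ^ (m - Suc k) * x i ^ k = x i ^ (m - 1)" if "k < m" for k
        using that by (simp add: power_add[symmetric])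
      then show ?thesis using True by simp
    next
      case False
      then have ne: "x i - x j \<noteq> 0" using inj ij by (auto dest: inj_onD)
      have "f i j + f j i = (x i ^ m - x j ^ m) / (x i - x j)"
      proof -
        have "f j i = - (x j ^ m / (x i - x j))" unfolding f_def using minus_divide_right[of "x j ^ m" "x i - x j"] by simp
        then show ?thesis by (simp add: f_def diff_divide_distrib)
      qed
      also have "\<dots> = (\<Sum>k<m. x j ^ (m - Suc k) * x i ^ k)"
        using ne by (simp add: power_diff_sumr2)
      finally show ?thesis using False by simp
    qed
  qed
  also have "\<dots> = (\<Sum>i\<in>I. \<Sum>j\<in>I. \<Sum>k<m. x j ^ (m - Suc k) * x i ^ k) - (\<Sum>i\<in>I. real m * x i ^ (m - 1))"
    using I by (simp add: sum_subtractf)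
  also have "(\<Sum>i\<in>I. \<Sum>j\<in>I. \<Sum>k<m. x j ^ (m - Suc k) * x i ^ k) = (\<Sum>i\<in>I. \<Sum>k<m. x i ^ k * (\<Sum>j\<in>I. x j ^ (m - Suc k)))"
    by (intro sum.cong refl, subst sum.swap) (simp add: sum_distrib_left mult.commute)
  also have "\<dots> = (\<Sum>k<m. (\<Sum>i\<in>I. x i ^ k) * (\<Sum>i\<in>I. x i ^ (m - 1 - k)))"
    by (subst sum.swap) (simp add: sum_distrib_right)
  also have "(\<Sum>i\<in>I. real m * x i ^ (m - 1)) = real m * (\<Sum>i\<in>I. x i ^ (m - 1))"
    by (simp only: sum_distrib_left)
  finally have h: "2 * (\<Sum>i\<in>I. \<Sum>j\<in>I - {i}. f i j) =
    (\<Sum>k<m. (\<Sum>i\<in>I. x i ^ k) * (\<Sum>i\<in>I. x i ^ (m - 1 - k))) - real m * (\<Sum>i\<in>I. x i ^ (m - 1))" .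
  show ?thesis unfolding h[symmetric] by (simp add: f_def)
qed

text \<open>The three summands come from the constant drift \<alpha>, the Ito correction and the
  interaction; \<open>2 * e * x + s\<close> is the squared diffusion coefficient of a particle at
  \<open>x\<close>. For \<open>n \<le> 1\<close> the truncated indices \<open>n - 1\<close> and
  \<open>n - 2\<close> stand next to a factor or a range of sum that is zero. The expression is
  linear in \<open>(e, s)\<close>, which accounts for the time change.\<close>

definition moment_drift :: "real \<Rightarrow> real \<Rightarrow> nat \<Rightarrow> real \<Rightarrow> real \<Rightarrow> (nat \<Rightarrow> real) \<Rightarrow> nat \<Rightarrow> real" where
  "moment_drift c \<alpha> N e s S n =
     real n * e * \<alpha> * S (n - 1)
     + real n * real (n - 1) / 2 * (2 * e * S (n - 1) + s * S (n - 2))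
     + c * real n / 2 * (2 * e * ((\<Sum>k<n. S k * S (n - 1 - k)) - real n / real N * S (n - 1))
                       + s * ((\<Sum>k<n - 1. S k * S (n - 2 - k)) - real (n - 1) / real N * S (n - 2)))"

lemma moment_drift_scale: "r * moment_drift c \<alpha> N e s S n = moment_drift c \<alpha> N (r * e) (r * s) S n"
  by (simp add: moment_drift_def algebra_simps)

text \<open>A polynomial in the Dunkl coordinate instead of the Laguerre coordinate: there the
  diffusion coefficient is 1 and the noise is the Brownian path itself, so no stochastic integral
  arises.\<close>

definition moment_poly :: "nat \<Rightarrow> real \<Rightarrow> real \<Rightarrow> nat \<Rightarrow> real poly" where
  "moment_poly N \<gamma> E n = smult (1 / real N) ([:- \<gamma> * E, 0, \<gamma> / 2:] ^ n)"

lemma poly_moment_poly: "poly (moment_poly N \<gamma> E n) z = (\<gamma> * (z\<^sup>2 / 2 - E)) ^ n / real N"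
  by (simp add: moment_poly_def poly_power algebra_simps power2_eq_square)

lemma poly_pderiv_moment_poly:
  "poly (pderiv (moment_poly N \<gamma> E n)) z = real n * (\<gamma> * (z\<^sup>2 / 2 - E)) ^ (n - 1) * (\<gamma> * z) / real N"
  by (simp add: moment_poly_def pderiv_smult pderiv_power pderiv_pCons poly_power algebra_simps power2_eq_square)

lemma poly_pderiv2_moment_poly:
  "poly (pderiv (pderiv (moment_poly N \<gamma> E n))) z =
    real n * (real (n - 1) * (\<gamma> * (z\<^sup>2 / 2 - E)) ^ (n - 2) * (\<gamma> * z)\<^sup>2 + (\<gamma> * (z\<^sup>2 / 2 - E)) ^ (n - 1) * \<gamma>) / real N"
proof -
  have q: "poly [:- \<gamma> * E, 0, \<gamma> / 2:] z = \<gamma> * (z\<^sup>2 / 2 - E)" by (simp add: algebra_simps power2_eq_square)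
  have d: "pderiv [:- \<gamma> * E, 0, \<gamma> / 2:] = [:0, \<gamma>:]" by (simp add: pderiv_pCons)
  have d2: "pderiv [:0, \<gamma>:] = [:\<gamma>:]" by (simp add: pderiv_pCons)
  have n: "n - Suc (Suc 0) = n - 2" by simp
  show ?thesis
    unfolding moment_poly_def pderiv_smult pderiv_power pderiv_mult d d2 poly_smult poly_mult poly_add poly_power q
    by (simp add: n algebra_simps power2_eq_square add_divide_distrib)
qed

text \<open>With \<open>x = \<gamma> (z\<^sup>2 / 2 - E)\<close> one has \<open>\<gamma>\<^sup>2 z\<^sup>2 = 2 \<gamma> x + 2 \<gamma>\<^sup>2 E\<close>; antisymmetrising the
  interaction leaves a polynomial in the moments.\<close>

lemma Dunkl_generator_moment_poly:
  assumes N: "N \<ge> 1" and \<gamma>: "\<gamma> > 0" and inj: "inj_on z {1..N}" and z: "\<And>i. i \<in> {1..N} \<Longrightarrow> 0 < z i"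
  shows "(\<Sum>i\<in>{1..N}. poly (pderiv (moment_poly N \<gamma> E n)) (z i) * Dunkl_B_drift N \<alpha> (2 * c / real N) z i
            + poly (pderiv (pderiv (moment_poly N \<gamma> E n))) (z i) / 2)
       = moment_drift c \<alpha> N \<gamma> (2 * \<gamma>\<^sup>2 * E) (empirical_moment N (\<lambda>i. \<gamma> * ((z i)\<^sup>2 / 2 - E))) n"
proof (cases "n = 0")
  case True
  then show ?thesis by (simp add: poly_pderiv_moment_poly poly_pderiv2_moment_poly moment_drift_def)
next
  case n0: False
  define I where "I = {1..N}"
  define x where "x i = \<gamma> * ((z i)\<^sup>2 / 2 - E)" for i
  define p where "p k = (\<Sum>i\<in>I. x i ^ k)" for k
  define s where "s = 2 * \<gamma>\<^sup>2 * E"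
  have I: "finite I" "inj_on z I" "\<And>i. i \<in> I \<Longrightarrow> 0 < z i" using inj z by (auto simp: I_def)
  have v: "(\<gamma> * z i)\<^sup>2 = 2 * \<gamma> * x i + s" for i
    by (simp add: x_def s_def algebra_simps power2_eq_square)
  have xinj: "inj_on x I"
  proof (rule inj_onI)
    fix i j assume ij: "i \<in> I" "j \<in> I" "x i = x j"
    then have "(z i)\<^sup>2 = (z j)\<^sup>2" using \<gamma> by (simp add: x_def)
    then have "z i = z j" using I(3)[OF ij(1)] I(3)[OF ij(2)] by (simp add: power2_eq_iff_nonneg)
    then show "i = j" using I(2) ij by (auto dest: inj_onD)
  qed
  \<comment> \<open>The two poles of the type B interaction add up to
    \<open>2 z_i / (z_i^2 - z_j^2)\<close>, and \<open>z_i^2 - z_j^2\<close> is a multiple of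
    \<open>x_i - x_j\<close>.\<close>
  have inter: "\<gamma> * z i * (1 / (z i - z j) + 1 / (z i + z j)) = (2 * \<gamma> * x i + s) / (x i - x j)"
    if "i \<in> I" "j \<in> I - {i}" for i j
  proof -
    have ne: "z i - z j \<noteq> 0" "z i + z j \<noteq> 0"
      using I(2,3) that inj_onD[OF I(2)] by (auto, metis add_pos_pos less_irrefl)
    have "x i - x j = \<gamma> * ((z i - z j) * (z i + z j)) / 2"
      by (simp add: x_def algebra_simps power2_eq_square)
    then have "(2 * \<gamma> * x i + s) / (x i - x j) = (\<gamma> * z i)\<^sup>2 / (\<gamma> * ((z i - z j) * (z i + z j)) / 2)"
      unfolding v[symmetric] by (simp only:)
    also have "\<dots> = \<gamma> * z i * (1 / (z i - z j) + 1 / (z i + z j))"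
      using ne \<gamma> by (simp add: divide_simps) (simp add: algebra_simps power2_eq_square)
    finally show ?thesis by simp
  qed
  have summand: "poly (pderiv (moment_poly N \<gamma> E n)) (z i) * Dunkl_B_drift N \<alpha> (2 * c / real N) z i
            + poly (pderiv (pderiv (moment_poly N \<gamma> E n))) (z i) / 2
     = real n / N * (\<gamma> * \<alpha> * x i ^ (n - 1))
       + real n / N * (real (n - 1) / 2 * (2 * \<gamma> * x i ^ (n - 1) + s * x i ^ (n - 2)))
       + real n / N * (c / N) * (2 * \<gamma> * (\<Sum>j\<in>I - {i}. x i ^ n / (x i - x j)) + s * (\<Sum>j\<in>I - {i}. x i ^ (n - 1) / (x i - x j)))"
    if i: "i \<in> I" for i
  proof -
    define w where "w = (\<Sum>j\<in>I - {i}. 1 / (x i - x j))"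
    have "(\<gamma> * z i) * Dunkl_B_drift N \<alpha> (2 * c / real N) z i
      = \<gamma> * (\<alpha> - 1/2) + c / N * (\<Sum>j\<in>I - {i}. \<gamma> * z i * (1 / (z i - z j) + 1 / (z i + z j)))"
      using I(3)[OF i] by (simp add: Dunkl_B_drift_def I_def sum_distrib_left field_simps)
    also have "(\<Sum>j\<in>I - {i}. \<gamma> * z i * (1 / (z i - z j) + 1 / (z i + z j))) = (2 * \<gamma> * x i + s) * w"
      unfolding w_def sum_distrib_left using inter[OF i] by (intro sum.cong refl) simp
    finally have drift: "(\<gamma> * z i) * Dunkl_B_drift N \<alpha> (2 * c / real N) z i = \<gamma> * (\<alpha> - 1/2) + c / N * ((2 * \<gamma> * x i + s) * w)" .
    have xn: "x i ^ n = x i ^ (n - 1) * x i" using n0 by (metis power_minus_mult neq0_conv)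
    \<comment> \<open>For \<open>n = 1\<close> the exponent \<open>n - 2\<close> is truncated to 0
      and the powers differ; the prefactor \<open>n - 1\<close> restores the equality.\<close>
    have xn1: "real (n - 1) * (x i ^ (n - 2) * x i) = real (n - 1) * x i ^ (n - 1)"
    proof (cases "n = 1")
      case False
      then have "n - 1 = Suc (n - 2)" using n0 by simp
      then show ?thesis by simp
    qed simp
    have "poly (pderiv (moment_poly N \<gamma> E n)) (z i) * Dunkl_B_drift N \<alpha> (2 * c / real N) z i
      = real n / N * x i ^ (n - 1) * ((\<gamma> * z i) * Dunkl_B_drift N \<alpha> (2 * c / real N) z i)"
      by (simp add: poly_pderiv_moment_poly x_def)
    also have "\<dots> = real n / N * x i ^ (n - 1) * (\<gamma> * (\<alpha> - 1/2) + c / N * ((2 * \<gamma> * x i + s) * w))"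
      unfolding drift ..
    finally have t1: "poly (pderiv (moment_poly N \<gamma> E n)) (z i) * Dunkl_B_drift N \<alpha> (2 * c / real N) z i
      = real n / N * x i ^ (n - 1) * (\<gamma> * (\<alpha> - 1/2) + c / N * ((2 * \<gamma> * x i + s) * w))" .
    have t2: "poly (pderiv (pderiv (moment_poly N \<gamma> E n))) (z i) = real n / N * (real (n - 1) * x i ^ (n - 2) * (2 * \<gamma> * x i + s) + x i ^ (n - 1) * \<gamma>)"
      by (simp add: poly_pderiv2_moment_poly x_def[symmetric] v)
    have w1: "(\<Sum>j\<in>I - {i}. x i ^ k / (x i - x j)) = x i ^ k * w" for k
      by (simp add: w_def sum_distrib_left)
    have w2: "(\<Sum>j\<in>I - {i}. x i ^ n / (x i - x j)) = x i ^ (n - 1) * x i * w"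
      unfolding w1 xn[symmetric] ..
    have t3: "real (n - 1) * x i ^ (n - 2) * (2 * \<gamma> * x i + s) = real (n - 1) * (2 * \<gamma> * x i ^ (n - 1) + s * x i ^ (n - 2))"
      using xn1 by (simp add: algebra_simps)
    \<comment> \<open>The \<open>- 1/2\<close> of the Dunkl drift cancels against the part
      \<open>x i ^ (n - 1) * \<gamma> / 2\<close> of the Ito correction, which leaves
      \<alpha>.\<close>
    show ?thesis unfolding t1 t2 w1[of "n - 1"] w2 t3 by (simp add: algebra_simps add_divide_distrib)
  qed
  have emp: "empirical_moment N (\<lambda>i. \<gamma> * ((z i)\<^sup>2 / 2 - E)) k = p k / N" for k
    by (simp add: empirical_moment_def p_def x_def I_def)
  have inter_sum: "(\<Sum>i\<in>I. \<Sum>j\<in>I - {i}. x i ^ m / (x i - x j)) = real N * real N / 2 * ((\<Sum>k<m. p k / N * (p (m - 1 - k) / N)) - real m / N * (p (m - 1) / N))" for m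
    unfolding sum_power_div_diff[OF I(1) xinj] p_def[symmetric]
    using N by (simp add: field_simps sum_distrib_left sum_divide_distrib)
  have "(\<Sum>i\<in>I. poly (pderiv (moment_poly N \<gamma> E n)) (z i) * Dunkl_B_drift N \<alpha> (2 * c / real N) z i
            + poly (pderiv (pderiv (moment_poly N \<gamma> E n))) (z i) / 2)
    = (\<Sum>i\<in>I. real n / N * (\<gamma> * \<alpha> * x i ^ (n - 1))
       + real n / N * (real (n - 1) / 2 * (2 * \<gamma> * x i ^ (n - 1) + s * x i ^ (n - 2)))
       + real n / N * (c / N) * (2 * \<gamma> * (\<Sum>j\<in>I - {i}. x i ^ n / (x i - x j)) + s * (\<Sum>j\<in>I - {i}. x i ^ (n - 1) / (x i - x j))))"
    by (rule sum.cong[OF refl summand])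
  also have "\<dots> = real n / N * (\<gamma> * \<alpha> * p (n - 1)) + real n / N * (real (n - 1) / 2 * (2 * \<gamma> * p (n - 1) + s * p (n - 2)))
       + real n / N * (c / N) * (2 * \<gamma> * (\<Sum>i\<in>I. \<Sum>j\<in>I - {i}. x i ^ n / (x i - x j)) + s * (\<Sum>i\<in>I. \<Sum>j\<in>I - {i}. x i ^ (n - 1) / (x i - x j)))"
    by (simp only: p_def sum.distrib sum_distrib_left distrib_left mult.assoc mult.left_commute mult.commute)
  also have "\<dots> = moment_drift c \<alpha> N \<gamma> s (\<lambda>k. p k / N) n"
    unfolding inter_sum moment_drift_def diff_diff_left using N by (simp add: algebra_simps numeral_2_eq_2)
  finally show ?thesis unfolding I_def[symmetric] s_def[symmetric] emp[abs_def] .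
qed

section \<open>Moment bounds\<close>

lemma power_le_one_plus_even_power:
  fixes u :: real assumes "even n" "k \<le> n" shows "\<bar>u\<bar> ^ k \<le> 1 + u ^ n"
proof (cases "\<bar>u\<bar> \<le> 1")
  case True
  then have "\<bar>u\<bar> ^ k \<le> 1" by (simp add: power_le_one)
  then show ?thesis using zero_le_even_power[OF assms(1), of u] by simp
next
  case False
  then have "\<bar>u\<bar> ^ k \<le> \<bar>u\<bar> ^ n" using assms by (intro power_increasing) auto
  then show ?thesis using assms(1) by (simp add: power_even_abs)
qed

lemma mixed_power_le_even_powers:
  fixes u v :: real assumes "even n" "k + l \<le> n" shows "\<bar>u\<bar> ^ k * \<bar>v\<bar> ^ l \<le> 1 + u ^ n + v ^ n"
proof -
  define m where "m = max \<bar>u\<bar> \<bar>v\<bar>"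
  have "\<bar>u\<bar> ^ k * \<bar>v\<bar> ^ l \<le> m ^ k * m ^ l"
    by (intro mult_mono power_mono) (auto simp: m_def)
  also have "\<dots> \<le> 1 + m ^ n"
    using power_le_one_plus_even_power[OF assms, of m] by (simp add: power_add m_def)
  also have "m ^ n \<le> u ^ n + v ^ n"
    using assms(1) zero_le_even_power[OF assms(1), of u] zero_le_even_power[OF assms(1), of v]
    by (auto simp: m_def max_def power_even_abs)
  finally show ?thesis by simp
qed

lemma empirical_moment_0: "N \<ge> 1 \<Longrightarrow> empirical_moment N x 0 = 1"
  by (simp add: empirical_moment_def)

lemma empirical_moment_even_nonneg: "even n \<Longrightarrow> 0 \<le> empirical_moment N x n"
  by (simp add: empirical_moment_def sum_nonneg zero_le_even_power)

lemma abs_empirical_moment_le: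
  assumes "N \<ge> 1" "even n" "k \<le> n"
  shows "\<bar>empirical_moment N x k\<bar> \<le> 1 + empirical_moment N x n"
proof -
  have "\<bar>\<Sum>i=1..N. x i ^ k\<bar> \<le> (\<Sum>i=1..N. 1 + x i ^ n)"
    by (intro order_trans[OF sum_abs] sum_mono) (simp add: power_abs power_le_one_plus_even_power[OF assms(2,3)])
  also have "\<dots> = N + (\<Sum>i=1..N. x i ^ n)" by (simp add: sum.distrib)
  finally have "\<bar>\<Sum>i=1..N. x i ^ k\<bar> / N \<le> (N + (\<Sum>i=1..N. x i ^ n)) / N" by (intro divide_right_mono) auto
  then show ?thesis using assms(1) by (simp add: empirical_moment_def add_divide_distrib)
qed

text \<open>The product is the average of \<open>x_i^k x_j^l\<close> over all pairs and can be
  bounded pair by pair. This keeps the quadratic interaction linear in the top moment, without which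
  the drift could not be integrated over a fixed time interval.\<close>

lemma abs_empirical_moment_product_le:
  assumes "N \<ge> 1" "even n" "k + l \<le> n"
  shows "\<bar>empirical_moment N x k * empirical_moment N x l\<bar> \<le> 2 * (1 + empirical_moment N x n)"
proof -
  have "\<bar>(\<Sum>i=1..N. x i ^ k) * (\<Sum>i=1..N. x i ^ l)\<bar> \<le> (\<Sum>i=1..N. \<Sum>j=1..N. 1 + x i ^ n + x j ^ n)"
    unfolding sum_product
    by (intro order_trans[OF sum_abs] sum_mono) (simp add: abs_mult power_abs mixed_power_le_even_powers[OF assms(2,3)])
  also have "\<dots> = real N * real N + 2 * real N * (\<Sum>i=1..N. x i ^ n)" by (simp add: sum.distrib sum_distrib_left algebra_simps)
  finally have "\<bar>(\<Sum>i=1..N. x i ^ k) * (\<Sum>i=1..N. x i ^ l)\<bar> / (real N * real N) \<le> (real N * real N + 2 * real N * (\<Sum>i=1..N. x i ^ n)) / (real N * real N)"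
    by (intro divide_right_mono) auto
  also have "\<dots> = 1 + 2 * empirical_moment N x n" using assms(1) by (simp add: empirical_moment_def add_divide_distrib)
  also have "\<dots> \<le> 2 * (1 + empirical_moment N x n)" by simp
  finally show ?thesis by (simp add: empirical_moment_def abs_mult)
qed

text \<open>For nonnegative terms the sum of squares is at most the square of the sum. It dominates
  a bracket of degree \<open>2 n\<close> by the square of \<open>1 + S_n\<close>, with no moment of
  higher order.\<close>

lemma sum_even_power_le:
  assumes "N \<ge> 1" "even n"
  shows "(\<Sum>i=1..N. 1 + x i ^ (2 * n)) \<le> 2 * (real N)\<^sup>2 * (1 + empirical_moment N x n)\<^sup>2"
proof -
  define V where "V = 1 + empirical_moment N x n"
  have V: "V \<ge> 1" using empirical_moment_even_nonneg[OF assms(2), of N x] by (simp add: V_def)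
  have S: "0 \<le> (\<Sum>i=1..N. x i ^ n)" "(\<Sum>i=1..N. x i ^ n) \<le> N * V"
    using assms by (auto simp: V_def empirical_moment_def field_simps intro!: sum_nonneg zero_le_even_power)
  have "(\<Sum>i=1..N. (x i ^ n)\<^sup>2) \<le> (\<Sum>i=1..N. x i ^ n)\<^sup>2"
  proof -
    have "(\<Sum>i=1..N. (x i ^ n)\<^sup>2) \<le> (\<Sum>i=1..N. x i ^ n * (\<Sum>j=1..N. x j ^ n))"
    proof (rule sum_mono)
      fix i assume "i \<in> {1..N}"
      then have "x i ^ n \<le> (\<Sum>j=1..N. x j ^ n)" using assms by (intro member_le_sum) (auto intro: zero_le_even_power)
      then show "(x i ^ n)\<^sup>2 \<le> x i ^ n * (\<Sum>j=1..N. x j ^ n)"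
        using assms by (simp add: power2_eq_square mult_left_mono zero_le_even_power)
    qed
    then show ?thesis by (simp add: sum_distrib_right power2_eq_square)
  qed
  also have "\<dots> \<le> (N * V)\<^sup>2" using S by (intro power_mono) auto
  finally have 1: "(\<Sum>i=1..N. x i ^ (2 * n)) \<le> (N * V)\<^sup>2" by (simp add: power_mult[symmetric] mult.commute)
  have "real N * 1 \<le> (real N)\<^sup>2 * V\<^sup>2" using one_le_power[OF V, of 2] assms(1)
    by (intro mult_mono) (auto simp: power2_eq_square)
  then show ?thesis using 1 by (simp add: sum.distrib V_def power_mult_distrib)
qed

section \<open>From mesh points to all times, and bounds for drift and bracket\<close>

lemma mesh_cover:
  assumes T: "0 < T" and t: "t \<in> {0..T}"
  obtains k where "k < 4 ^ m" "t \<in> {mesh T m k..mesh T m (Suc k)}"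
proof -
  define P where "P k \<longleftrightarrow> t \<le> mesh T m (Suc k)" for k
  have "P (4 ^ m - 1)" using t by (simp add: P_def)
  define k where "k = (LEAST k. P k)"
  have k: "P k" "k \<le> 4 ^ m - 1" unfolding k_def using \<open>P (4 ^ m - 1)\<close> by (rule LeastI, rule Least_le)
  have "mesh T m k \<le> t"
  proof (cases k)
    case (Suc l)
    then have "\<not> P l" unfolding k_def by (metis lessI not_less_Least)
    then show ?thesis using Suc by (simp add: P_def)
  qed (use t in simp)
  moreover have "k < 4 ^ m" using k(2) by (metis diff_less le_less_trans less_numeral_extra(1) zero_less_numeral zero_less_power)
  ultimately show ?thesis using that k(1) by (auto simp: P_def)
qed

text \<open>For each \<open>e\<close> one good mesh on which \<open>f\<close> oscillates by at most
  \<open>e\<close> is enough, so it does no harm that good meshes are merely frequent.\<close>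

lemma frequently_mesh_le_imp_le:
  assumes T: "0 < T" and f: "continuous_on {0..T} f"
    and freq: "\<exists>\<^sub>F m in sequentially. \<forall>k\<le>4^m. f (mesh T m k) \<le> (K::real)" and t: "t \<in> {0..T}"
  shows "f t \<le> K"
proof (rule field_le_epsilon)
  fix e :: real assume "0 < e"
  have "\<exists>\<^sub>F m in sequentially. (\<forall>k\<le>4^m. f (mesh T m k) \<le> K) \<and>
      (\<forall>k<4 ^ m. \<forall>s\<in>{mesh T m k..mesh T m (Suc k)}. \<bar>f s - f (mesh T m k)\<bar> \<le> e)"
    using freq
  proof (rule frequently_rev_mp)
    show "\<forall>\<^sub>F m in sequentially. (\<forall>k\<le>4^m. f (mesh T m k) \<le> K) \<longrightarrow> (\<forall>k\<le>4^m. f (mesh T m k) \<le> K) \<and>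
      (\<forall>k<4 ^ m. \<forall>s\<in>{mesh T m k..mesh T m (Suc k)}. \<bar>f s - f (mesh T m k)\<bar> \<le> e)"
      using mesh_oscillation[OF f T \<open>0 < e\<close>] by eventually_elim blast
  qed
  then obtain m where m: "\<forall>k\<le>4^m. f (mesh T m k) \<le> K"
    "\<forall>k<4 ^ m. \<forall>s\<in>{mesh T m k..mesh T m (Suc k)}. \<bar>f s - f (mesh T m k)\<bar> \<le> e"
    using frequently_ex by blast
  obtain k where k: "k < 4 ^ m" "t \<in> {mesh T m k..mesh T m (Suc k)}" using mesh_cover[OF T t] .
  from m(2)[rule_format, OF this] m(1)[rule_format, of k] k(1) show "f t \<le> K + e" by linarith
qed

text \<open>The constant does not depend on \<open>N\<close>. In \<open>3 * c\<close> two units come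
  from the products of moments and one from the self-interaction, whose factor \<open>1 / N\<close>
  is bounded by 1.\<close>

lemma abs_moment_drift_le:
  assumes N: "N \<ge> 1" and n: "even n" "n \<ge> 1" and e: "0 \<le> e" "e \<le> 1" and s: "0 \<le> s" "s \<le> s1"
    and c: "0 < c" and \<alpha>: "0 \<le> \<alpha>"
  shows "\<bar>moment_drift c \<alpha> N e s (empirical_moment N x) n\<bar>
     \<le> (real n * \<alpha> + (real n)\<^sup>2 * (2 + s1) * (1 + 3 * c)) * (1 + empirical_moment N x n)"
proof -
  define S where "S = empirical_moment N x"
  define V where "V = 1 + S n"
  have V: "V \<ge> 1" using empirical_moment_even_nonneg[OF n(1), of N x] by (simp add: V_def S_def)
  have S1: "\<bar>S k\<bar> \<le> V" if "k \<le> n" for k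
    unfolding S_def V_def using abs_empirical_moment_le[OF N n(1) that] .
  have S2: "\<bar>S k * S l\<bar> \<le> 2 * V" if "k + l \<le> n" for k l
    unfolding S_def V_def using abs_empirical_moment_product_le[OF N n(1) that] .
  have lin: "\<bar>2 * e * A + s * B\<bar> \<le> (2 + s1) * K" if "\<bar>A\<bar> \<le> K" "\<bar>B\<bar> \<le> K" for A B K
  proof -
    have "\<bar>2 * e * A + s * B\<bar> \<le> 2 * e * \<bar>A\<bar> + s * \<bar>B\<bar>"
      using e s by (intro order_trans[OF abs_triangle_ineq]) (simp add: abs_mult)
    also have "\<dots> \<le> 2 * 1 * K + s1 * K" using e s that by (intro add_mono mult_mono) auto
    finally show ?thesis by (simp add: algebra_simps)
  qed
  have interaction: "\<bar>(\<Sum>k<m. S k * S (m - 1 - k)) - real m / real N * S (m - 1)\<bar> \<le> 3 * real n * V" if "m \<le> n" for m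
  proof -
    have "\<bar>\<Sum>k<m. S k * S (m - 1 - k)\<bar> \<le> (\<Sum>k<m. 2 * V)"
      using that by (intro order_trans[OF sum_abs] sum_mono S2) auto
    also have "\<dots> \<le> real n * (2 * V)" using that V by (simp add: mult_right_mono)
    finally have 1: "\<bar>\<Sum>k<m. S k * S (m - 1 - k)\<bar> \<le> real n * (2 * V)" .
    have 2: "\<bar>real m / real N * S (m - 1)\<bar> \<le> real n * V"
      unfolding abs_mult
    proof (rule mult_mono)
      have "real m / real N \<le> real m / 1" using N by (intro divide_left_mono) auto
      then show "\<bar>real m / real N\<bar> \<le> real n" using that by simp
      show "\<bar>S (m - 1)\<bar> \<le> V" using S1[of "m - 1"] that by simp
    qed auto
    have "real n * (2 * V) + real n * V = 3 * real n * V" by (simp add: algebra_simps)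
    with order_trans[OF abs_triangle_ineq4 add_mono[OF 1 2]] show ?thesis by simp
  qed
  have t1: "\<bar>real n * e * \<alpha> * S (n - 1)\<bar> \<le> real n * \<alpha> * V"
  proof -
    have "real n * e * \<alpha> * \<bar>S (n - 1)\<bar> \<le> real n * 1 * \<alpha> * V"
      using e \<alpha> S1[of "n - 1"] by (intro mult_mono) auto
    then show ?thesis using e \<alpha> by (simp add: abs_mult)
  qed
  have t2: "\<bar>real n * real (n - 1) / 2 * (2 * e * S (n - 1) + s * S (n - 2))\<bar> \<le> (real n)\<^sup>2 / 2 * ((2 + s1) * V)"
    unfolding abs_mult using lin[OF S1[of "n - 1"] S1[of "n - 2"]] V s
    by (intro mult_mono) (auto simp: power2_eq_square intro!: mult_left_mono)
  have "\<bar>2 * e * ((\<Sum>k<n. S k * S (n - 1 - k)) - real n / real N * S (n - 1))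
       + s * ((\<Sum>k<n - 1. S k * S (n - 2 - k)) - real (n - 1) / real N * S (n - 2))\<bar> \<le> (2 + s1) * (3 * real n * V)"
    using interaction[of n] interaction[of "n - 1"] by (intro lin) (auto simp: numeral_2_eq_2)
  then have t3: "\<bar>c * real n / 2 * (2 * e * ((\<Sum>k<n. S k * S (n - 1 - k)) - real n / real N * S (n - 1))
       + s * ((\<Sum>k<n - 1. S k * S (n - 2 - k)) - real (n - 1) / real N * S (n - 2)))\<bar> \<le> c * real n / 2 * ((2 + s1) * (3 * real n * V))"
    using c by (simp add: abs_mult mult_left_mono)
  have "\<bar>moment_drift c \<alpha> N e s S n\<bar> \<le> real n * \<alpha> * V + (real n)\<^sup>2 / 2 * ((2 + s1) * V) + c * real n / 2 * ((2 + s1) * (3 * real n * V))"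
    unfolding moment_drift_def using t1 t2 t3 by linarith
  also have "\<dots> = (real n * \<alpha> + (real n)\<^sup>2 * (2 + s1) * (1 + 3 * c) / 2) * V"
    by (simp add: algebra_simps power2_eq_square add_divide_distrib)
  also have "\<dots> \<le> (real n * \<alpha> + (real n)\<^sup>2 * (2 + s1) * (1 + 3 * c)) * V"
    using V c s by (intro mult_right_mono) auto
  finally show ?thesis by (simp add: V_def S_def)
qed

text \<open>To be used with \<open>w = (\<gamma> z)\<^sup>2\<close>: then \<open>r\<^sup>2 x\<^bsup>2r-2\<^esup> w\<close> is the bracket of \<open>x\<^sup>r\<close>.\<close>

lemma even_bracket_le:
  fixes x w g s :: real
  assumes w: "w = 2 * g * x + s" and gs: "0 \<le> g" "0 \<le> s" and r: "r \<ge> 1" "2 * r \<le> k" and k: "even k"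
  shows "x ^ (2 * r - 2) * w \<le> (2 * g + s) * (1 + x ^ k)"
proof -
  have 1: "x ^ (2 * r - 1) \<le> 1 + x ^ k" and 2: "x ^ (2 * r - 2) \<le> 1 + x ^ k"
    using power_le_one_plus_even_power[OF k, of "2 * r - 1" x] power_le_one_plus_even_power[OF k, of "2 * r - 2" x] r(2)
    by (auto simp: power_abs[symmetric] intro: order_trans[OF abs_ge_self])
  have "2 * r - 1 = Suc (2 * r - 2)" using r(1) by simp
  then have "x ^ (2 * r - 2) * w = 2 * g * x ^ (2 * r - 1) + s * x ^ (2 * r - 2)"
    using w by (simp add: algebra_simps)
  also have "\<dots> \<le> 2 * g * (1 + x ^ k) + s * (1 + x ^ k)"
    using 1 2 gs by (intro add_mono mult_left_mono) auto
  finally show ?thesis by (simp add: algebra_simps)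
qed

section \<open>The rescaled moments of the Dunkl particle system\<close>

locale Dunkl_particles =
  driven_by_brownian_motions M N b y "\<lambda>i \<omega> s. Dunkl_B_drift N \<alpha> (2 * c / real N) (\<lambda>j. y j s \<omega>) i" y0
  for M :: "'a measure" and N b y \<alpha> c y0 +
  assumes N: "N \<ge> 1" and c: "c > 0" and \<alpha>: "\<alpha> > 1/2"
    and ordered: "ordered_nonneg M N y"
    and generic: "AE \<omega> in M. AE s in lborel. 0 \<le> s \<longrightarrow>
        inj_on (\<lambda>i. y i s \<omega>) {1..N} \<and> (\<forall>i\<in>{1..N}. y i s \<omega> \<noteq> 0)"
begin

definition moment :: "real \<Rightarrow> real \<Rightarrow> nat \<Rightarrow> real \<Rightarrow> 'a \<Rightarrow> real" where
  "moment \<gamma> E n t \<omega> = empirical_moment N (\<lambda>i. \<gamma> * ((y i t \<omega>)\<^sup>2 / 2 - E)) n"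

lemma moment_eq_sum_poly: "moment \<gamma> E n t \<omega> = (\<Sum>i\<in>{1..N}. poly (moment_poly N \<gamma> E n) (y i t \<omega>))"
  by (simp add: moment_def empirical_moment_def poly_moment_poly sum_divide_distrib)

lemma moment_continuous: "\<omega> \<in> space M \<Longrightarrow> continuous_on {0..T} (\<lambda>t. moment \<gamma> E n t \<omega>)"
proof -
  assume \<omega>: "\<omega> \<in> space M"
  have "continuous_on {0..T} (\<lambda>t. y i t \<omega>)" if "i \<in> {1..N}" for i
    using y_paths[OF that] \<omega> unfolding continuous_paths_def by (auto intro: continuous_on_subset)
  then show ?thesis unfolding moment_eq_sum_poly by (intro continuous_intros) auto
qed

lemma moment_drift_continuous:
  "\<omega> \<in> space M \<Longrightarrow> continuous_on {0..T} (\<lambda>t. moment_drift c' \<alpha>' N' e s (\<lambda>k. moment \<gamma> E k t \<omega>) n)"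
  unfolding moment_drift_def by (intro continuous_intros moment_continuous)

text \<open>The algebraic identity for the generator presupposes distinct positive particles, which
  hold at almost every time only; an identity almost everywhere suffices for the integrals.\<close>

lemma sum_generator_integral:
  assumes \<omega>: "\<omega> \<in> space M" and \<gamma>: "\<gamma> > 0"
    and gen: "AE s in lborel. 0 \<le> s \<longrightarrow> inj_on (\<lambda>i. y i s \<omega>) {1..N} \<and> (\<forall>i\<in>{1..N}. y i s \<omega> \<noteq> 0)"
    and integ: "\<And>i. i \<in> {1..N} \<Longrightarrow> (\<lambda>s. Dunkl_B_drift N \<alpha> (2 * c / real N) (\<lambda>j. y j s \<omega>) i) absolutely_integrable_on {0..T}"
    and uv: "0 \<le> u" "v \<le> T"
  shows "(\<Sum>i\<in>{1..N}. integral {u..v} (generator_term (moment_poly N \<gamma> E n) i \<omega>))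
     = integral {u..v} (\<lambda>s. moment_drift c \<alpha> N \<gamma> (2 * \<gamma>\<^sup>2 * E) (\<lambda>k. moment \<gamma> E k s \<omega>) n)"
proof -
  have gi: "generator_term (moment_poly N \<gamma> E n) i \<omega> integrable_on {u..v}" if i: "i \<in> {1..N}" for i
  proof -
    have cy: "continuous_on {0..T} (\<lambda>t. y i t \<omega>)"
      using y_paths[OF i] \<omega> unfolding continuous_paths_def by (auto intro: continuous_on_subset)
    have "(\<lambda>s. poly (pderiv (moment_poly N \<gamma> E n)) (y i s \<omega>) * Dunkl_B_drift N \<alpha> (2 * c / real N) (\<lambda>j. y j s \<omega>) i) integrable_on {0..T}"
      by (rule set_lebesgue_integral_eq_integral(1)[OF absolutely_integrable_continuous_times[OF _ integ[OF i]]])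
        (intro continuous_intros cy)
    moreover have "(\<lambda>s. poly (pderiv (pderiv (moment_poly N \<gamma> E n))) (y i s \<omega>) / 2) integrable_on {0..T}"
      by (intro integrable_continuous_real continuous_intros cy) auto
    ultimately have "generator_term (moment_poly N \<gamma> E n) i \<omega> integrable_on {0..T}"
      unfolding generator_term_def by (rule integrable_add)
    then show ?thesis by (rule integrable_subinterval_real) (use uv in auto)
  qed
  have "(\<Sum>i\<in>{1..N}. integral {u..v} (generator_term (moment_poly N \<gamma> E n) i \<omega>))
      = integral {u..v} (\<lambda>s. \<Sum>i\<in>{1..N}. generator_term (moment_poly N \<gamma> E n) i \<omega> s)"
    using gi by (intro Henstock_Kurzweil_Integration.integral_sum[symmetric]) auto
  also have "\<dots> = integral {u..v} (\<lambda>s. moment_drift c \<alpha> N \<gamma> (2 * \<gamma>\<^sup>2 * E) (\<lambda>k. moment \<gamma> E k s \<omega>) n)"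
  proof -
    have "AE s in lborel. s \<in> {u..v} \<longrightarrow> (\<Sum>i\<in>{1..N}. generator_term (moment_poly N \<gamma> E n) i \<omega> s)
        = moment_drift c \<alpha> N \<gamma> (2 * \<gamma>\<^sup>2 * E) (\<lambda>k. moment \<gamma> E k s \<omega>) n"
      using gen
    proof eventually_elim
      case (elim s)
      show ?case
      proof
        assume s: "s \<in> {u..v}"
        then have s0: "0 \<le> s" using uv by simp
        have "0 < y i s \<omega>" if "i \<in> {1..N}" for i
        proof -
          have "0 \<le> y i s \<omega>" using ordered \<omega> s0 that unfolding ordered_nonneg_def by blast
          then show ?thesis using elim s0 that by force
        qed
        then show "(\<Sum>i\<in>{1..N}. generator_term (moment_poly N \<gamma> E n) i \<omega> s)
          = moment_drift c \<alpha> N \<gamma> (2 * \<gamma>\<^sup>2 * E) (\<lambda>k. moment \<gamma> E k s \<omega>) n"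
          unfolding generator_term_def moment_def
          using Dunkl_generator_moment_poly[OF N \<gamma>, of "\<lambda>i. y i s \<omega>" E n \<alpha> c] elim s0 by simp
      qed
    qed
    from has_integral_AE[OF this] show ?thesis unfolding integral_def integrable_on_def by simp
  qed
  finally show ?thesis .
qed

text \<open>\<open>V = 1 + S\<^sub>2\<^sub>r\<close> is controlled through \<open>ln V\<close>: since \<open>ln u \<le> u - 1\<close>, the increments of
  \<open>ln V\<close> are at most those of \<open>V\<close> divided by \<open>V\<close>, and the bracket of \<open>\<integral> dV / V\<close> is bounded
  uniformly in \<open>N\<close>.\<close>

lemma moment_deviation:
  fixes T A e s1 :: real and r :: nat
  assumes \<gamma>: "\<gamma> > 0" and \<tau>: "\<tau> > 0" and E: "E > 0" and T: "T > 0" and A: "A > 0" and e: "e > 0" and r: "r \<ge> 1"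
    and \<epsilon>: "\<gamma> / \<tau> \<le> 1" and s1: "2 * \<gamma>\<^sup>2 * E / \<tau> \<le> s1"
  defines "C \<equiv> real (2 * r) * \<alpha> + (real (2 * r))\<^sup>2 * (2 + s1) * (1 + 3 * c)"
    and "V0 \<equiv> 1 + empirical_moment N (\<lambda>i. \<gamma> * ((y0 i)\<^sup>2 / 2 - E)) (2 * r)"
  defines "K \<equiv> exp (ln V0 + 2 * C * T + 2 * A)"
  shows "\<exists>Bad\<in>events. prob Bad \<le> 16 * (real r)\<^sup>2 * (2 + s1) * T / A\<^sup>2 + 2 * (real r)\<^sup>2 * (2 + s1) * K * T / (real N * e\<^sup>2) \<and>
    (\<forall>\<omega>\<in>space M - Bad. (\<forall>i\<in>{1..N}. y i 0 \<omega> = y0 i) \<and>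
      (\<forall>t\<in>{0..T / \<tau>}. \<bar>moment \<gamma> E r t \<omega> - moment \<gamma> E r 0 \<omega>
         - integral {0..t} (\<lambda>s. moment_drift c \<alpha> N \<gamma> (2 * \<gamma>\<^sup>2 * E) (\<lambda>k. moment \<gamma> E k s \<omega>) r)\<bar> \<le> 2 * e))"
proof -
  define n where "n = 2 * r"
  have n: "even n" "n \<ge> 1" using r by (auto simp: n_def)
  \<comment> \<open>The particles are followed in their own time, where the horizon \<open>T\<close>
    of the rescaled process is \<open>T / \<tau>\<close>.\<close>
  define H where "H = T / \<tau>"
  have H: "H > 0" using T \<tau> by (simp add: H_def)
  define xs where "xs z i = \<gamma> * ((z i)\<^sup>2 / 2 - E)" for z :: "nat \<Rightarrow> real" and i
  define VV where "VV z = 1 + empirical_moment N (xs z) n" for z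
  have VV1: "VV z \<ge> 1" for z using empirical_moment_even_nonneg[OF n(1)] by (simp add: VV_def)
  define s where "s = 2 * \<gamma>\<^sup>2 * E"
  have s0: "s \<ge> 0" using \<gamma> E by (simp add: s_def)
  have s1': "0 \<le> s1" using s1 s0 \<tau> by (simp add: s_def[symmetric]) (meson divide_nonneg_pos order_trans)
  have w: "(\<gamma> * z i)\<^sup>2 = 2 * \<gamma> * xs z i + s" for z i
    by (simp add: xs_def s_def algebra_simps power2_eq_square)
  \<comment> \<open>Brackets grow at a rate of order \<tau> in particle time; over the horizon
    \<open>H\<close> the factor \<tau> cancels.\<close>
  have gs: "2 * \<gamma> + s \<le> \<tau> * (2 + s1)"
  proof -
    have "\<gamma> \<le> \<tau>" "s \<le> s1 * \<tau>" using \<epsilon> s1 \<tau> by (simp_all add: s_def field_simps)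
    then show ?thesis by (simp add: algebra_simps)
  qed
  have V0_eq: "V0 = VV y0" by (simp add: V0_def VV_def xs_def[abs_def] n_def)
  have C: "C \<ge> 0" unfolding C_def using \<alpha> c s1' by (intro add_nonneg_nonneg mult_nonneg_nonneg) auto
  have K1: "1 \<le> K" unfolding K_def using VV1[of y0] C T A by (simp add: V0_eq)
  \<comment> \<open>A bound on \<open>V\<close> confines every particle. The resulting radius grows
    with \<open>N\<close>, but it only affects the part of the variance that vanishes with the
    mesh.\<close>
  have localised: "\<bar>z i\<bar> \<le> 1 + 2 * ((1 + N * K) / \<gamma> + E)" if "VV z \<le> K" "i \<in> {1..N}" for z i
  proof -
    have "xs z i ^ n \<le> (\<Sum>j=1..N. xs z j ^ n)"
      using n that(2) by (intro member_le_sum) (auto intro: zero_le_even_power)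
    also have "\<dots> = N * (VV z - 1)" using N by (simp add: VV_def empirical_moment_def)
    also have "\<dots> \<le> N * K" using that(1) by (intro mult_left_mono) auto
    finally have "\<bar>xs z i\<bar> \<le> 1 + N * K"
      using power_le_one_plus_even_power[OF n(1), of 1 "xs z i"] n(2) by simp
    then have "\<gamma> * ((z i)\<^sup>2 / 2 - E) \<le> 1 + N * K" unfolding xs_def by linarith
    then have "(z i)\<^sup>2 / 2 - E \<le> (1 + N * K) / \<gamma>" using \<gamma> by (simp add: field_simps)
    then have "(z i)\<^sup>2 \<le> 2 * ((1 + N * K) / \<gamma> + E)" by argo
    then show ?thesis by (rule order_trans[OF abs_le_one_plus_square add_left_mono])
  qed
  define R where "R = 1 + 2 * ((1 + N * K) / \<gamma> + E)"
  have meas_VV: "(\<lambda>\<omega>. VV (state t \<omega>)) \<in> borel_measurable (BM_filtration M N b t)" if "0 \<le> t" for t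
  proof -
    have [measurable]: "(\<lambda>\<omega>. state t \<omega> i) \<in> borel_measurable (BM_filtration M N b t)" if "i \<in> {1..N}" for i
      using y_adapted[OF that] \<open>0 \<le> t\<close> by (simp add: adapted_def state_def)
    show ?thesis unfolding VV_def empirical_moment_def xs_def by measurable
  qed
  \<comment> \<open>Both weights switch off when \<open>V\<close> exceeds \<open>K\<close>. The
    first also divides by \<open>V\<close>, for the logarithm; the second serves \<open>S_r\<close>
    itself.\<close>
  define \<zeta>a where "\<zeta>a z = (if VV z \<le> K then 1 / VV z else 0)" for z
  define \<zeta>b where "\<zeta>b z = (if VV z \<le> K then 1 else 0 :: real)" for z
  \<comment> \<open>The factor \<open>V^-2\<close> cancels \<open>V^2\<close> from the bracket and
    \<open>N^-2\<close> cancels \<open>N^2\<close>; with \<open>n = 2 * r\<close> the constant is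
    \<open>2 * n^2 = 8 * r^2\<close>.\<close>
  have qa: "(\<Sum>i\<in>{1..N}. (\<zeta>a z * poly (pderiv (moment_poly N \<gamma> E n)) (z i))\<^sup>2) \<le> 8 * (real r)\<^sup>2 * (\<tau> * (2 + s1))" for z
  proof -
    have "(\<Sum>i\<in>{1..N}. (\<zeta>a z * poly (pderiv (moment_poly N \<gamma> E n)) (z i))\<^sup>2)
       = (\<zeta>a z)\<^sup>2 * (real n)\<^sup>2 / (real N)\<^sup>2 * (\<Sum>i\<in>{1..N}. xs z i ^ (2 * n - 2) * (\<gamma> * z i)\<^sup>2)"
      unfolding sum_distrib_left
    proof (intro sum.cong refl)
      fix i
      have "2 * n - 2 = (n - 1) * 2" by simp
      then have "xs z i ^ (2 * n - 2) = (xs z i ^ (n - 1))\<^sup>2" by (simp only: power_mult)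
      then show "(\<zeta>a z * poly (pderiv (moment_poly N \<gamma> E n)) (z i))\<^sup>2
        = (\<zeta>a z)\<^sup>2 * (real n)\<^sup>2 / (real N)\<^sup>2 * (xs z i ^ (2 * n - 2) * (\<gamma> * z i)\<^sup>2)"
        by (simp add: poly_pderiv_moment_poly xs_def power_mult_distrib power_divide)
    qed
    also have "\<dots> \<le> (1 / VV z)\<^sup>2 * (real n)\<^sup>2 / (real N)\<^sup>2 * ((2 * \<gamma> + s) * (2 * (real N)\<^sup>2 * (VV z)\<^sup>2))"
    proof (intro mult_mono divide_right_mono power_mono)
      show "\<zeta>a z \<le> 1 / VV z" using VV1[of z] by (auto simp: \<zeta>a_def)
      show "0 \<le> \<zeta>a z" using VV1[of z] by (auto simp: \<zeta>a_def)
      have "(\<Sum>i\<in>{1..N}. xs z i ^ (2 * n - 2) * (\<gamma> * z i)\<^sup>2) \<le> (\<Sum>i\<in>{1..N}. (2 * \<gamma> + s) * (1 + xs z i ^ (2 * n)))"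
        using n \<gamma> s0 by (intro sum_mono even_bracket_le[OF w]) auto
      also have "\<dots> = (2 * \<gamma> + s) * (\<Sum>i\<in>{1..N}. 1 + xs z i ^ (2 * n))" by (simp only: sum_distrib_left)
      also have "\<dots> \<le> (2 * \<gamma> + s) * (2 * (real N)\<^sup>2 * (VV z)\<^sup>2)"
        unfolding VV_def using \<gamma> s0 sum_even_power_le[OF N n(1), of "xs z"] by (intro mult_left_mono) auto
      finally show "(\<Sum>i\<in>{1..N}. xs z i ^ (2 * n - 2) * (\<gamma> * z i)\<^sup>2) \<le> (2 * \<gamma> + s) * (2 * (real N)\<^sup>2 * (VV z)\<^sup>2)" .
      have "even (2 * n - 2)" by simp
      then show "0 \<le> (\<Sum>i\<in>{1..N}. xs z i ^ (2 * n - 2) * (\<gamma> * z i)\<^sup>2)"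
        by (intro sum_nonneg mult_nonneg_nonneg zero_le_even_power) auto
    qed auto
    also have "\<dots> = 8 * (real r)\<^sup>2 * (2 * \<gamma> + s)"
      using VV1[of z] N by (simp add: n_def field_simps power2_eq_square)
    also have "\<dots> \<le> 8 * (real r)\<^sup>2 * (\<tau> * (2 + s1))" using gs by (intro mult_left_mono) auto
    finally show ?thesis .
  qed
  \<comment> \<open>Here a factor \<open>1 / N\<close> is left: the weights contribute
    \<open>N^-2\<close>, while the sum over particles is only of order \<open>N * K\<close>.\<close>
  have qb: "(\<Sum>i\<in>{1..N}. (\<zeta>b z * poly (pderiv (moment_poly N \<gamma> E r)) (z i))\<^sup>2) \<le> (real r)\<^sup>2 / N * (\<tau> * (2 + s1)) * K" for z
  proof (cases "VV z \<le> K")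
    case True
    have "(\<Sum>i\<in>{1..N}. (\<zeta>b z * poly (pderiv (moment_poly N \<gamma> E r)) (z i))\<^sup>2)
       = (real r)\<^sup>2 / (real N)\<^sup>2 * (\<Sum>i\<in>{1..N}. xs z i ^ (2 * r - 2) * (\<gamma> * z i)\<^sup>2)"
      unfolding sum_distrib_left
    proof (intro sum.cong refl)
      fix i
      have "2 * r - 2 = (r - 1) * 2" by simp
      then have "xs z i ^ (2 * r - 2) = (xs z i ^ (r - 1))\<^sup>2" by (simp only: power_mult)
      then show "(\<zeta>b z * poly (pderiv (moment_poly N \<gamma> E r)) (z i))\<^sup>2
        = (real r)\<^sup>2 / (real N)\<^sup>2 * (xs z i ^ (2 * r - 2) * (\<gamma> * z i)\<^sup>2)"
        using True by (simp add: \<zeta>b_def poly_pderiv_moment_poly xs_def power_mult_distrib power_divide)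
    qed
    also have "\<dots> \<le> (real r)\<^sup>2 / (real N)\<^sup>2 * ((\<tau> * (2 + s1)) * (N * K))"
    proof (intro mult_left_mono)
      have "(\<Sum>i\<in>{1..N}. xs z i ^ (2 * r - 2) * (\<gamma> * z i)\<^sup>2) \<le> (\<Sum>i\<in>{1..N}. (2 * \<gamma> + s) * (1 + xs z i ^ n))"
        using n \<gamma> s0 r by (intro sum_mono even_bracket_le[OF w]) (auto simp: n_def)
      also have "\<dots> = (2 * \<gamma> + s) * (N * VV z)"
        using N by (simp add: VV_def empirical_moment_def sum.distrib sum_distrib_left[symmetric] field_simps)
      also have "\<dots> \<le> (\<tau> * (2 + s1)) * (N * K)"
        using gs True \<gamma> s0 VV1[of z] \<tau> s1' by (intro mult_mono) auto
      finally show "(\<Sum>i\<in>{1..N}. xs z i ^ (2 * r - 2) * (\<gamma> * z i)\<^sup>2) \<le> (\<tau> * (2 + s1)) * (N * K)" .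
    qed auto
    also have "\<dots> = (real r)\<^sup>2 / N * (\<tau> * (2 + s1)) * K" using N by (simp add: power2_eq_square)
    finally show ?thesis .
  next
    case False
    then show ?thesis using \<tau> s1' K1 by (auto simp: \<zeta>b_def intro!: mult_nonneg_nonneg divide_nonneg_nonneg)
  qed
  obtain Ba where Ba: "Ba \<in> events" "prob Ba \<le> 2 * (8 * (real r)\<^sup>2 * (\<tau> * (2 + s1))) * H / A\<^sup>2"
    "\<And>\<omega>. \<omega> \<in> space M - Ba \<Longrightarrow> (\<forall>i\<in>{1..N}. y i 0 \<omega> = y0 i) \<and>
      (\<forall>i\<in>{1..N}. (\<lambda>s. Dunkl_B_drift N \<alpha> (2 * c / real N) (\<lambda>j. y j s \<omega>) i) absolutely_integrable_on {0..H}) \<and>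
      (\<exists>\<^sub>F m in sequentially. \<forall>k\<le>4^m. \<bar>\<Sum>j<k. \<zeta>a (state (mesh H m j) \<omega>) *
        (\<Sum>i\<in>{1..N}. poly (moment_poly N \<gamma> E n) (y i (mesh H m (Suc j)) \<omega>) - poly (moment_poly N \<gamma> E n) (y i (mesh H m j) \<omega>)
           - integral {mesh H m j..mesh H m (Suc j)} (generator_term (moment_poly N \<gamma> E n) i \<omega>))\<bar> \<le> 2 * A)"
  proof (rule bexE[OF weighted_Ito_deviation[OF H A]])
    show "(\<lambda>\<omega>. \<zeta>a (state t \<omega>)) \<in> borel_measurable (BM_filtration M N b t)" if "0 \<le> t" for t
      unfolding \<zeta>a_def using meas_VV[OF that] by measurable
    show "0 \<le> \<zeta>a z" "\<zeta>a z \<le> 1" for z using VV1[of z] by (auto simp: \<zeta>a_def)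
    show "\<bar>z i\<bar> \<le> R" if "\<zeta>a z \<noteq> 0" "i \<in> {1..N}" for z i
      unfolding R_def using that by (intro localised) (auto simp: \<zeta>a_def split: if_splits)
    show "(\<Sum>i\<in>{1..N}. (\<zeta>a z * poly (pderiv (moment_poly N \<gamma> E n)) (z i))\<^sup>2) \<le> 8 * (real r)\<^sup>2 * (\<tau> * (2 + s1))" for z by (rule qa)
  qed (erule conjE, rule that, assumption, assumption, erule (1) bspec)
  obtain Bb where Bb: "Bb \<in> events" "prob Bb \<le> 2 * ((real r)\<^sup>2 / N * (\<tau> * (2 + s1)) * K) * H / e\<^sup>2"
    "\<And>\<omega>. \<omega> \<in> space M - Bb \<Longrightarrow> (\<forall>i\<in>{1..N}. y i 0 \<omega> = y0 i) \<and>
      (\<forall>i\<in>{1..N}. (\<lambda>s. Dunkl_B_drift N \<alpha> (2 * c / real N) (\<lambda>j. y j s \<omega>) i) absolutely_integrable_on {0..H}) \<and>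
      (\<exists>\<^sub>F m in sequentially. \<forall>k\<le>4^m. \<bar>\<Sum>j<k. \<zeta>b (state (mesh H m j) \<omega>) *
        (\<Sum>i\<in>{1..N}. poly (moment_poly N \<gamma> E r) (y i (mesh H m (Suc j)) \<omega>) - poly (moment_poly N \<gamma> E r) (y i (mesh H m j) \<omega>)
           - integral {mesh H m j..mesh H m (Suc j)} (generator_term (moment_poly N \<gamma> E r) i \<omega>))\<bar> \<le> 2 * e)"
  proof (rule bexE[OF weighted_Ito_deviation[OF H e]])
    show "(\<lambda>\<omega>. \<zeta>b (state t \<omega>)) \<in> borel_measurable (BM_filtration M N b t)" if "0 \<le> t" for t
      unfolding \<zeta>b_def using meas_VV[OF that] by measurable
    show "0 \<le> \<zeta>b z" "\<zeta>b z \<le> 1" for z by (auto simp: \<zeta>b_def)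
    show "\<bar>z i\<bar> \<le> R" if "\<zeta>b z \<noteq> 0" "i \<in> {1..N}" for z i
      unfolding R_def using that by (intro localised) (auto simp: \<zeta>b_def split: if_splits)
    show "(\<Sum>i\<in>{1..N}. (\<zeta>b z * poly (pderiv (moment_poly N \<gamma> E r)) (z i))\<^sup>2) \<le> (real r)\<^sup>2 / N * (\<tau> * (2 + s1)) * K" for z by (rule qb)
  qed (erule conjE, rule that, assumption, assumption, erule (1) bspec)
  obtain Nl where Nl: "{\<omega>\<in>space M. \<not> (AE s in lborel. 0 \<le> s \<longrightarrow>
        inj_on (\<lambda>i. y i s \<omega>) {1..N} \<and> (\<forall>i\<in>{1..N}. y i s \<omega> \<noteq> 0))} \<subseteq> Nl" "emeasure M Nl = 0" "Nl \<in> events"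
    using generic by (rule AE_E)
  have N0: "Nl \<in> null_sets M" using Nl by auto
  show ?thesis
  proof (intro bexI[of _ "Ba \<union> Bb \<union> Nl"] conjI ballI)
    show "Ba \<union> Bb \<union> Nl \<in> events" using Ba Bb Nl by auto
    have "prob (Ba \<union> Bb \<union> Nl) = prob (Ba \<union> Bb)" using Ba Bb N0 by (intro measure_Un_null_set) auto
    also have "\<dots> \<le> prob Ba + prob Bb" using Ba Bb by (intro measure_Un_le) auto
    also have "\<dots> \<le> 2 * (8 * (real r)\<^sup>2 * (\<tau> * (2 + s1))) * H / A\<^sup>2 + 2 * ((real r)\<^sup>2 / N * (\<tau> * (2 + s1)) * K) * H / e\<^sup>2"
      using Ba Bb by (intro add_mono) auto
    also have "\<dots> = 16 * (real r)\<^sup>2 * (2 + s1) * T / A\<^sup>2 + 2 * (real r)\<^sup>2 * (2 + s1) * K * T / (real N * e\<^sup>2)"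
      using \<tau> by (simp add: H_def)
    finally show "prob (Ba \<union> Bb \<union> Nl) \<le> 16 * (real r)\<^sup>2 * (2 + s1) * T / A\<^sup>2 + 2 * (real r)\<^sup>2 * (2 + s1) * K * T / (real N * e\<^sup>2)" .
    fix \<omega> assume \<omega>': "\<omega> \<in> space M - (Ba \<union> Bb \<union> Nl)"
    then have \<omega>: "\<omega> \<in> space M" "\<omega> \<in> space M - Ba" "\<omega> \<in> space M - Bb" and gen: "AE s in lborel. 0 \<le> s \<longrightarrow>
        inj_on (\<lambda>i. y i s \<omega>) {1..N} \<and> (\<forall>i\<in>{1..N}. y i s \<omega> \<noteq> 0)" using Nl by auto
    show y0: "y i 0 \<omega> = y0 i" if "i \<in> {1..N}" for i using Ba(3)[OF \<omega>(2)] that by blast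
    have integ: "(\<lambda>s. Dunkl_B_drift N \<alpha> (2 * c / real N) (\<lambda>j. y j s \<omega>) i) absolutely_integrable_on {0..H}" if "i \<in> {1..N}" for i
      using Ba(3)[OF \<omega>(2)] that by blast
    define drift where "drift n t = moment_drift c \<alpha> N \<gamma> s (\<lambda>k. moment \<gamma> E k t \<omega>) n" for n t
    have drift_cont: "continuous_on {0..H} (drift n)" for n unfolding drift_def by (rule moment_drift_continuous[OF \<omega>(1)])
    have drift_int: "drift n integrable_on {0..H}" for n using drift_cont by (intro integrable_continuous_real)
    have mesh_in': "mesh H m j \<in> {0..H}" if "j \<le> 4 ^ m" for j m using mesh_in[of H j m] H that by simp
    have incr: "(\<Sum>i\<in>{1..N}. poly (moment_poly N \<gamma> E n) (y i (mesh H m (Suc j)) \<omega>) - poly (moment_poly N \<gamma> E n) (y i (mesh H m j) \<omega>)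
           - integral {mesh H m j..mesh H m (Suc j)} (generator_term (moment_poly N \<gamma> E n) i \<omega>))
       = moment \<gamma> E n (mesh H m (Suc j)) \<omega> - moment \<gamma> E n (mesh H m j) \<omega> - integral {mesh H m j..mesh H m (Suc j)} (drift n)"
      if "j < 4 ^ m" for m j n
    proof -
      have "(\<Sum>i\<in>{1..N}. integral {mesh H m j..mesh H m (Suc j)} (generator_term (moment_poly N \<gamma> E n) i \<omega>))
        = integral {mesh H m j..mesh H m (Suc j)} (drift n)"
        unfolding drift_def s_def using mesh_in'[of j m] mesh_in'[of "Suc j" m] that
        by (intro sum_generator_integral[OF \<omega>(1) \<gamma> gen integ]) auto
      then show ?thesis by (simp add: sum_subtractf moment_eq_sum_poly)
    qed
    define W where "W t = VV (state t \<omega>)" for t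
    have W_eq: "W t = 1 + moment \<gamma> E n t \<omega>" for t
      by (simp add: W_def VV_def state_def moment_def xs_def[abs_def])
    have W1: "W t \<ge> 1" for t using VV1 by (simp add: W_def)
    have W_cont: "continuous_on {0..H} W" unfolding W_eq[abs_def] by (intro continuous_intros moment_continuous[OF \<omega>(1)])
    have W0: "W 0 = V0"
      unfolding W_def V0_eq VV_def empirical_moment_def using y0 by (simp add: xs_def state_def)
    have drift_le: "drift n t \<le> \<tau> * C * W t" for t
    proof -
      have "drift n t = \<tau> * moment_drift c \<alpha> N (\<gamma> / \<tau>) (s / \<tau>) (\<lambda>k. moment \<gamma> E k t \<omega>) n"
        using \<tau> by (simp add: moment_drift_scale drift_def)
      also have "\<dots> \<le> \<tau> * (C * W t)"
      proof (intro mult_left_mono)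
        have "\<bar>moment_drift c \<alpha> N (\<gamma> / \<tau>) (s / \<tau>) (empirical_moment N (xs (state t \<omega>))) n\<bar> \<le> C * (1 + empirical_moment N (xs (state t \<omega>)) n)"
          unfolding C_def n_def[symmetric] using \<gamma> \<tau> \<epsilon> s1 s0 c \<alpha> by (intro abs_moment_drift_le[OF N n]) (auto simp: s_def)
        moreover have "(\<lambda>k. moment \<gamma> E k t \<omega>) = empirical_moment N (xs (state t \<omega>))"
          by (simp add: fun_eq_iff moment_def xs_def[abs_def] state_def)
        ultimately show "moment_drift c \<alpha> N (\<gamma> / \<tau>) (s / \<tau>) (\<lambda>k. moment \<gamma> E k t \<omega>) n \<le> C * W t"
          by (simp add: W_def VV_def)
      qed (use \<tau> in simp)
      finally show ?thesis by (simp add: mult.assoc)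
    qed
    have "\<exists>\<^sub>F m in sequentially. \<forall>k\<le>4^m. \<bar>\<Sum>j<k. \<zeta>a (state (mesh H m j) \<omega>) *
        (moment \<gamma> E n (mesh H m (Suc j)) \<omega> - moment \<gamma> E n (mesh H m j) \<omega> - integral {mesh H m j..mesh H m (Suc j)} (drift n))\<bar> \<le> 2 * A"
      using Ba(3)[OF \<omega>(2), THEN conjunct2, THEN conjunct2]
    proof (rule frequently_elim1, intro allI impI)
      fix m k :: nat assume k: "k \<le> 4 ^ m"
      assume dev: "\<forall>k\<le>4^m. \<bar>\<Sum>j<k. \<zeta>a (state (mesh H m j) \<omega>) *
        (\<Sum>i\<in>{1..N}. poly (moment_poly N \<gamma> E n) (y i (mesh H m (Suc j)) \<omega>) - poly (moment_poly N \<gamma> E n) (y i (mesh H m j) \<omega>)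
           - integral {mesh H m j..mesh H m (Suc j)} (generator_term (moment_poly N \<gamma> E n) i \<omega>))\<bar> \<le> 2 * A"
      have "(\<Sum>j<k. \<zeta>a (state (mesh H m j) \<omega>) *
        (\<Sum>i\<in>{1..N}. poly (moment_poly N \<gamma> E n) (y i (mesh H m (Suc j)) \<omega>) - poly (moment_poly N \<gamma> E n) (y i (mesh H m j) \<omega>)
           - integral {mesh H m j..mesh H m (Suc j)} (generator_term (moment_poly N \<gamma> E n) i \<omega>)))
        = (\<Sum>j<k. \<zeta>a (state (mesh H m j) \<omega>) *
        (moment \<gamma> E n (mesh H m (Suc j)) \<omega> - moment \<gamma> E n (mesh H m j) \<omega> - integral {mesh H m j..mesh H m (Suc j)} (drift n)))"
      proof (rule sum.cong[OF refl])
        fix j assume "j \<in> {..<k}"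
        then have "j < 4 ^ m" using k by simp
        from incr[OF this, of n] show "\<zeta>a (state (mesh H m j) \<omega>) *
        (\<Sum>i\<in>{1..N}. poly (moment_poly N \<gamma> E n) (y i (mesh H m (Suc j)) \<omega>) - poly (moment_poly N \<gamma> E n) (y i (mesh H m j) \<omega>)
           - integral {mesh H m j..mesh H m (Suc j)} (generator_term (moment_poly N \<gamma> E n) i \<omega>)) = \<zeta>a (state (mesh H m j) \<omega>) *
        (moment \<gamma> E n (mesh H m (Suc j)) \<omega> - moment \<gamma> E n (mesh H m j) \<omega> - integral {mesh H m j..mesh H m (Suc j)} (drift n))"
          by (rule arg_cong)
      qed
      with dev[rule_format, OF k] show "\<bar>\<Sum>j<k. \<zeta>a (state (mesh H m j) \<omega>) *
        (moment \<gamma> E n (mesh H m (Suc j)) \<omega> - moment \<gamma> E n (mesh H m j) \<omega> - integral {mesh H m j..mesh H m (Suc j)} (drift n))\<bar> \<le> 2 * A"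
        by (simp only:)
    qed
    then have "\<exists>\<^sub>F m in sequentially. \<forall>k\<le>4^m. W (mesh H m k) \<le> K"
    proof (rule frequently_rev_mp)
      show "\<forall>\<^sub>F m in sequentially. (\<forall>k\<le>4^m. \<bar>\<Sum>j<k. \<zeta>a (state (mesh H m j) \<omega>) *
        (moment \<gamma> E n (mesh H m (Suc j)) \<omega> - moment \<gamma> E n (mesh H m j) \<omega> - integral {mesh H m j..mesh H m (Suc j)} (drift n))\<bar> \<le> 2 * A)
        \<longrightarrow> (\<forall>k\<le>4^m. W (mesh H m k) \<le> K)"
        using mesh_oscillation[OF W_cont H zero_less_one]
      proof (eventually_elim, intro impI allI)
        fix m k :: nat
        assume osc: "\<forall>k<4 ^ m. \<forall>t\<in>{mesh H m k..mesh H m (Suc k)}. \<bar>W t - W (mesh H m k)\<bar> \<le> 1"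
          and dev: "\<forall>k\<le>4^m. \<bar>\<Sum>j<k. \<zeta>a (state (mesh H m j) \<omega>) *
            (moment \<gamma> E n (mesh H m (Suc j)) \<omega> - moment \<gamma> E n (mesh H m j) \<omega> - integral {mesh H m j..mesh H m (Suc j)} (drift n))\<bar> \<le> 2 * A"
        assume "k \<le> 4 ^ m"
        then show "W (mesh H m k) \<le> K"
        \<comment> \<open>As long as \<open>V \<le> K\<close> at all earlier mesh points the cutoff
          is inactive and the sum controls \<open>ln V\<close>. The bound obtained is exactly
          \<open>ln K\<close>, by the choice of \<open>K\<close>, so the cutoff is never
          reached.\<close>
        proof (induction k rule: less_induct)
          case (less k)
          define Wk where "Wk j = W (mesh H m j)" for j
          define I where "I j = integral {mesh H m j..mesh H m (Suc j)} (drift n)" for j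
          have Wk1: "Wk j \<ge> 1" for j using W1 by (simp add: Wk_def)
          have step: "ln (Wk (Suc j)) - ln (Wk j) \<le> \<zeta>a (state (mesh H m j) \<omega>) *
            (moment \<gamma> E n (mesh H m (Suc j)) \<omega> - moment \<gamma> E n (mesh H m j) \<omega> - I j) + 2 * (\<tau> * C) * (H / 4 ^ m)" if j: "j < k" for j
          proof -
            have jm: "j < 4 ^ m" using j less.prems by simp
            have "VV (state (mesh H m j) \<omega>) \<le> K" using less.IH[OF j] j less.prems by (simp add: W_def)
            then have z: "\<zeta>a (state (mesh H m j) \<omega>) = 1 / Wk j" by (simp add: \<zeta>a_def Wk_def W_def)
            have "ln (Wk (Suc j)) - ln (Wk j) = ln (Wk (Suc j) / Wk j)"
              using Wk1[of j] Wk1[of "Suc j"] by (simp add: ln_div)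
            also have "\<dots> \<le> Wk (Suc j) / Wk j - 1"
              using Wk1[of j] Wk1[of "Suc j"] by (intro ln_le_minus_one) (auto intro!: divide_pos_pos)
            also have "\<dots> = 1 / Wk j * (Wk (Suc j) - Wk j - I j) + I j / Wk j"
              using Wk1[of j] by (simp add: field_simps)
            also have "I j / Wk j \<le> 2 * (\<tau> * C) * (H / 4 ^ m)"
            proof -
              have sub: "{mesh H m j..mesh H m (Suc j)} \<subseteq> {0..H}" using mesh_in'[of j m] mesh_in'[of "Suc j" m] jm by auto
              have "I j \<le> integral {mesh H m j..mesh H m (Suc j)} (\<lambda>_. \<tau> * C * (2 * Wk j))"
                unfolding I_def
              proof (rule integral_le[OF integrable_subinterval_real[OF drift_int sub] integrable_const_ivl])
                fix t assume t: "t \<in> {mesh H m j..mesh H m (Suc j)}"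
                \<comment> \<open>\<open>W\<close> moves by at most 1 within a mesh interval and is
                  at least 1. This doubling is the 2 in \<open>2 * C * T\<close> in the exponent of
                  \<open>K\<close>.\<close>
                have "W t \<le> 2 * Wk j" using osc jm t Wk1[of j] unfolding Wk_def by fastforce
                then show "drift n t \<le> \<tau> * C * (2 * Wk j)"
                  using drift_le[of t] \<tau> C by (meson mult_left_mono mult_nonneg_nonneg less_imp_le order_trans)
              qed
              also have "\<dots> = 2 * (\<tau> * C) * (H / 4 ^ m) * Wk j" using H by (simp add: mesh_Suc)
              finally show ?thesis using Wk1[of j] by (simp add: divide_le_eq)
            qed
            finally show ?thesis unfolding z by (simp add: W_eq Wk_def)
          qed
          have "ln (Wk k) - ln (Wk 0) = (\<Sum>j<k. ln (Wk (Suc j)) - ln (Wk j))"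
            by (rule sum_lessThan_telescope[symmetric])
          also have "\<dots> \<le> (\<Sum>j<k. \<zeta>a (state (mesh H m j) \<omega>) *
            (moment \<gamma> E n (mesh H m (Suc j)) \<omega> - moment \<gamma> E n (mesh H m j) \<omega> - I j)) + real k * (2 * (\<tau> * C) * (H / 4 ^ m))"
            using sum_mono[of "{..<k}", OF step] by (simp add: sum.distrib)
          also have "\<dots> \<le> 2 * A + 2 * C * T"
          proof (rule add_mono)
            show "(\<Sum>j<k. \<zeta>a (state (mesh H m j) \<omega>) *
              (moment \<gamma> E n (mesh H m (Suc j)) \<omega> - moment \<gamma> E n (mesh H m j) \<omega> - I j)) \<le> 2 * A"
              unfolding I_def using dev less.prems abs_ge_self order_trans by blast
            have "real k * (2 * (\<tau> * C) * (H / 4 ^ m)) \<le> real (4 ^ m) * (2 * (\<tau> * C) * (H / 4 ^ m))"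
              using less.prems \<tau> C H by (intro mult_right_mono) auto
            also have "\<dots> = 2 * C * T" using \<tau> by (simp add: H_def)
            finally show "real k * (2 * (\<tau> * C) * (H / 4 ^ m)) \<le> 2 * C * T" .
          qed
          finally have "ln (Wk k) \<le> ln V0 + 2 * C * T + 2 * A" using W0 by (simp add: Wk_def)
          then show ?case unfolding K_def using Wk1[of k] by (simp add: Wk_def ln_ge_iff) (metis exp_le_cancel_iff exp_ln less_le_trans zero_less_one)
        qed
      qed
    qed
    from frequently_mesh_le_imp_le[OF H W_cont this] have WK: "W t \<le> K" if "t \<in> {0..H}" for t using that .
    fix t assume t: "t \<in> {0..T / \<tau>}"
    define f where "f t = \<bar>moment \<gamma> E r t \<omega> - moment \<gamma> E r 0 \<omega> - integral {0..t} (drift r)\<bar>" for t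
    have f_cont: "continuous_on {0..H} f"
      unfolding f_def by (intro continuous_intros moment_continuous[OF \<omega>(1)] indefinite_integral_continuous_1[OF drift_int])
    have "\<exists>\<^sub>F m in sequentially. \<forall>k\<le>4^m. f (mesh H m k) \<le> 2 * e"
      using Bb(3)[OF \<omega>(3), THEN conjunct2, THEN conjunct2]
    proof (rule frequently_elim1, intro allI impI)
      fix m k :: nat assume k: "k \<le> 4 ^ m"
      assume dev: "\<forall>k\<le>4^m. \<bar>\<Sum>j<k. \<zeta>b (state (mesh H m j) \<omega>) *
        (\<Sum>i\<in>{1..N}. poly (moment_poly N \<gamma> E r) (y i (mesh H m (Suc j)) \<omega>) - poly (moment_poly N \<gamma> E r) (y i (mesh H m j) \<omega>)
           - integral {mesh H m j..mesh H m (Suc j)} (generator_term (moment_poly N \<gamma> E r) i \<omega>))\<bar> \<le> 2 * e"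
      \<comment> \<open>By \<open>WK\<close> the second weight equals 1 at every mesh point, so the
        weighted sum telescopes to the deviation of \<open>S_r\<close>.\<close>
      have "\<zeta>b (state (mesh H m j) \<omega>) *
        (\<Sum>i\<in>{1..N}. poly (moment_poly N \<gamma> E r) (y i (mesh H m (Suc j)) \<omega>) - poly (moment_poly N \<gamma> E r) (y i (mesh H m j) \<omega>)
           - integral {mesh H m j..mesh H m (Suc j)} (generator_term (moment_poly N \<gamma> E r) i \<omega>))
        = moment \<gamma> E r (mesh H m (Suc j)) \<omega> - moment \<gamma> E r (mesh H m j) \<omega> - integral {mesh H m j..mesh H m (Suc j)} (drift r)" if "j < k" for j
      proof -
        have "VV (state (mesh H m j) \<omega>) \<le> K" using WK[OF mesh_in'[of j m]] that k by (simp add: W_def)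
        moreover have "j < 4 ^ m" using that k by simp
        ultimately show ?thesis unfolding incr[OF \<open>j < 4 ^ m\<close>] by (simp add: \<zeta>b_def)
      qed
      then have "(\<Sum>j<k. \<zeta>b (state (mesh H m j) \<omega>) *
        (\<Sum>i\<in>{1..N}. poly (moment_poly N \<gamma> E r) (y i (mesh H m (Suc j)) \<omega>) - poly (moment_poly N \<gamma> E r) (y i (mesh H m j) \<omega>)
           - integral {mesh H m j..mesh H m (Suc j)} (generator_term (moment_poly N \<gamma> E r) i \<omega>)))
        = (\<Sum>j<k. moment \<gamma> E r (mesh H m (Suc j)) \<omega> - moment \<gamma> E r (mesh H m j) \<omega> - integral {mesh H m j..mesh H m (Suc j)} (drift r))"
        by (intro sum.cong) auto
      also have "\<dots> = moment \<gamma> E r (mesh H m k) \<omega> - moment \<gamma> E r 0 \<omega> - integral {0..mesh H m k} (drift r)"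
        using sum_lessThan_telescope[of "\<lambda>j. moment \<gamma> E r (mesh H m j) \<omega>" k] sum_integral_mesh[OF drift_int H k, of r]
        by (simp add: sum_subtractf)
      finally show "f (mesh H m k) \<le> 2 * e" using dev k by (auto simp: f_def)
    qed
    from frequently_mesh_le_imp_le[OF H f_cont this] t
    show "\<bar>moment \<gamma> E r t \<omega> - moment \<gamma> E r 0 \<omega>
         - integral {0..t} (\<lambda>s. moment_drift c \<alpha> N \<gamma> (2 * \<gamma>\<^sup>2 * E) (\<lambda>k. moment \<gamma> E k s \<omega>) r)\<bar> \<le> 2 * e"
      by (simp add: f_def drift_def[abs_def] s_def H_def)
  qed
qed

end

section \<open>Uniform convergence in probability\<close>

text \<open>Outer form of uniform convergence in probability: no measurability of suprema is needed.\<close>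

definition unif_conv_in_prob ::
    "real \<Rightarrow> (nat \<Rightarrow> 'a measure) \<Rightarrow> (nat \<Rightarrow> real \<Rightarrow> 'a \<Rightarrow> real) \<Rightarrow> (real \<Rightarrow> real) \<Rightarrow> bool" where
  "unif_conv_in_prob T M X x \<longleftrightarrow> (\<forall>e>0. \<forall>\<^sub>F N in sequentially. \<exists>A\<in>sets (M N). measure (M N) A \<le> e \<and>
     (\<forall>\<omega>\<in>space (M N) - A. \<forall>t\<in>{0..T}. \<bar>X N t \<omega> - x t\<bar> \<le> e))"

text \<open>Reduces the rules below to a deterministic estimate on single paths. The estimate is
  asked for large \<open>N\<close> only, which lets the rules use assumptions stated for
  \<open>N \<ge> 1\<close>.\<close>

lemma unif_conv_in_prob_combine:
  assumes X: "unif_conv_in_prob T M X x" and Y: "unif_conv_in_prob T M Y y"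
    and Z: "\<And>e. 0 < e \<Longrightarrow> \<exists>d>0. \<forall>\<^sub>F N in sequentially. \<forall>\<omega>\<in>space (M N).
      (\<forall>t\<in>{0..T}. \<bar>X N t \<omega> - x t\<bar> \<le> d) \<longrightarrow> (\<forall>t\<in>{0..T}. \<bar>Y N t \<omega> - y t\<bar> \<le> d) \<longrightarrow>
      (\<forall>t\<in>{0..T}. \<bar>Z N t \<omega> - z t\<bar> \<le> e)"
  shows "unif_conv_in_prob T M Z z"
  unfolding unif_conv_in_prob_def
proof (intro allI impI)
  fix e :: real assume e: "0 < e"
  obtain d where d: "d > 0" and Zd: "\<forall>\<^sub>F N in sequentially. \<forall>\<omega>\<in>space (M N).
      (\<forall>t\<in>{0..T}. \<bar>X N t \<omega> - x t\<bar> \<le> d) \<longrightarrow> (\<forall>t\<in>{0..T}. \<bar>Y N t \<omega> - y t\<bar> \<le> d) \<longrightarrow>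
      (\<forall>t\<in>{0..T}. \<bar>Z N t \<omega> - z t\<bar> \<le> e)" using Z[OF e] by blast
  define d' where "d' = min d (e / 2)"
  have d': "d' > 0" "d' \<le> d" "d' \<le> e / 2" using d e by (auto simp: d'_def)
  have 1: "\<forall>\<^sub>F N in sequentially. \<exists>A\<in>sets (M N). measure (M N) A \<le> d' \<and>
     (\<forall>\<omega>\<in>space (M N) - A. \<forall>t\<in>{0..T}. \<bar>X N t \<omega> - x t\<bar> \<le> d')"
    and 2: "\<forall>\<^sub>F N in sequentially. \<exists>A\<in>sets (M N). measure (M N) A \<le> d' \<and>
     (\<forall>\<omega>\<in>space (M N) - A. \<forall>t\<in>{0..T}. \<bar>Y N t \<omega> - y t\<bar> \<le> d')"
    using X Y d'(1) unfolding unif_conv_in_prob_def by auto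
  from 1 2 Zd show "\<forall>\<^sub>F N in sequentially. \<exists>A\<in>sets (M N). measure (M N) A \<le> e \<and>
     (\<forall>\<omega>\<in>space (M N) - A. \<forall>t\<in>{0..T}. \<bar>Z N t \<omega> - z t\<bar> \<le> e)"
  proof eventually_elim
    case (elim N)
    then obtain A B where A: "A \<in> sets (M N)" "measure (M N) A \<le> d'" "\<And>\<omega> t. \<omega> \<in> space (M N) - A \<Longrightarrow> t \<in> {0..T} \<Longrightarrow> \<bar>X N t \<omega> - x t\<bar> \<le> d'"
      and B: "B \<in> sets (M N)" "measure (M N) B \<le> d'" "\<And>\<omega> t. \<omega> \<in> space (M N) - B \<Longrightarrow> t \<in> {0..T} \<Longrightarrow> \<bar>Y N t \<omega> - y t\<bar> \<le> d'"
      by blast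
    show ?case
    proof (intro bexI[of _ "A \<union> B"] conjI ballI)
      show "measure (M N) (A \<union> B) \<le> e" using measure_Un_le[OF A(1) B(1)] A(2) B(2) d'(3) by linarith
      show "A \<union> B \<in> sets (M N)" using A B by auto
      fix \<omega> t assume \<omega>: "\<omega> \<in> space (M N) - (A \<union> B)" and t: "t \<in> {0..T}"
      have "\<forall>t\<in>{0..T}. \<bar>X N t \<omega> - x t\<bar> \<le> d" using order_trans[OF A(3)[of \<omega>] d'(2)] \<omega> by blast
      moreover have "\<forall>t\<in>{0..T}. \<bar>Y N t \<omega> - y t\<bar> \<le> d" using order_trans[OF B(3)[of \<omega>] d'(2)] \<omega> by blast
      ultimately show "\<bar>Z N t \<omega> - z t\<bar> \<le> e" using elim(3) \<omega> t by blast
    qed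
  qed
qed

lemma unif_conv_in_prob_const:
  assumes "k \<longlonglongrightarrow> k'" shows "unif_conv_in_prob T M (\<lambda>N t \<omega>. k N) (\<lambda>t. k')"
  unfolding unif_conv_in_prob_def
proof (intro allI impI)
  fix e :: real assume "0 < e"
  with assms have "\<forall>\<^sub>F N in sequentially. dist (k N) k' < e" by (rule tendstoD)
  then show "\<forall>\<^sub>F N in sequentially. \<exists>A\<in>sets (M N). measure (M N) A \<le> e \<and> (\<forall>\<omega>\<in>space (M N) - A. \<forall>t\<in>{0..T}. \<bar>k N - k'\<bar> \<le> e)"
    by eventually_elim (use \<open>0 < e\<close> in \<open>auto simp: dist_real_def intro!: bexI[of _ "{}"]\<close>)
qed

lemma unif_conv_in_prob_add:
  assumes "unif_conv_in_prob T M X x" "unif_conv_in_prob T M Y y"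
  shows "unif_conv_in_prob T M (\<lambda>N t \<omega>. X N t \<omega> + Y N t \<omega>) (\<lambda>t. x t + y t)"
proof (rule unif_conv_in_prob_combine[OF assms])
  fix e :: real assume "0 < e"
  then show "\<exists>d>0. \<forall>\<^sub>F N in sequentially. \<forall>\<omega>\<in>space (M N).
      (\<forall>t\<in>{0..T}. \<bar>X N t \<omega> - x t\<bar> \<le> d) \<longrightarrow> (\<forall>t\<in>{0..T}. \<bar>Y N t \<omega> - y t\<bar> \<le> d) \<longrightarrow>
      (\<forall>t\<in>{0..T}. \<bar>X N t \<omega> + Y N t \<omega> - (x t + y t)\<bar> \<le> e)"
  proof (intro exI[of _ "e/2"] conjI always_eventually allI ballI impI)
    fix N \<omega> t assume "\<forall>t\<in>{0..T}. \<bar>X N t \<omega> - x t\<bar> \<le> e / 2" "\<forall>t\<in>{0..T}. \<bar>Y N t \<omega> - y t\<bar> \<le> e / 2" "t \<in> {0..T}"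
    then have "\<bar>X N t \<omega> - x t\<bar> \<le> e / 2" "\<bar>Y N t \<omega> - y t\<bar> \<le> e / 2" by auto
    then show "\<bar>X N t \<omega> + Y N t \<omega> - (x t + y t)\<bar> \<le> e" by linarith
  qed simp
qed

lemma unif_conv_in_prob_mult:
  assumes "unif_conv_in_prob T M X x" "unif_conv_in_prob T M Y y"
    and x: "continuous_on {0..T} x" and y: "continuous_on {0..T} y"
  shows "unif_conv_in_prob T M (\<lambda>N t \<omega>. X N t \<omega> * Y N t \<omega>) (\<lambda>t. x t * y t)"
proof (rule unif_conv_in_prob_combine[OF assms(1,2)])
  fix e :: real assume e: "0 < e"
  have "bounded (x ` {0..T})" "bounded (y ` {0..T})"
    using x y by (auto intro!: compact_imp_bounded compact_continuous_image)
  then obtain B1 B2 where "\<forall>t\<in>{0..T}. \<bar>x t\<bar> \<le> B1" "\<forall>t\<in>{0..T}. \<bar>y t\<bar> \<le> B2" unfolding bounded_iff by force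
  then obtain B where B: "B \<ge> 0" "\<And>t. t \<in> {0..T} \<Longrightarrow> \<bar>x t\<bar> \<le> B" "\<And>t. t \<in> {0..T} \<Longrightarrow> \<bar>y t\<bar> \<le> B"
    by (metis abs_ge_zero abs_le_D1 abs_of_nonneg max.coboundedI1 max.coboundedI2 max_def)
  \<comment> \<open>From the error \<open>d * d + 2 * B * d\<close> of the product, with one factor
    \<open>d\<close> bounded by 1.\<close>
  define d where "d = min 1 (e / (2 * B + 1))"
  have d: "0 < d" "d \<le> 1" using e B by (auto simp: d_def)
  have "d * (2 * B + 1) \<le> e / (2 * B + 1) * (2 * B + 1)" using B by (intro mult_right_mono) (auto simp: d_def)
  also have "\<dots> = e" using B(1) by (simp add: add_nonneg_eq_0_iff)
  finally have de: "d * (2 * B + 1) \<le> e" .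
  have "\<bar>u * v - p * r\<bar> \<le> e" if "\<bar>u - p\<bar> \<le> d" "\<bar>v - r\<bar> \<le> d" "\<bar>p\<bar> \<le> B" "\<bar>r\<bar> \<le> B" for u v p r
  proof -
    have "u * v - p * r = (u - p) * (v - r) + (u - p) * r + p * (v - r)" by (simp add: algebra_simps)
    then have "\<bar>u * v - p * r\<bar> \<le> \<bar>u - p\<bar> * \<bar>v - r\<bar> + \<bar>u - p\<bar> * \<bar>r\<bar> + \<bar>p\<bar> * \<bar>v - r\<bar>"
      by (metis (no_types) abs_mult abs_triangle_ineq add_right_mono order_trans)
    also have "\<dots> \<le> d * 1 + d * B + B * d" using that d by (intro add_mono mult_mono) auto
    also have "\<dots> \<le> e" using de by (simp add: algebra_simps)
    finally show ?thesis .
  qed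
  then show "\<exists>d>0. \<forall>\<^sub>F N in sequentially. \<forall>\<omega>\<in>space (M N).
      (\<forall>t\<in>{0..T}. \<bar>X N t \<omega> - x t\<bar> \<le> d) \<longrightarrow> (\<forall>t\<in>{0..T}. \<bar>Y N t \<omega> - y t\<bar> \<le> d) \<longrightarrow>
      (\<forall>t\<in>{0..T}. \<bar>X N t \<omega> * Y N t \<omega> - x t * y t\<bar> \<le> e)"
    using d(1) B by (intro exI[of _ d] conjI always_eventually) auto
qed

lemma unif_conv_in_prob_sum:
  assumes "finite I" "\<And>i. i \<in> I \<Longrightarrow> unif_conv_in_prob T M (X i) (x i)"
  shows "unif_conv_in_prob T M (\<lambda>N t \<omega>. \<Sum>i\<in>I. X i N t \<omega>) (\<lambda>t. \<Sum>i\<in>I. x i t)"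
  using assms
proof (induction I rule: finite_induct)
  case empty
  then show ?case using unif_conv_in_prob_const[of "\<lambda>_. 0" 0] by simp
next
  case (insert i I)
  then show ?case using unif_conv_in_prob_add[of T M "X i" "x i" "\<lambda>N t \<omega>. \<Sum>i\<in>I. X i N t \<omega>"] by simp
qed

lemma unif_conv_in_prob_integral:
  assumes X: "unif_conv_in_prob T M X x" and T: "0 < T"
    and Xc: "\<And>N \<omega>. N \<ge> 1 \<Longrightarrow> \<omega> \<in> space (M N) \<Longrightarrow> continuous_on {0..T} (\<lambda>t. X N t \<omega>)"
    and x: "continuous_on {0..T} x"
  shows "unif_conv_in_prob T M (\<lambda>N t \<omega>. integral {0..t} (\<lambda>u. X N u \<omega>)) (\<lambda>t. integral {0..t} x)"
proof (rule unif_conv_in_prob_combine[OF X X])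
  fix e :: real assume e: "0 < e"
  have "\<bar>integral {0..t} (\<lambda>u. X N u \<omega>) - integral {0..t} x\<bar> \<le> e"
    if N: "N \<ge> 1" "\<omega> \<in> space (M N)" and t: "t \<in> {0..T}" and close: "\<forall>t\<in>{0..T}. \<bar>X N t \<omega> - x t\<bar> \<le> e / T" for N \<omega> t
  proof -
    have sub: "{0..t} \<subseteq> {0..T}" using t by auto
    have i: "(\<lambda>u. X N u \<omega>) integrable_on {0..t}" "x integrable_on {0..t}"
      using continuous_on_subset[OF Xc[OF N] sub] continuous_on_subset[OF x sub] by (auto intro: integrable_continuous_real)
    have "\<bar>integral {0..t} (\<lambda>u. X N u \<omega> - x u)\<bar> \<le> integral {0..t} (\<lambda>u. e / T)"
      using close sub integral_norm_bound_integral[OF integrable_diff[OF i] integrable_const_ivl, of "e / T"]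
      by auto
    also have "\<dots> = t * (e / T)" using t by simp
    also have "\<dots> \<le> T * (e / T)" using t e T by (intro mult_right_mono) auto
    finally show ?thesis using T i by (simp add: Henstock_Kurzweil_Integration.integral_diff)
  qed
  then show "\<exists>d>0. \<forall>\<^sub>F N in sequentially. \<forall>\<omega>\<in>space (M N).
      (\<forall>t\<in>{0..T}. \<bar>X N t \<omega> - x t\<bar> \<le> d) \<longrightarrow> (\<forall>t\<in>{0..T}. \<bar>X N t \<omega> - x t\<bar> \<le> d) \<longrightarrow>
      (\<forall>t\<in>{0..T}. \<bar>integral {0..t} (\<lambda>u. X N u \<omega>) - integral {0..t} x\<bar> \<le> e)"
    using e T by (intro exI[of _ "e / T"] conjI eventually_mono[OF eventually_ge_at_top[of 1]]) auto
qed

lemma unif_conv_in_prob_cong: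
  assumes "unif_conv_in_prob T M X x"
    and "\<And>N \<omega> t. N \<ge> 1 \<Longrightarrow> \<omega> \<in> space (M N) \<Longrightarrow> t \<in> {0..T} \<Longrightarrow> Y N t \<omega> = X N t \<omega>" "\<And>t. t \<in> {0..T} \<Longrightarrow> y t = x t"
  shows "unif_conv_in_prob T M Y y"
proof (rule unif_conv_in_prob_combine[OF assms(1,1)])
  fix e :: real assume "0 < e"
  then show "\<exists>d>0. \<forall>\<^sub>F N in sequentially. \<forall>\<omega>\<in>space (M N).
      (\<forall>t\<in>{0..T}. \<bar>X N t \<omega> - x t\<bar> \<le> d) \<longrightarrow> (\<forall>t\<in>{0..T}. \<bar>X N t \<omega> - x t\<bar> \<le> d) \<longrightarrow>
      (\<forall>t\<in>{0..T}. \<bar>Y N t \<omega> - y t\<bar> \<le> e)"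
    using assms(2,3) by (intro exI[of _ e] conjI eventually_mono[OF eventually_ge_at_top[of 1]]) auto
qed

text \<open>The event in \<open>null_in_prob\<close> is enclosed in a measurable set of small
  measure, and monotonicity of the measure asks for measurability of the larger set only.\<close>

lemma unif_conv_in_prob_imp_null_in_prob:
  assumes X: "unif_conv_in_prob T M X x" and T: "0 \<le> T" and M: "\<And>N. N \<ge> 1 \<Longrightarrow> prob_space (M N)"
  shows "null_in_prob M (\<lambda>N \<omega>. SUP t\<in>{0..T}. \<bar>X N t \<omega> - x t\<bar>)"
  unfolding null_in_prob_def
proof (intro allI impI, rule LIMSEQ_I)
  fix e r :: real assume e: "0 < e" and r: "0 < r"
  define d where "d = min (e / 2) (r / 2)"
  have d: "d > 0" "d < e" "d < r" using e r by (auto simp: d_def)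
  have "\<forall>\<^sub>F N in sequentially. \<exists>A\<in>sets (M N). measure (M N) A \<le> d \<and>
     (\<forall>\<omega>\<in>space (M N) - A. \<forall>t\<in>{0..T}. \<bar>X N t \<omega> - x t\<bar> \<le> d)"
    using X d(1) unfolding unif_conv_in_prob_def by auto
  then have "\<forall>\<^sub>F N in sequentially. measure (M N) {\<omega> \<in> space (M N). e \<le> \<bar>SUP t\<in>{0..T}. \<bar>X N t \<omega> - x t\<bar>\<bar>} < r"
    using eventually_ge_at_top[of 1]
  proof eventually_elim
    case (elim N)
    interpret prob_space "M N" using M elim(2) by simp
    from elim obtain A where A: "A \<in> sets (M N)" "measure (M N) A \<le> d" "\<And>\<omega> t. \<omega> \<in> space (M N) - A \<Longrightarrow> t \<in> {0..T} \<Longrightarrow> \<bar>X N t \<omega> - x t\<bar> \<le> d"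
      by blast
    let ?S = "{\<omega> \<in> space (M N). e \<le> \<bar>SUP t\<in>{0..T}. \<bar>X N t \<omega> - x t\<bar>\<bar>}"
    have "?S \<subseteq> A"
    proof
      fix \<omega> assume \<omega>: "\<omega> \<in> ?S"
      show "\<omega> \<in> A"
      proof (rule ccontr)
        assume "\<omega> \<notin> A"
        then have *: "\<bar>X N t \<omega> - x t\<bar> \<le> d" if "t \<in> {0..T}" for t using A(3) \<omega> that by auto
        have "(SUP t\<in>{0..T}. \<bar>X N t \<omega> - x t\<bar>) \<le> d" using T * by (intro cSUP_least) auto
        moreover have "\<bar>X N 0 \<omega> - x 0\<bar> \<le> (SUP t\<in>{0..T}. \<bar>X N t \<omega> - x t\<bar>)"
          using T * by (intro cSUP_upper) (auto intro!: bdd_aboveI2[where M=d])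
        ultimately show False using \<omega> d by auto
      qed
    qed
    then have "measure (M N) ?S \<le> measure (M N) A" using A(1) by (intro finite_measure_mono)
    then show ?case using A(2) d by simp
  qed
  then show "\<exists>no. \<forall>N\<ge>no. norm (measure (M N) {\<omega> \<in> space (M N). e \<le> \<bar>SUP t\<in>{0..T}. \<bar>X N t \<omega> - x t\<bar>\<bar>} - 0) < r"
    by (simp add: eventually_sequentially)
qed

text \<open>The value of \<open>moment_drift\<close> at \<open>e = 0\<close> and
  \<open>1 / N = 0\<close>.\<close>

definition limit_drift :: "real \<Rightarrow> real \<Rightarrow> (nat \<Rightarrow> real) \<Rightarrow> nat \<Rightarrow> real" where
  "limit_drift c s m n = s * real n * real (n - 1) / 2 * m (n - 2) + c * real n / 2 * s * (\<Sum>k<n - 1. m k * m (n - 2 - k))"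

lemma limit_moment_continuous: "continuous_on {0..T} (limit_moment c s a n)"
proof (induction n rule: less_induct)
  case (less n)
  consider "n = 0" | "n = 1" | k where "n = Suc (Suc k)" by (metis One_nat_def not0_implies_Suc)
  then show ?case
  proof cases
    case (3 k)
    have lt: "j < n" "k - j < n" if "j \<in> {0..k}" for j using that 3 by auto
    have "(\<lambda>u. limit_moment c s a j u * limit_moment c s a (k - j) u) integrable_on {0..T}" if "j \<in> {0..k}" for j
      using less.IH[OF lt(1)[OF that]] less.IH[OF lt(2)[OF that]] by (intro integrable_continuous_real continuous_intros)
    moreover have "limit_moment c s a k integrable_on {0..T}" using less.IH[of k] 3 by (intro integrable_continuous_real) auto
    ultimately show ?thesis unfolding 3 limit_moment.simps
      by (intro continuous_intros indefinite_integral_continuous_1) auto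
  qed auto
qed

lemma limit_drift_continuous: "continuous_on {0..T} (\<lambda>u. limit_drift c s (\<lambda>k. limit_moment c s a k u) n)"
  unfolding limit_drift_def by (intro continuous_intros limit_moment_continuous)

text \<open>For \<open>n = 1\<close> the limiting drift vanishes, so the separate clause for the
  first moment and the recursion merge into one equation, of the same form as the one for
  \<open>S_n\<close>.\<close>

lemma limit_moment_integral_equation:
  assumes "n \<ge> 1"
  shows "limit_moment c s a n t = a n + integral {0..t} (\<lambda>u. limit_drift c s (\<lambda>k. limit_moment c s a k u) n)"
proof (cases "n = 1")
  case True
  then show ?thesis by (simp add: limit_drift_def)
next
  case False
  then obtain k where n: "n = Suc (Suc k)" using assms by (metis One_nat_def not0_implies_Suc not_one_le_zero)
  have i: "limit_moment c s a k integrable_on {0..t}"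
    "(\<lambda>u. limit_moment c s a j u * limit_moment c s a (k - j) u) integrable_on {0..t}" for j
    by (intro integrable_continuous_real continuous_intros limit_moment_continuous)+
  have "integral {0..t} (\<lambda>u. limit_drift c s (\<lambda>k. limit_moment c s a k u) n)
    = s * real n * real (n - 1) / 2 * integral {0..t} (limit_moment c s a k)
      + c * real n / 2 * s * (\<Sum>j\<in>{0..k}. integral {0..t} (\<lambda>u. limit_moment c s a j u * limit_moment c s a (k - j) u))"
  proof -
    have eq: "limit_drift c s (\<lambda>k. limit_moment c s a k u) n = s * real n * real (n - 1) / 2 * limit_moment c s a k u
      + c * real n / 2 * s * (\<Sum>j\<in>{0..k}. limit_moment c s a j u * limit_moment c s a (k - j) u)" for u
      unfolding limit_drift_def n by (simp add: lessThan_Suc_atMost atLeast0AtMost)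
    have "integral {0..t} (\<lambda>u. limit_drift c s (\<lambda>k. limit_moment c s a k u) n)
      = integral {0..t} (\<lambda>u. s * real n * real (n - 1) / 2 * limit_moment c s a k u)
      + integral {0..t} (\<lambda>u. c * real n / 2 * s * (\<Sum>j\<in>{0..k}. limit_moment c s a j u * limit_moment c s a (k - j) u))"
      unfolding eq using i
      by (intro Henstock_Kurzweil_Integration.integral_add integrable_on_mult_right integrable_sum) auto
    also have "\<dots> = s * real n * real (n - 1) / 2 * integral {0..t} (limit_moment c s a k)
      + c * real n / 2 * s * integral {0..t} (\<lambda>u. \<Sum>j\<in>{0..k}. limit_moment c s a j u * limit_moment c s a (k - j) u)"
      by (simp only: Henstock_Kurzweil_Integration.integral_mult_right)
    also have "integral {0..t} (\<lambda>u. \<Sum>j\<in>{0..k}. limit_moment c s a j u * limit_moment c s a (k - j) u)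
      = (\<Sum>j\<in>{0..k}. integral {0..t} (\<lambda>u. limit_moment c s a j u * limit_moment c s a (k - j) u))"
      by (rule Henstock_Kurzweil_Integration.integral_sum) (use i in auto)
    finally show ?thesis .
  qed
  then show ?thesis by (simp add: n algebra_simps)
qed

text \<open>The system is triangular, so no Gronwall argument is called for: the drift converges by
  the rules for sums and products, its time integral follows, and the equation yields the next
  moment.\<close>

lemma moments_conv_of_drift_equation:
  fixes X :: "nat \<Rightarrow> nat \<Rightarrow> real \<Rightarrow> 'a \<Rightarrow> real"
  assumes T: "0 < T" and e: "\<epsilon> \<longlonglongrightarrow> 0" and s: "s \<longlonglongrightarrow> \<sigma>2"
    and X0: "\<And>N t \<omega>. N \<ge> 1 \<Longrightarrow> X 0 N t \<omega> = 1"
    and Xc: "\<And>n N \<omega>. N \<ge> 1 \<Longrightarrow> \<omega> \<in> space (M N) \<Longrightarrow> continuous_on {0..T} (\<lambda>t. X n N t \<omega>)"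
    and init: "\<And>n. a' n \<longlonglongrightarrow> a n"
    and eq: "\<And>n. n \<ge> 1 \<Longrightarrow> unif_conv_in_prob T M (\<lambda>N t \<omega>. X n N t \<omega> - a' n N
        - integral {0..t} (\<lambda>u. moment_drift c \<alpha> N (\<epsilon> N) (s N) (\<lambda>k. X k N u \<omega>) n)) (\<lambda>_. 0)"
  shows "unif_conv_in_prob T M (X n) (limit_moment c \<sigma>2 a n)"
proof (induction n rule: less_induct)
  case (less n)
  show ?case
  proof (cases "n = 0")
    case True
    show ?thesis unfolding True
      by (rule unif_conv_in_prob_cong[OF unif_conv_in_prob_const[of "\<lambda>_. 1" 1]]) (simp_all add: X0)
  next
    case False
    then have n: "n \<ge> 1" by simp
    let ?m = "limit_moment c \<sigma>2 a"
    have inv_N: "(\<lambda>N. r / real N) \<longlonglongrightarrow> 0" for r by (rule lim_const_over_n)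
    have m: "unif_conv_in_prob T M (X k) (?m k)" if "k < n" for k by (rule less.IH[OF that])
    have mc: "continuous_on {0..T} (?m k)" for k by (rule limit_moment_continuous)
    note const = unif_conv_in_prob_const
    have 1: "unif_conv_in_prob T M (\<lambda>N t \<omega>. real n * \<epsilon> N * \<alpha> * X (n - 1) N t \<omega>) (\<lambda>t. real n * 0 * \<alpha> * ?m (n - 1) t)"
      by (intro unif_conv_in_prob_mult const m mc continuous_intros tendsto_intros e) (use n in auto)
    have 2: "unif_conv_in_prob T M (\<lambda>N t \<omega>. real n * real (n - 1) / 2 * (2 * \<epsilon> N * X (n - 1) N t \<omega> + s N * X (n - 2) N t \<omega>))
      (\<lambda>t. real n * real (n - 1) / 2 * (2 * 0 * ?m (n - 1) t + \<sigma>2 * ?m (n - 2) t))"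
      by (intro unif_conv_in_prob_mult unif_conv_in_prob_add const m mc continuous_intros tendsto_intros e s) (use n in auto)
    \<comment> \<open>The self-interaction is written as an added term with coefficient
      \<open>(- real n) / real N\<close>, which fits the rules for sums, products and null
      sequences.\<close>
    have 3: "unif_conv_in_prob T M (\<lambda>N t \<omega>. c * real n / 2 * (2 * \<epsilon> N * ((\<Sum>k<n. X k N t \<omega> * X (n - 1 - k) N t \<omega>) + (- real n) / real N * X (n - 1) N t \<omega>)
                       + s N * ((\<Sum>k<n - 1. X k N t \<omega> * X (n - 2 - k) N t \<omega>) + (- real (n - 1)) / real N * X (n - 2) N t \<omega>)))
      (\<lambda>t. c * real n / 2 * (2 * 0 * ((\<Sum>k<n. ?m k t * ?m (n - 1 - k) t) + 0 * ?m (n - 1) t)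
                       + \<sigma>2 * ((\<Sum>k<n - 1. ?m k t * ?m (n - 2 - k) t) + 0 * ?m (n - 2) t)))"
      by (intro unif_conv_in_prob_mult unif_conv_in_prob_add unif_conv_in_prob_sum const m mc continuous_intros tendsto_intros e s inv_N) (use n in auto)
    have drift: "unif_conv_in_prob T M (\<lambda>N t \<omega>. moment_drift c \<alpha> N (\<epsilon> N) (s N) (\<lambda>k. X k N t \<omega>) n) (\<lambda>t. limit_drift c \<sigma>2 (\<lambda>k. ?m k t) n)"
      by (rule unif_conv_in_prob_cong[OF unif_conv_in_prob_add[OF unif_conv_in_prob_add[OF 1 2] 3]])
        (simp_all add: moment_drift_def limit_drift_def algebra_simps)
    have "unif_conv_in_prob T M (\<lambda>N t \<omega>. integral {0..t} (\<lambda>u. moment_drift c \<alpha> N (\<epsilon> N) (s N) (\<lambda>k. X k N u \<omega>) n))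
      (\<lambda>t. integral {0..t} (\<lambda>u. limit_drift c \<sigma>2 (\<lambda>k. ?m k u) n))"
      by (rule unif_conv_in_prob_integral[OF drift T _ limit_drift_continuous])
        (unfold moment_drift_def, intro continuous_intros Xc)
    from unif_conv_in_prob_add[OF unif_conv_in_prob_add[OF eq[OF n] const[OF init[of n]]] this]
    show ?thesis
      by (rule unif_conv_in_prob_cong) (simp_all add: limit_moment_integral_equation[OF n])
  qed
qed

section \<open>The moment problem\<close>

text \<open>A single term of the exponential series. At \<open>x = n\<close> it stands in for
  Stirling's formula: \<open>n^n \<le> e^n n!\<close>.\<close>

lemma power_div_fact_le_exp: "0 \<le> x \<Longrightarrow> x ^ n / fact n \<le> exp (x::real)"
proof -
  assume x: "0 \<le> x"
  have "(\<Sum>k\<in>{n}. x ^ k /\<^sub>R fact k) \<le> (\<Sum>k. x ^ k /\<^sub>R fact k)"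
    using x by (intro sum_le_suminf summable_exp_generic) auto
  then show ?thesis by (simp add: exp_def divide_inverse mult.commute)
qed

lemma (in prob_space) integrable_power_of_even:
  fixes X :: "'a \<Rightarrow> real"
  assumes [measurable]: "X \<in> borel_measurable M" and int: "integrable M (\<lambda>\<omega>. X \<omega> ^ n)" and "even n" "k \<le> n"
  shows "integrable M (\<lambda>\<omega>. \<bar>X \<omega>\<bar> ^ k)"
proof (rule Bochner_Integration.integrable_bound[of M "\<lambda>\<omega>. 1 + X \<omega> ^ n"])
  show "AE \<omega> in M. norm (\<bar>X \<omega>\<bar> ^ k) \<le> norm (1 + X \<omega> ^ n)"
  proof (intro AE_I2)
    fix \<omega>
    show "norm (\<bar>X \<omega>\<bar> ^ k) \<le> norm (1 + X \<omega> ^ n)"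
      using power_le_one_plus_even_power[OF assms(3,4), of "X \<omega>"] by simp
  qed
qed (use int in auto)

text \<open>With \<open>p = 2 * q + 2\<close> one combines \<open>p^p \<le> e^p p!\<close>,
  \<open>p! \<le> p^j (p - j)!\<close> and \<open>p^j \<le> e^p j!\<close>. The remainder is at most
  \<open>j! / h^j * (h \<Lambda> e^2)^p\<close>, and the radius is chosen so that the base is at
  most 1/2; the second factor \<open>e^p\<close> pays for the \<open>j\<close> derivatives.\<close>

lemma exp_moment_remainder_tendsto_0:
  fixes h \<Lambda> :: real
  assumes \<Lambda>: "\<Lambda> > 0" and h: "0 < h" "h \<le> 1 / (2 * \<Lambda> * exp 2)"
  shows "(\<lambda>q. h ^ (2 * q + 2 - j) / fact (2 * q + 2 - j) * (\<Lambda> * real (2 * q + 2)) ^ (2 * q + 2)) \<longlonglongrightarrow> 0"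
proof (rule tendsto_sandwich[of "\<lambda>_. 0" _ _ "\<lambda>q. fact j / h ^ j * (1/2) ^ (2 * q + 2)"])
  have "strict_mono (\<lambda>q::nat. 2 * q + 2)" by (auto simp: strict_mono_def)
  from LIMSEQ_subseq_LIMSEQ[OF LIMSEQ_realpow_zero[of "1/2"] this]
  have "(\<lambda>q. fact j / h ^ j * (1/2) ^ (2 * q + 2)) \<longlonglongrightarrow> fact j / h ^ j * 0"
    by (intro tendsto_mult_left) (simp add: comp_def)
  then show "(\<lambda>q. fact j / h ^ j * (1/2) ^ (2 * q + 2)) \<longlonglongrightarrow> 0" by simp
  show "\<forall>\<^sub>F q in sequentially. 0 \<le> h ^ (2 * q + 2 - j) / fact (2 * q + 2 - j) * (\<Lambda> * real (2 * q + 2)) ^ (2 * q + 2)"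
    using h \<Lambda> by (auto intro!: always_eventually)
  show "\<forall>\<^sub>F q in sequentially. h ^ (2 * q + 2 - j) / fact (2 * q + 2 - j) * (\<Lambda> * real (2 * q + 2)) ^ (2 * q + 2)
      \<le> fact j / h ^ j * (1/2) ^ (2 * q + 2)"
    using eventually_ge_at_top[of j]
  proof eventually_elim
    case (elim q)
    define p where "p = 2 * q + 2"
    have jp: "j \<le> p" using elim by (simp add: p_def)
    have pp: "real p ^ p \<le> exp (real p) * fact p" using power_div_fact_le_exp[of "real p" p] by (simp add: divide_le_eq)
    have pj: "real p ^ j \<le> exp (real p) * fact j" using power_div_fact_le_exp[of "real p" j] by (simp add: divide_le_eq)
    have e2: "exp (2::real) ^ p = exp (real p) * exp (real p)"
      unfolding exp_of_nat_mult[symmetric] exp_add[symmetric] by (simp add: mult_2_right)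
    have f: "fact p \<le> real p ^ j * fact (p - j)"
    proof -
      have "fact p div fact (p - j) \<le> p ^ j" using fact_div_fact_le_pow[OF jp] .
      moreover have "fact p = (fact p div fact (p - j)) * (fact (p - j) :: nat)" by (simp add: fact_dvd)
      ultimately have "(fact p :: nat) \<le> p ^ j * fact (p - j)" by (metis mult_le_mono1)
      then have "real (fact p) \<le> real (p ^ j * fact (p - j))" by (rule of_nat_mono)
      then show ?thesis by simp
    qed
    have "real p ^ p \<le> exp (real p) * (real p ^ j * fact (p - j))" using pp f by (meson exp_ge_zero mult_left_mono order_trans)
    also have "\<dots> \<le> exp (real p) * ((exp (real p) * fact j) * fact (p - j))" using pj by (intro mult_left_mono mult_right_mono) auto
    finally have "real p ^ p \<le> exp 2 ^ p * fact j * fact (p - j)"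
      by (simp only: e2 mult.assoc)
    then have "h ^ (p - j) / fact (p - j) * (\<Lambda> ^ p * real p ^ p) \<le> h ^ (p - j) / fact (p - j) * (\<Lambda> ^ p * (exp 2 ^ p * fact j * fact (p - j)))"
      using h \<Lambda> by (intro mult_left_mono) auto
    also have "\<dots> = fact j / h ^ j * (h * (\<Lambda> * exp 2)) ^ p"
      using h jp by (simp add: power_diff power_mult_distrib field_simps)
    also have "\<dots> \<le> fact j / h ^ j * (1/2) ^ p"
      using h \<Lambda> by (intro mult_left_mono power_mono) (auto simp: field_simps)
    finally show ?case unfolding p_def[symmetric] power_mult_distrib .
  qed
qed auto

text \<open>Taylor expansion of \<open>t \<mapsto> \<integral>x\<^sup>j e\<^sup>i\<^sup>t\<^sup>x\<close> converges with a radius independent of \<open>t\<close> and \<open>j\<close>, so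
  that agreement of all moments propagates from \<open>t = 0\<close> to the whole line.\<close>

lemma moment_char_step:
  assumes \<mu>: "real_distribution \<mu>" "has_moments \<mu> m" and \<nu>: "real_distribution \<nu>" "has_moments \<nu> m"
    and \<Lambda>: "\<Lambda> > 0" "\<And>n. n \<ge> 1 \<Longrightarrow> \<bar>m n\<bar> \<le> (\<Lambda> * real n) ^ n"
    and h: "h \<noteq> 0" "\<bar>h\<bar> \<le> 1 / (2 * \<Lambda> * exp 2)"
    and eq: "\<And>j. (CLINT x|\<mu>. complex_of_real x ^ j * iexp (t * x)) = (CLINT x|\<nu>. complex_of_real x ^ j * iexp (t * x))"
  shows "(CLINT x|\<mu>. complex_of_real x ^ j * iexp ((t + h) * x)) = (CLINT x|\<nu>. complex_of_real x ^ j * iexp ((t + h) * x))"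
proof -
  define \<phi> where "\<phi> \<rho> j t = (CLINT x|\<rho>. complex_of_real x ^ j * iexp (t * x))" for \<rho> j t
  define B where "B q = \<bar>h\<bar> ^ (2 * q + 2 - j) / fact (2 * q + 2 - j) * (\<Lambda> * real (2 * q + 2)) ^ (2 * q + 2)" for q
  have step: "cmod (\<phi> \<rho> j (t + h) - (\<Sum>k\<le>2 * q + 1 - j. (\<i> * of_real h) ^ k / fact k * \<phi> \<rho> (j + k) t)) \<le> B q"
    if \<rho>: "real_distribution \<rho>" "has_moments \<rho> m" and jq: "j \<le> q" for \<rho> q
  proof -
    interpret real_distribution \<rho> by fact
    \<comment> \<open>Chosen so that the remainder has the even degree
      \<open>n + 1 + j = 2 * q + 2\<close>, where the absolute moment is the moment
      \<open>m (2 * q + 2)\<close>.\<close>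
    define n where "n = 2 * q + 1 - j"
    have nj: "Suc n + j = 2 * q + 2" "Suc n = 2 * q + 2 - j" using jq by (simp_all add: n_def)
    have pw: "integrable \<rho> (\<lambda>x. x ^ k)" "(\<integral>x. x ^ k \<partial>\<rho>) = m k" for k using \<rho>(2) by (simp_all add: has_moments_def)
    have apw: "integrable \<rho> (\<lambda>x. \<bar>x\<bar> ^ k)" for k
      using integrable_power_of_even[of "\<lambda>x. x" "2 * k" k] pw(1) by simp
    have ci: "integrable \<rho> (\<lambda>x. complex_of_real x ^ k * iexp (u * x))" for k u
      by (rule Bochner_Integration.integrable_bound[OF apw[of k]]) (auto simp: norm_mult norm_power)
    have "(CLINT x|\<rho>. complex_of_real x ^ j * iexp ((t + h) * x) - (\<Sum>k\<le>n. (\<i> * of_real h) ^ k / fact k * (complex_of_real x ^ (j + k) * iexp (t * x))))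
      = \<phi> \<rho> j (t + h) - (\<Sum>k\<le>n. (\<i> * of_real h) ^ k / fact k * \<phi> \<rho> (j + k) t)"
    proof -
      have ci2: "integrable \<rho> (\<lambda>x. (\<i> * of_real h) ^ k / fact k * (complex_of_real x ^ (j + k) * iexp (t * x)))" for k
        by (intro integrable_mult_right ci)
      have "(CLINT x|\<rho>. complex_of_real x ^ j * iexp ((t + h) * x) - (\<Sum>k\<le>n. (\<i> * of_real h) ^ k / fact k * (complex_of_real x ^ (j + k) * iexp (t * x))))
        = \<phi> \<rho> j (t + h) - (CLINT x|\<rho>. \<Sum>k\<le>n. (\<i> * of_real h) ^ k / fact k * (complex_of_real x ^ (j + k) * iexp (t * x)))"
        unfolding \<phi>_def by (rule Bochner_Integration.integral_diff[OF ci Bochner_Integration.integrable_sum[OF ci2]])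
      also have "(CLINT x|\<rho>. \<Sum>k\<le>n. (\<i> * of_real h) ^ k / fact k * (complex_of_real x ^ (j + k) * iexp (t * x)))
        = (\<Sum>k\<le>n. CLINT x|\<rho>. (\<i> * of_real h) ^ k / fact k * (complex_of_real x ^ (j + k) * iexp (t * x)))"
        by (rule Bochner_Integration.integral_sum[OF ci2])
      also have "\<dots> = (\<Sum>k\<le>n. (\<i> * of_real h) ^ k / fact k * \<phi> \<rho> (j + k) t)"
        unfolding \<phi>_def by (intro sum.cong refl integral_mult_right_zero)
      finally show ?thesis .
    qed
    then have "cmod (\<phi> \<rho> j (t + h) - (\<Sum>k\<le>n. (\<i> * of_real h) ^ k / fact k * \<phi> \<rho> (j + k) t))
      = cmod (CLINT x|\<rho>. complex_of_real x ^ j * iexp ((t + h) * x) - (\<Sum>k\<le>n. (\<i> * of_real h) ^ k / fact k * (complex_of_real x ^ (j + k) * iexp (t * x))))"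
      by simp
    also have "\<dots> \<le> (\<integral>x. \<bar>h\<bar> ^ Suc n / fact (Suc n) * \<bar>x\<bar> ^ (Suc n + j) \<partial>\<rho>)"
    proof (rule Bochner_Integration.integral_norm_bound_integral)
      show "integrable \<rho> (\<lambda>x. complex_of_real x ^ j * iexp ((t + h) * x) - (\<Sum>k\<le>n. (\<i> * of_real h) ^ k / fact k * (complex_of_real x ^ (j + k) * iexp (t * x))))"
        by (intro Bochner_Integration.integrable_diff Bochner_Integration.integrable_sum integrable_mult_right ci)
      show "integrable \<rho> (\<lambda>x. \<bar>h\<bar> ^ Suc n / fact (Suc n) * \<bar>x\<bar> ^ (Suc n + j))" using apw by (intro integrable_mult_right)
      fix x
      have "complex_of_real x ^ j * iexp ((t + h) * x) - (\<Sum>k\<le>n. (\<i> * of_real h) ^ k / fact k * (complex_of_real x ^ (j + k) * iexp (t * x)))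
        = complex_of_real x ^ j * iexp (t * x) * (iexp (h * x) - (\<Sum>k\<le>n. (\<i> * (h * x)) ^ k / fact k))"
        by (simp add: right_diff_distrib sum_distrib_left exp_add[symmetric] power_add power_mult_distrib algebra_simps)
      also have "cmod \<dots> \<le> \<bar>x\<bar> ^ j * 1 * (\<bar>h * x\<bar> ^ Suc n / fact (Suc n))"
        unfolding norm_mult by (intro mult_mono iexp_approx1) (auto simp: norm_power)
      also have "\<dots> = \<bar>h\<bar> ^ Suc n / fact (Suc n) * \<bar>x\<bar> ^ (Suc n + j)"
        by (simp only: abs_mult power_mult_distrib power_add mult_1_right times_divide_eq_right times_divide_eq_left mult.assoc mult.commute mult.left_commute)
      finally show "cmod (complex_of_real x ^ j * iexp ((t + h) * x) - (\<Sum>k\<le>n. (\<i> * of_real h) ^ k / fact k * (complex_of_real x ^ (j + k) * iexp (t * x))))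
        \<le> \<bar>h\<bar> ^ Suc n / fact (Suc n) * \<bar>x\<bar> ^ (Suc n + j)" .
    qed
    also have "\<dots> = \<bar>h\<bar> ^ Suc n / fact (Suc n) * m (2 * q + 2)"
    proof -
      have "(\<lambda>x::real. \<bar>x\<bar> ^ (Suc n + j)) = (\<lambda>x. x ^ (2 * q + 2))" unfolding nj(1) by (intro ext power_even_abs) simp
      then show ?thesis unfolding integral_mult_right_zero pw(2)[of "2 * q + 2", symmetric] by (simp only:)
    qed
    also have "\<dots> \<le> \<bar>h\<bar> ^ Suc n / fact (Suc n) * (\<Lambda> * real (2 * q + 2)) ^ (2 * q + 2)"
      using \<Lambda>(2)[of "2 * q + 2"] by (intro mult_left_mono) auto
    finally show ?thesis unfolding B_def nj(2)[symmetric] n_def[symmetric] .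
  qed
  have "cmod (\<phi> \<mu> j (t + h) - \<phi> \<nu> j (t + h)) \<le> B q + B q" if jq: "j \<le> q" for q
  proof -
    \<comment> \<open>By \<open>eq\<close> the two laws share this Taylor polynomial.\<close>
    define S where "S = (\<Sum>k\<le>2 * q + 1 - j. (\<i> * of_real h) ^ k / fact k * \<phi> \<mu> (j + k) t)"
    have S: "S = (\<Sum>k\<le>2 * q + 1 - j. (\<i> * of_real h) ^ k / fact k * \<phi> \<nu> (j + k) t)"
      unfolding S_def \<phi>_def by (intro sum.cong refl arg_cong2[where f="(*)"] eq)
    have "cmod (\<phi> \<mu> j (t + h) - \<phi> \<nu> j (t + h)) = cmod ((\<phi> \<mu> j (t + h) - S) - (\<phi> \<nu> j (t + h) - S))" by simp
    also have "\<dots> \<le> cmod (\<phi> \<mu> j (t + h) - S) + cmod (\<phi> \<nu> j (t + h) - S)" by (rule norm_triangle_ineq4)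
    also have "\<dots> \<le> B q + B q"
      using step[OF \<mu> jq, folded S_def] step[OF \<nu> jq, folded S] by (rule add_mono)
    finally show ?thesis .
  qed
  moreover have "(\<lambda>q. B q + B q) \<longlonglongrightarrow> 0 + 0"
    unfolding B_def using \<Lambda>(1) h by (intro tendsto_add exp_moment_remainder_tendsto_0) auto
  ultimately have "cmod (\<phi> \<mu> j (t + h) - \<phi> \<nu> j (t + h)) \<le> 0 + 0"
    by (intro LIMSEQ_le_const[of "\<lambda>q. B q + B q"]) auto
  then show ?thesis by (simp add: \<phi>_def)
qed

text \<open>The point \<open>t\<close> is reached from 0 in equal steps shorter than the radius of
  convergence. The induction carries the integrals for every \<open>j\<close>, since one step
  consumes the derivatives of all orders at its starting point.\<close>

lemma moments_determine_distribution:
  assumes \<mu>: "real_distribution \<mu>" "has_moments \<mu> m" and \<nu>: "real_distribution \<nu>" "has_moments \<nu> m"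
    and \<Lambda>: "\<Lambda> > 0" "\<And>n. n \<ge> 1 \<Longrightarrow> \<bar>m n\<bar> \<le> (\<Lambda> * real n) ^ n"
  shows "\<mu> = \<nu>"
proof (rule Levy_uniqueness[OF \<mu>(1) \<nu>(1)], rule ext)
  fix t :: real
  show "char \<mu> t = char \<nu> t"
  proof (cases "t = 0")
    case True
    then show ?thesis using real_distribution.char_zero \<mu> \<nu> by simp
  next
    case False
    define \<delta> where "\<delta> = 1 / (2 * \<Lambda> * exp 2)"
    have \<delta>: "\<delta> > 0" using \<Lambda> by (simp add: \<delta>_def)
    obtain N :: nat where N: "\<bar>t\<bar> / \<delta> < real N" using reals_Archimedean2 by blast
    then have N0: "real N > 0" using \<delta> by (smt (verit) divide_nonneg_pos)
    define h where "h = t / real N"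
    have h: "h \<noteq> 0" "\<bar>h\<bar> \<le> 1 / (2 * \<Lambda> * exp 2)"
    proof -
      show "h \<noteq> 0" using False N0 by (simp add: h_def)
      have "\<bar>t\<bar> / real N \<le> \<delta>" using N N0 \<delta> by (simp add: field_simps)
      then show "\<bar>h\<bar> \<le> 1 / (2 * \<Lambda> * exp 2)" using N0 unfolding \<delta>_def[symmetric] by (simp add: h_def)
    qed
    have "(CLINT x|\<mu>. complex_of_real x ^ j * iexp (real k * h * x)) = (CLINT x|\<nu>. complex_of_real x ^ j * iexp (real k * h * x))" for k j
    proof (induction k arbitrary: j)
      case 0
      have "(CLINT x|\<rho>. complex_of_real x ^ j) = of_real (m j)" if "has_moments \<rho> m" for \<rho>
        using that unfolding has_moments_def of_real_power[symmetric] by (subst integral_complex_of_real) auto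
      then show ?case using \<mu> \<nu> by simp
    next
      case (Suc k)
      have "(CLINT x|\<mu>. complex_of_real x ^ j * iexp ((real k * h + h) * x)) = (CLINT x|\<nu>. complex_of_real x ^ j * iexp ((real k * h + h) * x))"
        by (rule moment_char_step[OF \<mu> \<nu> \<Lambda>(1) _ h Suc.IH]) (rule \<Lambda>(2))
      moreover have "real k * h + h = real (Suc k) * h" by (simp add: algebra_simps)
      ultimately show ?case by (simp only:)
    qed
    from this[of 0 N] show ?thesis using N0 by (simp add: char_def h_def)
  qed
qed

section \<open>Tightness and the moments of weak limits\<close>

lemma bounded_second_moments_imp_tight:
  assumes rd: "\<And>k. real_distribution (\<nu> k)" and int: "\<And>k. integrable (\<nu> k) (\<lambda>x. x\<^sup>2)"
    and bd: "\<And>k. (\<integral>x. x\<^sup>2 \<partial>\<nu> k) \<le> C"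
  shows "tight \<nu>"
  unfolding tight_def
proof (intro conjI allI impI rd)
  fix e :: real assume e: "0 < e"
  have "0 \<le> (\<integral>x. x\<^sup>2 \<partial>\<nu> 0)" by (intro Bochner_Integration.integral_nonneg) simp
  then have C: "C \<ge> 0" using bd[of 0] by (rule order_trans)
  \<comment> \<open>\<open>C + 1\<close> makes \<open>C / L^2 < e\<close> strict, and the final
    \<open>+ 1\<close> keeps \<open>L\<close> at least 1.\<close>
  define L where "L = sqrt ((C + 1) / e) + 1"
  have L1: "L \<ge> 1" using C e by (simp add: L_def)
  have "(C + 1) / e \<le> (sqrt ((C + 1) / e))\<^sup>2" using C e by simp
  also have "\<dots> \<le> L\<^sup>2" using C e by (intro power_mono) (auto simp: L_def)
  finally have L2: "C / L\<^sup>2 < e" using C e L1 by (simp add: field_simps)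
  have "1 - e < measure (\<nu> k) {- L<..L}" for k
  proof -
    interpret real_distribution "\<nu> k" by (rule rd)
    have "measure (\<nu> k) {x \<in> space (\<nu> k). L\<^sup>2 \<le> x\<^sup>2} \<le> (\<integral>x. x\<^sup>2 \<partial>\<nu> k) / L\<^sup>2"
      using integral_Markov_inequality_measure[of "\<nu> k" "\<lambda>x. x\<^sup>2" "space (\<nu> k)" "L\<^sup>2"] int[of k] L1 by simp
    also have "\<dots> \<le> C / L\<^sup>2" using bd[of k] by (intro divide_right_mono) auto
    finally have 1: "measure (\<nu> k) {x \<in> space (\<nu> k). L\<^sup>2 \<le> x\<^sup>2} < e" using L2 by simp
    have "space (\<nu> k) - {x \<in> space (\<nu> k). L\<^sup>2 \<le> x\<^sup>2} \<subseteq> {- L<..L}"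
      using L1 by (auto simp: not_le abs_le_square_iff[symmetric] power2_le_iff_abs_le abs_less_iff dest!: power2_less_imp_less[of "\<bar>_\<bar>" L, simplified])
    then have "measure (\<nu> k) (space (\<nu> k) - {x \<in> space (\<nu> k). L\<^sup>2 \<le> x\<^sup>2}) \<le> measure (\<nu> k) {- L<..L}"
      by (intro finite_measure_mono) auto
    moreover have "measure (\<nu> k) (space (\<nu> k) - {x \<in> space (\<nu> k). L\<^sup>2 \<le> x\<^sup>2}) = 1 - measure (\<nu> k) {x \<in> space (\<nu> k). L\<^sup>2 \<le> x\<^sup>2}"
      by (rule prob_compl) simp
    ultimately show ?thesis using 1 by simp
  qed
  then show "\<exists>a b. a < b \<and> (\<forall>n. 1 - e < measure (\<nu> n) {a<..b})"
    using L1 by (intro exI[of _ "- L"] exI[of _ L]) auto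
qed

text \<open>Powers are unbounded, so weak convergence is applied to the truncations
  \<open>cl L x ^ n\<close>. The truncation error is at most \<open>2 x^(2n) / L^n\<close>,
  uniformly small because the moments of order \<open>2 n\<close> converge and are therefore bounded
  along the sequence.\<close>

lemma weak_limit_has_moments:
  assumes rd: "\<And>k. real_distribution (\<nu> k)" and rd': "real_distribution \<nu>'" and weak: "weak_conv_m \<nu> \<nu>'"
    and int: "\<And>k n. integrable (\<nu> k) (\<lambda>x. x ^ n)" and conv: "\<And>n. (\<lambda>k. \<integral>x. x ^ n \<partial>\<nu> k) \<longlonglongrightarrow> m n"
  shows "has_moments \<nu>' m"
proof -
  interpret R: real_distribution \<nu>' by fact
  define cl where "cl L x = max (- L) (min L x)" for L x :: real
  have cl_cont: "isCont (\<lambda>x. cl L x ^ n) x" for L n x unfolding cl_def by (intro continuous_intros)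
  have cl_bd: "\<bar>cl L x\<bar> \<le> \<bar>L\<bar>" for L x by (auto simp: cl_def)
  have cl_le: "\<bar>cl L x\<bar> \<le> \<bar>x\<bar>" if "L \<ge> 0" for L x using that by (auto simp: cl_def)
  have cl_id: "cl L x = x" if "\<bar>x\<bar> \<le> L" for L x using that by (auto simp: cl_def)
  have cl_meas[measurable]: "cl L \<in> borel_measurable borel" for L unfolding cl_def by measurable
  have cl_conv: "(\<lambda>k. \<integral>x. cl L x ^ n \<partial>\<nu> k) \<longlonglongrightarrow> (\<integral>x. cl L x ^ n \<partial>\<nu>')" for L n
    using weak_conv_imp_integral_bdd_continuous_conv[OF rd rd' weak cl_cont, where B="\<bar>L\<bar> ^ n"] cl_bd
    by (simp add: power_abs power_mono)
  have cl_int: "integrable \<rho> (\<lambda>x. cl L x ^ n)" if "real_distribution \<rho>" for \<rho> L n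
  proof -
    interpret real_distribution \<rho> by fact
    show ?thesis by (rule integrable_const_bound[of _ "\<bar>L\<bar> ^ n"]) (auto simp: power_abs cl_bd power_mono)
  qed
  define C where "C n = (SUP k. \<integral>x. x ^ (2 * n) \<partial>\<nu> k)" for n
  have bdd: "bdd_above (range (\<lambda>k. \<integral>x. x ^ (2 * n) \<partial>\<nu> k))" for n
    using convergent_imp_Bseq[OF convergentI[OF conv[of "2 * n"]]] by (simp add: Bseq_eq_bounded bounded_imp_bdd_above)
  have C: "(\<integral>x. x ^ (2 * n) \<partial>\<nu> k) \<le> C n" for k :: nat and n unfolding C_def by (rule cSUP_upper[OF _ bdd]) simp
  have C0: "0 \<le> C n" for n
    by (rule order_trans[OF _ C[of 0 n]]) (intro Bochner_Integration.integral_nonneg, simp add: zero_le_even_power)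
  have cl_C: "(\<integral>x. cl (real L) x ^ (2 * n) \<partial>\<nu>') \<le> C n" for L n
  proof (rule LIMSEQ_le_const2[OF cl_conv], intro exI allI impI)
    fix k
    have "(\<integral>x. cl (real L) x ^ (2 * n) \<partial>\<nu> k) \<le> (\<integral>x. x ^ (2 * n) \<partial>\<nu> k)"
    proof (rule integral_mono[OF cl_int[OF rd] int])
      fix x show "cl (real L) x ^ (2 * n) \<le> x ^ (2 * n)"
        using power_mono[OF cl_le[of "real L" x], of "2 * n"] by (simp add: power_even_abs)
    qed
    then show "(\<integral>x. cl (real L) x ^ (2 * n) \<partial>\<nu> k) \<le> C n" using C order_trans by blast
  qed
  have even: "integrable \<nu>' (\<lambda>x. x ^ (2 * n)) \<and> (\<integral>x. x ^ (2 * n) \<partial>\<nu>') \<le> C n" for n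
  proof -
    have lim: "(\<lambda>L. ennreal (cl (real L) x ^ (2 * n))) \<longlonglongrightarrow> ennreal (x ^ (2 * n))" for x
    proof (rule tendsto_eventually)
      obtain L0 :: nat where "\<bar>x\<bar> \<le> real L0" using real_arch_simple by blast
      then show "\<forall>\<^sub>F L in sequentially. ennreal (cl (real L) x ^ (2 * n)) = ennreal (x ^ (2 * n))"
        by (intro eventually_mono[OF eventually_ge_at_top[of L0]]) (simp add: cl_id)
    qed
    \<comment> \<open>Fatou's lemma as the truncation level grows carries the uniform bound over to
      the limit law.\<close>
    have "(\<integral>\<^sup>+x. ennreal (x ^ (2 * n)) \<partial>\<nu>') = (\<integral>\<^sup>+x. liminf (\<lambda>L. ennreal (cl (real L) x ^ (2 * n))) \<partial>\<nu>')"
      by (intro nn_integral_cong lim_imp_Liminf[symmetric] lim sequentially_bot)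
    also have "\<dots> \<le> liminf (\<lambda>L. \<integral>\<^sup>+x. ennreal (cl (real L) x ^ (2 * n)) \<partial>\<nu>')"
      by (rule nn_integral_liminf) simp
    also have "\<dots> \<le> liminf (\<lambda>L::nat. ennreal (C n))"
    proof (intro Liminf_mono always_eventually allI)
      fix L
      have "(\<integral>\<^sup>+x. ennreal (cl (real L) x ^ (2 * n)) \<partial>\<nu>') = ennreal (\<integral>x. cl (real L) x ^ (2 * n) \<partial>\<nu>')"
        by (rule nn_integral_eq_integral[OF cl_int[OF rd']]) (simp add: zero_le_even_power)
      then show "(\<integral>\<^sup>+x. ennreal (cl (real L) x ^ (2 * n)) \<partial>\<nu>') \<le> ennreal (C n)" using cl_C by (simp add: ennreal_leI)
    qed
    also have "\<dots> = ennreal (C n)" by (simp add: Liminf_const)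
    finally have fin: "(\<integral>\<^sup>+x. ennreal (x ^ (2 * n)) \<partial>\<nu>') \<le> ennreal (C n)" .
    then have i: "integrable \<nu>' (\<lambda>x. x ^ (2 * n))"
      by (intro integrableI_nonneg) (auto simp: zero_le_even_power intro: le_less_trans)
    have "ennreal (\<integral>x. x ^ (2 * n) \<partial>\<nu>') \<le> ennreal (C n)"
      using fin nn_integral_eq_integral[OF i] by (simp add: zero_le_even_power)
    then show ?thesis using i C0 by simp
  qed
  have all: "integrable \<nu>' (\<lambda>x. x ^ n)" for n
  proof -
    have "integrable \<nu>' (\<lambda>x. \<bar>x\<bar> ^ n)" using even[of n] by (intro R.integrable_power_of_even[of "\<lambda>x. x" "2 * n" n]) auto
    then show ?thesis by (rule Bochner_Integration.integrable_bound) (auto simp: power_abs)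
  qed
  have trunc: "\<bar>(\<integral>x. x ^ n \<partial>\<rho>) - (\<integral>x. cl L x ^ n \<partial>\<rho>)\<bar> \<le> 2 * C n / L ^ n"
    if \<rho>: "real_distribution \<rho>" "\<And>n. integrable \<rho> (\<lambda>x. x ^ n)" "(\<integral>x. x ^ (2 * n) \<partial>\<rho>) \<le> C n" and L: "L > 0" for \<rho> n L
  proof -
    have "\<bar>\<integral>x. x ^ n - cl L x ^ n \<partial>\<rho>\<bar> \<le> (\<integral>x. 2 / L ^ n * x ^ (2 * n) \<partial>\<rho>)"
    proof (rule Bochner_Integration.integral_norm_bound_integral[where 'b=real, unfolded real_norm_def])
      show "integrable \<rho> (\<lambda>x. x ^ n - cl L x ^ n)" using \<rho>(2) cl_int[OF \<rho>(1)] by (intro Bochner_Integration.integrable_diff)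
      show "integrable \<rho> (\<lambda>x. 2 / L ^ n * x ^ (2 * n))" using \<rho>(2) by (intro integrable_mult_right)
      fix x
      show "\<bar>x ^ n - cl L x ^ n\<bar> \<le> 2 / L ^ n * x ^ (2 * n)"
      proof (cases "\<bar>x\<bar> \<le> L")
        case True
        then show ?thesis using L by (simp add: cl_id zero_le_even_power)
      next
        case False
        have "\<bar>cl L x ^ n\<bar> \<le> \<bar>x\<bar> ^ n" unfolding power_abs using L by (intro power_mono cl_le) auto
        then have "\<bar>x ^ n - cl L x ^ n\<bar> \<le> 2 * \<bar>x\<bar> ^ n" using abs_triangle_ineq4[of "x ^ n" "cl L x ^ n"] by (simp add: power_abs)
        also have "\<dots> = 2 / L ^ n * (L ^ n * \<bar>x\<bar> ^ n)" using L by simp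
        also have "\<dots> \<le> 2 / L ^ n * (\<bar>x\<bar> ^ n * \<bar>x\<bar> ^ n)"
          using L False by (intro mult_left_mono mult_right_mono power_mono) auto
        also have "\<bar>x\<bar> ^ n * \<bar>x\<bar> ^ n = x ^ (2 * n)" by (simp add: power_add[symmetric] mult_2[symmetric] power_even_abs)
        finally show ?thesis .
      qed
    qed
    also have "\<dots> = 2 / L ^ n * (\<integral>x. x ^ (2 * n) \<partial>\<rho>)" by simp
    also have "\<dots> \<le> 2 / L ^ n * C n" using \<rho>(3) L by (intro mult_left_mono) auto
    finally show ?thesis using \<rho>(2) cl_int[OF \<rho>(1)] by (simp add: Bochner_Integration.integral_diff)
  qed
  have "(\<integral>x. x ^ n \<partial>\<nu>') = m n" for n
  \<comment> \<open>Split off because the truncation bound carries \<open>L^n\<close>, which does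
    not grow for \<open>n = 0\<close>.\<close>
  proof (cases "n = 0")
    case True
    have "(\<integral>x. x ^ 0 \<partial>\<nu> k) = 1" for k
    proof -
      interpret real_distribution "\<nu> k" by (rule rd)
      show ?thesis using prob_space by simp
    qed
    then have "m 0 = 1" using conv[of 0] LIMSEQ_unique[OF _ tendsto_const] by auto
    then show ?thesis using True R.prob_space by simp
  next
    case False
    have "\<bar>m n - (\<integral>x. x ^ n \<partial>\<nu>')\<bar> \<le> 4 * C n / real (Suc L) ^ n" for L
    proof -
      let ?L = "real (Suc L)"
      have "(\<lambda>k. \<bar>(\<integral>x. x ^ n \<partial>\<nu> k) - (\<integral>x. cl ?L x ^ n \<partial>\<nu> k)\<bar>) \<longlonglongrightarrow> \<bar>m n - (\<integral>x. cl ?L x ^ n \<partial>\<nu>')\<bar>"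
        by (intro tendsto_intros conv cl_conv)
      then have "\<bar>m n - (\<integral>x. cl ?L x ^ n \<partial>\<nu>')\<bar> \<le> 2 * C n / ?L ^ n"
        by (rule LIMSEQ_le_const2) (intro exI allI impI trunc rd int C, simp)
      moreover have "\<bar>(\<integral>x. x ^ n \<partial>\<nu>') - (\<integral>x. cl ?L x ^ n \<partial>\<nu>')\<bar> \<le> 2 * C n / ?L ^ n"
        using even[of n] by (intro trunc rd' all) auto
      moreover have "4 * C n / ?L ^ n = 2 * C n / ?L ^ n + 2 * C n / ?L ^ n" by simp
      ultimately show ?thesis by linarith
    qed
    moreover have "(\<lambda>L. 4 * C n / real (Suc L) ^ n) \<longlonglongrightarrow> 0"
      using False by (intro real_tendsto_divide_at_top[OF tendsto_const] filterlim_pow_at_top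
          filterlim_compose[OF filterlim_real_sequentially filterlim_Suc]) auto
    ultimately have "\<bar>m n - (\<integral>x. x ^ n \<partial>\<nu>')\<bar> \<le> 0"
      by (intro LIMSEQ_le_const[of "\<lambda>L. 4 * C n / real (Suc L) ^ n"]) auto
    then show ?thesis by simp
  qed
  then show ?thesis unfolding has_moments_def using all by blast
qed

text \<open>Second moments give tightness, and every weak subsequential limit has the moments
  \<open>m\<close>. That settles existence; the growth condition identifies all these limits with
  \<mu>, so the whole sequence converges.\<close>

lemma method_of_moments:
  assumes rd: "\<And>k. real_distribution (\<nu> k)" and int: "\<And>k n. integrable (\<nu> k) (\<lambda>x. x ^ n)"
    and conv: "\<And>n. (\<lambda>k. \<integral>x. x ^ n \<partial>\<nu> k) \<longlonglongrightarrow> m n"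
  shows "\<exists>\<nu>'. real_distribution \<nu>' \<and> has_moments \<nu>' m"
    and "\<lbrakk>real_distribution \<mu>; has_moments \<mu> m; \<Lambda> > 0; \<And>n. n \<ge> 1 \<Longrightarrow> \<bar>m n\<bar> \<le> (\<Lambda> * real n) ^ n\<rbrakk> \<Longrightarrow> weak_conv_m \<nu> \<mu>"
proof -
  have "Bseq (\<lambda>k. \<integral>x. x\<^sup>2 \<partial>\<nu> k)" using conv[of 2] by (intro convergent_imp_Bseq convergentI)
  then obtain C where "\<And>k. \<bar>\<integral>x. x\<^sup>2 \<partial>\<nu> k\<bar> \<le> C" unfolding Bseq_def by auto
  then have tight: "tight \<nu>"
    using rd int by (intro bounded_second_moments_imp_tight[of \<nu> C]) (auto intro: order_trans[OF abs_ge_self])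
  have sub: "has_moments \<nu>' m" if "strict_mono s" "real_distribution \<nu>'" "weak_conv_m (\<nu> \<circ> s) \<nu>'" for s \<nu>'
    by (rule weak_limit_has_moments[OF _ that(2,3)])
      (use rd int LIMSEQ_subseq_LIMSEQ[OF conv that(1)] in \<open>simp_all add: comp_def\<close>)
  from tight_imp_convergent_subsubsequence[OF tight strict_mono_id]
  obtain r \<nu>' where "strict_mono r" "real_distribution \<nu>'" "weak_conv_m (\<nu> \<circ> r) \<nu>'" by auto
  then show "\<exists>\<nu>'. real_distribution \<nu>' \<and> has_moments \<nu>' m" using sub by blast
  assume \<mu>: "real_distribution \<mu>" "has_moments \<mu> m" and \<Lambda>: "\<Lambda> > 0" "\<And>n. n \<ge> 1 \<Longrightarrow> \<bar>m n\<bar> \<le> (\<Lambda> * real n) ^ n"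
  show "weak_conv_m \<nu> \<mu>"
  proof (rule tight_subseq_weak_converge[OF rd \<mu>(1) tight])
    fix s \<nu>' assume s: "strict_mono s" "real_distribution \<nu>'" "weak_conv_m (\<nu> \<circ> s) \<nu>'"
    have "\<nu>' = \<mu>" by (rule moments_determine_distribution[OF s(2) sub[OF s] \<mu> \<Lambda>])
    then show "weak_conv_m (\<nu> \<circ> s) \<mu>" using s(3) by simp
  qed
qed

section \<open>Weak convergence of the empirical measures\<close>

lemma limit_moment_continuous_nonneg: "continuous_on {0..} (limit_moment c s a n)"
  unfolding continuous_on_sequentially comp_def
proof (intro allI ballI impI, elim conjE)
  fix t' :: "nat \<Rightarrow> real" and t assume t: "t \<in> {0..}" and t': "\<forall>k. t' k \<in> {0..}" "t' \<longlonglongrightarrow> t"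
  obtain B where B: "\<And>k. \<bar>t' k\<bar> \<le> B"
    using convergent_imp_Bseq[OF convergentI[OF t'(2)]] unfolding Bseq_def by auto
  have tB: "t \<le> B" by (rule LIMSEQ_le_const2[OF t'(2)]) (use B abs_le_D1 in blast)
  show "(\<lambda>k. limit_moment c s a n (t' k)) \<longlonglongrightarrow> limit_moment c s a n t"
    by (rule continuous_on_tendsto_compose[OF limit_moment_continuous[of B] t'(2)])
      (use t t' B tB abs_le_D1 in \<open>auto intro!: always_eventually\<close>)
qed

text \<open>Bounding \<open>m_k\<close> by \<open>(A n)^k\<close> for all \<open>k < n\<close> makes
  each product in the drift at most \<open>(A n)^(n-2)\<close>. The remaining factor is
  \<open>K n^2 / 2\<close>, where \<open>K = s * T * (1 + c)\<close>, and \<open>K \<le> A^2\<close>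
  brings the integral to half of \<open>(A n)^n\<close>. The other half is left for
  \<open>a n\<close>, which \<open>A \<ge> 2 \<Lambda>\<close> provides.\<close>

lemma limit_moment_growth:
  assumes T: "0 \<le> T" and c: "0 < c" and s: "0 < s" and \<Lambda>: "\<Lambda> > 0" "\<And>n. n \<ge> 1 \<Longrightarrow> \<bar>a n\<bar> \<le> (\<Lambda> * real n) ^ n"
  shows "\<exists>\<Lambda>'>0. \<forall>n. \<forall>t\<in>{0..T}. \<bar>limit_moment c s a n t\<bar> \<le> (\<Lambda>' * real n) ^ n"
proof -
  define K where "K = s * T * (1 + c)"
  have K: "K \<ge> 0" using T c s by (simp add: K_def)
  define A where "A = 2 * \<Lambda> + 2 * K + 2"
  have A: "A \<ge> 2 * \<Lambda>" "A \<ge> 2 * K" "A \<ge> 2" "A > 0" using \<Lambda> K by (auto simp: A_def)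
  have "\<bar>limit_moment c s a n t\<bar> \<le> (A * real n) ^ n" if "t \<in> {0..T}" for n t
    using that
  proof (induction n arbitrary: t rule: less_induct)
    case (less n)
    show ?case
    proof (cases "n = 0")
      case False
      then have n: "n \<ge> 1" by simp
      let ?m = "\<lambda>k. limit_moment c s a k"
      define B where "B = s * real n * real n * (1 + c) * (A * real n) ^ (n - 2)"
      have drift: "\<bar>limit_drift c s (\<lambda>k. ?m k u) n\<bar> \<le> B / 2" if n2: "n \<ge> 2" and u: "u \<in> {0..T}" for u
      proof -
        have pw: "\<bar>?m k u\<bar> \<le> (A * real n) ^ k" if "k < n" for k
          using less.IH[OF that u] that A by (elim order_trans) (intro power_mono mult_left_mono, auto)
        have "\<bar>\<Sum>k<n - 1. ?m k u * ?m (n - 2 - k) u\<bar> \<le> (\<Sum>k<n - 1. (A * real n) ^ (n - 2))"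
        proof (intro order_trans[OF sum_abs] sum_mono)
          fix k assume k: "k \<in> {..<n - 1}"
          have "\<bar>?m k u * ?m (n - 2 - k) u\<bar> \<le> (A * real n) ^ k * (A * real n) ^ (n - 2 - k)"
            unfolding abs_mult using k A by (intro mult_mono pw) auto
          also have "\<dots> = (A * real n) ^ (n - 2)" using k by (simp add: power_add[symmetric])
          finally show "\<bar>?m k u * ?m (n - 2 - k) u\<bar> \<le> (A * real n) ^ (n - 2)" .
        qed
        also have "\<dots> \<le> real n * (A * real n) ^ (n - 2)" using A by (simp add: mult_right_mono)
        finally have S: "\<bar>\<Sum>k<n - 1. ?m k u * ?m (n - 2 - k) u\<bar> \<le> real n * (A * real n) ^ (n - 2)" .
        have "\<bar>limit_drift c s (\<lambda>k. ?m k u) n\<bar> \<le> s * real n * real (n - 1) / 2 * \<bar>?m (n - 2) u\<bar> + c * real n / 2 * s * \<bar>\<Sum>k<n - 1. ?m k u * ?m (n - 2 - k) u\<bar>"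
          unfolding limit_drift_def using c s by (intro order_trans[OF abs_triangle_ineq]) (simp add: abs_mult)
        also have "\<dots> \<le> s * real n * real n / 2 * (A * real n) ^ (n - 2) + c * real n / 2 * s * (real n * (A * real n) ^ (n - 2))"
          using c s A n2 pw[of "n - 2"] S by (intro add_mono mult_mono divide_right_mono) auto
        also have "\<dots> = B / 2" by (simp add: B_def algebra_simps add_divide_distrib)
        finally show ?thesis .
      qed
      have int: "\<bar>integral {0..t} (\<lambda>u. limit_drift c s (\<lambda>k. ?m k u) n)\<bar> \<le> (A * real n) ^ n / 2"
      proof (cases "n = 1")
        case True
        then show ?thesis using A by (simp add: limit_drift_def)
      next
        case False
        then have n2: "n \<ge> 2" using n by simp
        have B: "B \<ge> 0" using s c A by (simp add: B_def)
        have "\<bar>integral {0..t} (\<lambda>u. limit_drift c s (\<lambda>k. ?m k u) n)\<bar> \<le> integral {0..t} (\<lambda>u. B / 2)"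
          by (rule abs_integral_le) (use drift[OF n2] less.prems in \<open>auto intro!: integrable_continuous_real limit_drift_continuous\<close>)
        also have "\<dots> = t * B / 2" using less.prems by simp
        also have "\<dots> \<le> T * B / 2" using less.prems B by (intro divide_right_mono mult_right_mono) auto
        also have "\<dots> = K * (real n * real n) * (A * real n) ^ (n - 2) / 2" by (simp add: B_def K_def)
        also have "\<dots> \<le> (A * A) * (real n * real n) * (A * real n) ^ (n - 2) / 2"
        proof -
          have "K * 1 \<le> A * A" using A K by (intro mult_mono) auto
          then show ?thesis using A by (intro divide_right_mono mult_right_mono) auto
        qed
        also have "\<dots> = (A * real n) ^ Suc (Suc (n - 2)) / 2" by (simp add: mult_ac)
        also have "Suc (Suc (n - 2)) = n" using n2 by simp
        finally show ?thesis .
      qed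
      have "\<bar>a n\<bar> \<le> (\<Lambda> * real n) ^ n" using \<Lambda>(2)[OF n] .
      also have "\<dots> \<le> (A / 2 * real n) ^ n" using A \<Lambda> by (intro power_mono mult_right_mono) auto
      also have "\<dots> = (A * real n) ^ n * (1/2) ^ n" by (simp add: power_mult_distrib power_divide)
      also have "\<dots> \<le> (A * real n) ^ n * (1/2) ^ 1" using n A by (intro mult_left_mono power_decreasing) auto
      finally have "\<bar>a n\<bar> \<le> (A * real n) ^ n / 2" by simp
      then show ?thesis unfolding limit_moment_integral_equation[OF n] using int by linarith
    qed simp
  qed
  then show ?thesis using A(4) by blast
qed

section \<open>Empirical measures and the weak topology\<close>

lemma empirical_measure_real_distribution:
  assumes "N \<ge> 1" shows "real_distribution (empirical_measure N x)"
proof -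
  have "prob_space (uniform_count_measure {1..N})" using assms by (intro prob_space_uniform_count_measure) auto
  then interpret prob_space "uniform_count_measure {1..N}" .
  show ?thesis unfolding empirical_measure_def
    by (intro real_distribution_distr) (simp add: measurable_def space_uniform_count_measure sets_uniform_count_measure)
qed

lemma integral_empirical_measure:
  assumes [measurable]: "f \<in> borel_measurable borel"
  shows "integrable (empirical_measure N x) f" "(\<integral>u. f u \<partial>empirical_measure N x) = (1 / real N) * (\<Sum>i=1..N. (f (x i) :: real))"
proof -
  have m: "x \<in> uniform_count_measure {1..N} \<rightarrow>\<^sub>M borel"
    by (simp add: measurable_def space_uniform_count_measure sets_uniform_count_measure)
  have "integrable (uniform_count_measure {1..N}) (\<lambda>i. f (x i))"
    unfolding uniform_count_measure_def by (rule integrable_point_measure_finite) simp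
  then show "integrable (empirical_measure N x) f" unfolding empirical_measure_def using integrable_distr_eq[OF m assms] by (simp only:)
  show "(\<integral>u. f u \<partial>empirical_measure N x) = (1 / real N) * (\<Sum>i=1..N. f (x i))"
    unfolding empirical_measure_def integral_distr[OF m assms] by (simp add: integral_uniform_count_measure)
qed

lemma empirical_measure_moments:
  "integrable (empirical_measure N x) (\<lambda>u. u ^ n)" "(\<integral>u. u ^ n \<partial>empirical_measure N x) = empirical_moment N x n"
  using integral_empirical_measure[of "\<lambda>u. u ^ n" N x] by (simp_all add: empirical_moment_def)

lemma continuous_map_weak_topology:
  fixes \<mu> :: "real \<Rightarrow> real measure"
  assumes rd: "\<And>t. t \<in> S \<Longrightarrow> real_distribution (\<mu> t)"
    and cont: "\<And>f :: real \<Rightarrow> real. continuous_on UNIV f \<Longrightarrow> bounded (range f) \<Longrightarrow> continuous_on S (\<lambda>t. \<integral>x. f x \<partial>\<mu> t)"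
  shows "continuous_map (top_of_set S) weak_topology \<mu>"
  unfolding weak_topology_def
proof (rule continuous_on_generated_topo)
  fix U assume "U \<in> {{\<nu>. real_distribution \<nu> \<and> (\<integral>x. f x \<partial>\<nu>) \<in> U} | f U.
        continuous_on UNIV (f :: real \<Rightarrow> real) \<and> bounded (range f) \<and> open U}"
  then obtain f V where U: "U = {\<nu>. real_distribution \<nu> \<and> (\<integral>x. f x \<partial>\<nu>) \<in> V}"
    and f: "continuous_on UNIV (f :: real \<Rightarrow> real)" "bounded (range f)" and V: "open V" by auto
  have "\<mu> -` U \<inter> topspace (top_of_set S) = S \<inter> (\<lambda>t. \<integral>x. f x \<partial>\<mu> t) -` V" using rd by (auto simp: U)
  then show "openin (top_of_set S) (\<mu> -` U \<inter> topspace (top_of_set S))"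
    using continuous_openin_preimage_gen[OF cont[OF f] V] by simp
next
  have "\<Union> {{\<nu>. real_distribution \<nu> \<and> (\<integral>x. f x \<partial>\<nu>) \<in> U} | f U.
        continuous_on UNIV (f :: real \<Rightarrow> real) \<and> bounded (range f) \<and> open U} = {\<nu>. real_distribution \<nu>}"
    using topspace_weak_topology unfolding weak_topology_def topology_generated_by_topspace .
  then show "\<mu> ` topspace (top_of_set S) \<subseteq> \<Union> {{\<nu>. real_distribution \<nu> \<and> (\<integral>x. f x \<partial>\<nu>) \<in> U} | f U.
        continuous_on UNIV (f :: real \<Rightarrow> real) \<and> bounded (range f) \<and> open U}" using rd by auto
qed

lemma weak_conv_integral:
  fixes f :: "real \<Rightarrow> real"
  assumes "\<And>k. real_distribution (\<nu> k)" "real_distribution \<mu>" "weak_conv_m \<nu> \<mu>" "continuous_on UNIV f" "bounded (range f)"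
  shows "(\<lambda>k. \<integral>x. f x \<partial>\<nu> k) \<longlonglongrightarrow> (\<integral>x. f x \<partial>\<mu>)"
proof -
  obtain B where "\<And>x. norm (f x) \<le> B" using assms(5) unfolding bounded_iff by auto
  then show ?thesis
    using assms(4) by (intro weak_conv_imp_integral_bdd_continuous_conv[OF assms(1-3)]) (auto simp: continuous_on_eq_continuous_at)
qed

text \<open>An open set of the weak topology is built from sets given by one test function through
  finite intersections and arbitrary unions, and eventual membership passes through both.\<close>

lemma weak_conv_imp_limitin:
  assumes rd: "\<And>k. real_distribution (\<nu> k)" "real_distribution \<mu>" and weak: "weak_conv_m \<nu> \<mu>"
  shows "limitin weak_topology \<nu> \<mu> sequentially"
  unfolding limitin_def
proof (intro conjI allI impI)
  show "\<mu> \<in> topspace weak_topology" using rd by (simp add: topspace_weak_topology)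
  fix U assume "openin weak_topology U \<and> \<mu> \<in> U"
  then have "generate_topology_on {{\<nu>. real_distribution \<nu> \<and> (\<integral>x. f x \<partial>\<nu>) \<in> U} | f U.
        continuous_on UNIV (f :: real \<Rightarrow> real) \<and> bounded (range f) \<and> open U} U" "\<mu> \<in> U"
    unfolding weak_topology_def by (auto dest: openin_topology_generated_by)
  then show "\<forall>\<^sub>F k in sequentially. \<nu> k \<in> U"
  proof (induction rule: generate_topology_on.induct)
    case (Int a b)
    then have "\<forall>\<^sub>F k in sequentially. \<nu> k \<in> a" "\<forall>\<^sub>F k in sequentially. \<nu> k \<in> b" by auto
    then show ?case by eventually_elim auto
  next
    case (UN K)
    then obtain k where k: "k \<in> K" "\<mu> \<in> k" by auto
    from UN.IH[OF this] show ?case by (rule eventually_mono) (use k in auto)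
  next
    case (Basis U)
    then obtain f V where U: "U = {\<nu>. real_distribution \<nu> \<and> (\<integral>x. f x \<partial>\<nu>) \<in> V}"
      and f: "continuous_on UNIV (f :: real \<Rightarrow> real)" "bounded (range f)" and V: "open V" by auto
    have "\<forall>\<^sub>F k in sequentially. (\<integral>x. f x \<partial>\<nu> k) \<in> V"
      using topological_tendstoD[OF weak_conv_integral[OF rd weak f] V] Basis U by auto
    then show ?case using rd by (auto simp: U)
  qed simp
qed

lemma weak_conv_imp_dist_tendsto:
  assumes d: "metrizes_weak_topology d" and rd: "\<And>k. real_distribution (\<nu> k)" "real_distribution \<mu>" and weak: "weak_conv_m \<nu> \<mu>"
  shows "(\<lambda>k. d (\<nu> k) \<mu>) \<longlonglongrightarrow> 0"
proof -
  interpret D: Metric_space "{\<nu>. real_distribution \<nu>}" d using d by (simp add: metrizes_weak_topology_def)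
  have "limitin D.mtopology \<nu> \<mu> sequentially"
    using weak_conv_imp_limitin[OF rd weak] d by (simp add: metrizes_weak_topology_def)
  then have "\<forall>e>0. \<exists>n0. \<forall>n\<ge>n0. d (\<nu> n) \<mu> < e" unfolding D.limit_metric_sequentially by blast
  then show ?thesis by (intro LIMSEQ_I) (simp add: D.nonneg)
qed

text \<open>Continuity is tested along sequences of times, to which the method of moments applies.
  The growth bound enters at the limit time alone, so its constant may vary with
  \<open>t\<close>.\<close>

lemma moments_continuous_imp_weakly_continuous:
  fixes \<mu> :: "real \<Rightarrow> real measure"
  assumes rd: "\<And>t. t \<in> S \<Longrightarrow> real_distribution (\<mu> t)" and mom: "\<And>t. t \<in> S \<Longrightarrow> has_moments (\<mu> t) (\<lambda>n. m n t)"
    and cont: "\<And>n. continuous_on S (m n)"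
    and growth: "\<And>t. t \<in> S \<Longrightarrow> \<exists>\<Lambda>>0. \<forall>n\<ge>1. \<bar>m n t\<bar> \<le> (\<Lambda> * real n) ^ n"
  shows "continuous_map (top_of_set S) weak_topology \<mu>"
proof (rule continuous_map_weak_topology[OF rd])
  fix f :: "real \<Rightarrow> real" assume f: "continuous_on UNIV f" "bounded (range f)"
  show "continuous_on S (\<lambda>t. \<integral>x. f x \<partial>\<mu> t)"
    unfolding continuous_on_sequentially comp_def
  proof (intro allI ballI impI, elim conjE)
    fix t' t assume t: "t \<in> S" and t': "\<forall>k. t' k \<in> S" "t' \<longlonglongrightarrow> t"
    obtain \<Lambda> where \<Lambda>: "\<Lambda> > 0" "\<And>n. n \<ge> 1 \<Longrightarrow> \<bar>m n t\<bar> \<le> (\<Lambda> * real n) ^ n" using growth[OF t] by auto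
    have "weak_conv_m (\<lambda>k. \<mu> (t' k)) (\<mu> t)"
    proof (rule method_of_moments(2)[where m="\<lambda>n. m n t" and \<Lambda>=\<Lambda>])
      show "(\<lambda>k. \<integral>x. x ^ n \<partial>\<mu> (t' k)) \<longlonglongrightarrow> m n t" for n
      proof -
        have "(\<lambda>k. m n (t' k)) \<longlonglongrightarrow> m n t"
          using cont[of n] t t' unfolding continuous_on_sequentially comp_def by blast
        then show ?thesis using mom t' by (simp add: has_moments_def)
      qed
    qed (use rd mom t t' \<Lambda> in \<open>auto simp: has_moments_def\<close>)
    then show "(\<lambda>k. \<integral>x. f x \<partial>\<mu> (t' k)) \<longlonglongrightarrow> (\<integral>x. f x \<partial>\<mu> t)"
      using t t' rd by (intro weak_conv_integral f) auto
  qed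
qed

text \<open>Otherwise there are \<open>t_k\<close> and laws \<open>\<nu>_k\<close>, far from
  \<open>\<mu>(t_k)\<close>, whose first \<open>k\<close> moments are close to those at
  \<open>t_k\<close>. Along a subsequence with \<open>t_k\<close> tending to \<open>t0\<close> both
  \<open>\<nu>_k\<close> and \<open>\<mu>(t_k)\<close> converge weakly to \<open>\<mu>(t0)\<close>
  by the method of moments, against the triangle inequality. Compactness of the time interval makes
  \<open>n0\<close> and \<delta> uniform in \<open>t\<close>.\<close>

lemma moments_close_imp_dist_small:
  fixes \<mu> :: "real \<Rightarrow> real measure" and e :: real
  assumes d: "metrizes_weak_topology d"
    and rd: "\<And>t. t \<in> {0..T} \<Longrightarrow> real_distribution (\<mu> t)" and mom: "\<And>t. t \<in> {0..T} \<Longrightarrow> has_moments (\<mu> t) (\<lambda>n. m n t)"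
    and cont: "\<And>n. continuous_on {0..T} (m n)"
    and growth: "\<And>t. t \<in> {0..T} \<Longrightarrow> \<exists>\<Lambda>>0. \<forall>n\<ge>1. \<bar>m n t\<bar> \<le> (\<Lambda> * real n) ^ n"
    and e: "0 < e"
  shows "\<exists>n0. \<exists>\<delta>>0. \<forall>t\<in>{0..T}. \<forall>\<nu>. real_distribution \<nu> \<longrightarrow> (\<forall>n. integrable \<nu> (\<lambda>x. x ^ n)) \<longrightarrow>
     (\<forall>n\<le>n0. \<bar>(\<integral>x. x ^ n \<partial>\<nu>) - m n t\<bar> \<le> \<delta>) \<longrightarrow> d \<nu> (\<mu> t) \<le> e"
proof (rule ccontr)
  assume neg: "\<not> ?thesis"
  have "\<exists>t \<nu>. t \<in> {0..T} \<and> real_distribution \<nu> \<and> (\<forall>n. integrable \<nu> (\<lambda>x. x ^ n)) \<and>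
     (\<forall>n\<le>k. \<bar>(\<integral>x. x ^ n \<partial>\<nu>) - m n t\<bar> \<le> 1 / real (Suc k)) \<and> e < d \<nu> (\<mu> t)" for k
  proof -
    have "(0::real) < 1 / real (Suc k)" by simp
    then show ?thesis using neg by (meson not_le)
  qed
  then obtain t \<nu> where t: "\<And>k. t k \<in> {0..T}" and \<nu>: "\<And>k. real_distribution (\<nu> k)" "\<And>k n. integrable (\<nu> k) (\<lambda>x. x ^ n)"
    and close: "\<And>k n. n \<le> k \<Longrightarrow> \<bar>(\<integral>x. x ^ n \<partial>\<nu> k) - m n (t k)\<bar> \<le> 1 / real (Suc k)" and far: "\<And>k. e < d (\<nu> k) (\<mu> (t k))"
    by metis
  obtain t0 r where t0: "t0 \<in> {0..T}" and r: "strict_mono r" and lim: "(t \<circ> r) \<longlonglongrightarrow> t0"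
    using compact_Icc[of 0 T] t unfolding compact_def by blast
  obtain \<Lambda> where \<Lambda>: "\<Lambda> > 0" "\<And>n. n \<ge> 1 \<Longrightarrow> \<bar>m n t0\<bar> \<le> (\<Lambda> * real n) ^ n" using growth[OF t0] by auto
  have mlim: "(\<lambda>k. m n (t (r k))) \<longlonglongrightarrow> m n t0" for n
    by (rule continuous_on_tendsto_compose[OF cont[of n]]) (use lim t t0 in \<open>simp_all add: comp_def\<close>)
  have "(\<lambda>k. (\<integral>x. x ^ n \<partial>\<nu> (r k)) - m n (t (r k))) \<longlonglongrightarrow> 0" for n
  proof (rule Lim_null_comparison)
    show "\<forall>\<^sub>F k in sequentially. norm ((\<integral>x. x ^ n \<partial>\<nu> (r k)) - m n (t (r k))) \<le> 1 / real (Suc k)"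
      using eventually_ge_at_top[of n]
    proof eventually_elim
      case (elim k)
      have kr: "k \<le> r k" using r by (rule strict_mono_imp_increasing)
      have "\<bar>(\<integral>x. x ^ n \<partial>\<nu> (r k)) - m n (t (r k))\<bar> \<le> 1 / real (Suc (r k))" using close[of n "r k"] elim kr by simp
      also have "\<dots> \<le> 1 / real (Suc k)" using kr by (intro divide_left_mono) auto
      finally show ?case by simp
    qed
    show "(\<lambda>k. 1 / real (Suc k)) \<longlonglongrightarrow> 0" using LIMSEQ_inverse_real_of_nat by (simp add: inverse_eq_divide)
  qed
  then have "(\<lambda>k. \<integral>x. x ^ n \<partial>\<nu> (r k)) \<longlonglongrightarrow> m n t0" for n using tendsto_add[OF _ mlim[of n], of "\<lambda>k. (\<integral>x. x ^ n \<partial>\<nu> (r k)) - m n (t (r k))" 0] by simp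
  then have "weak_conv_m (\<lambda>k. \<nu> (r k)) (\<mu> t0)"
    using \<nu> rd mom t0 \<Lambda> by (intro method_of_moments(2)[where m="\<lambda>n. m n t0" and \<Lambda>=\<Lambda>]) auto
  then have 1: "(\<lambda>k. d (\<nu> (r k)) (\<mu> t0)) \<longlonglongrightarrow> 0" using \<nu> rd t0 by (intro weak_conv_imp_dist_tendsto[OF d]) auto
  have "weak_conv_m (\<lambda>k. \<mu> (t (r k))) (\<mu> t0)"
    using rd mom t t0 \<Lambda> mlim by (intro method_of_moments(2)[where m="\<lambda>n. m n t0" and \<Lambda>=\<Lambda>]) (auto simp: has_moments_def)
  then have 2: "(\<lambda>k. d (\<mu> (t (r k))) (\<mu> t0)) \<longlonglongrightarrow> 0" using t rd t0 by (intro weak_conv_imp_dist_tendsto[OF d]) auto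
  interpret D: Metric_space "{\<nu>. real_distribution \<nu>}" d using d by (simp add: metrizes_weak_topology_def)
  have "e \<le> d (\<nu> (r k)) (\<mu> t0) + d (\<mu> (t (r k))) (\<mu> t0)" for k
    using D.triangle[of "\<nu> (r k)" "\<mu> t0" "\<mu> (t (r k))"] far[of "r k"] \<nu> rd t t0 by (simp add: D.commute)
  then have "e \<le> 0 + 0" by (intro LIMSEQ_le_const[OF tendsto_add[OF 1 2]]) auto
  then show False using e by simp
qed

lemma unif_conv_in_prob_finite:
  fixes e :: real and K :: nat
  assumes "\<And>n. unif_conv_in_prob T M (X n) (x n)" "0 < e"
  shows "\<forall>\<^sub>F N in sequentially. \<exists>A\<in>sets (M N). measure (M N) A \<le> e \<and>
     (\<forall>\<omega>\<in>space (M N) - A. \<forall>n\<le>K. \<forall>t\<in>{0..T}. \<bar>X n N t \<omega> - x n t\<bar> \<le> (e::real))"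
  using assms(2)
proof (induction K arbitrary: e)
  case 0
  then show ?case using assms(1)[of 0] unfolding unif_conv_in_prob_def by simp
next
  case (Suc K)
  have e2: "0 < e / 2" "e / 2 \<le> e" using Suc.prems by auto
  have "\<forall>\<^sub>F N in sequentially. \<exists>A\<in>sets (M N). measure (M N) A \<le> e / 2 \<and>
     (\<forall>\<omega>\<in>space (M N) - A. \<forall>t\<in>{0..T}. \<bar>X (Suc K) N t \<omega> - x (Suc K) t\<bar> \<le> e / 2)"
    using assms(1)[of "Suc K", unfolded unif_conv_in_prob_def, rule_format, OF e2(1)] .
  with Suc.IH[OF e2(1)] show ?case
  proof eventually_elim
    case (elim N)
    then obtain A B where A: "A \<in> sets (M N)" "measure (M N) A \<le> e / 2" "\<forall>\<omega>\<in>space (M N) - A. \<forall>n\<le>K. \<forall>t\<in>{0..T}. \<bar>X n N t \<omega> - x n t\<bar> \<le> e / 2"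
      and B: "B \<in> sets (M N)" "measure (M N) B \<le> e / 2" "\<forall>\<omega>\<in>space (M N) - B. \<forall>t\<in>{0..T}. \<bar>X (Suc K) N t \<omega> - x (Suc K) t\<bar> \<le> e / 2"
      by blast
    show ?case
    proof (intro bexI[of _ "A \<union> B"] conjI ballI allI impI)
      show "measure (M N) (A \<union> B) \<le> e" using measure_Un_le[OF A(1) B(1)] A(2) B(2) by linarith
      show "A \<union> B \<in> sets (M N)" using A B by auto
      fix \<omega> n t assume *: "\<omega> \<in> space (M N) - (A \<union> B)" "n \<le> Suc K" "t \<in> {0..T}"
      show "\<bar>X n N t \<omega> - x n t\<bar> \<le> e"
      proof (cases "n = Suc K")
        case True
        then have "\<bar>X n N t \<omega> - x n t\<bar> \<le> e / 2" using B(3) * by blast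
        then show ?thesis using e2(2) by linarith
      next
        case False
        then have "\<bar>X n N t \<omega> - x n t\<bar> \<le> e / 2" using A(3) * by auto
        then show ?thesis using e2(2) by linarith
      qed
    qed
  qed
qed

text \<open>The exceptional event has probability below 1, so some sample point realises the first
  \<open>k\<close> moments up to a small error. The empirical measures at such points, taken from
  varying probability spaces, are an ordinary sequence of laws to which the method of moments
  applies.\<close>

lemma limiting_moments_exist:
  assumes M: "\<And>N. N \<ge> 1 \<Longrightarrow> prob_space (M N)" and t: "t \<in> {0..T}"
    and conv: "\<And>n. unif_conv_in_prob T M (\<lambda>N t \<omega>. empirical_moment N (\<lambda>i. x N i t \<omega>) n) (m n)"
  shows "\<exists>\<nu>. real_distribution \<nu> \<and> has_moments \<nu> (\<lambda>n. m n t)"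
proof -
  have "\<exists>N \<omega>. N \<ge> 1 \<and> (\<forall>n\<le>k. \<bar>empirical_moment N (\<lambda>i. x N i t \<omega>) n - m n t\<bar> \<le> 1 / real (Suc (Suc k)))" for k
  proof -
    \<comment> \<open>The accuracy also bounds the probability of the exceptional event;
      \<open>k + 2\<close> in place of \<open>k + 1\<close> keeps it below 1 for
      \<open>k = 0\<close>.\<close>
    have pos: "(0::real) < 1 / real (Suc (Suc k))" by simp
    have "\<forall>\<^sub>F N in sequentially. N \<ge> 1 \<and> (\<exists>A\<in>sets (M N). measure (M N) A \<le> 1 / real (Suc (Suc k)) \<and>
     (\<forall>\<omega>\<in>space (M N) - A. \<forall>n\<le>k. \<forall>t\<in>{0..T}. \<bar>empirical_moment N (\<lambda>i. x N i t \<omega>) n - m n t\<bar> \<le> 1 / real (Suc (Suc k))))"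
      using unif_conv_in_prob_finite[OF conv pos, of k] eventually_ge_at_top[of 1] by eventually_elim simp
    then obtain N A where N: "N \<ge> 1" and A: "A \<in> sets (M N)" "measure (M N) A \<le> 1 / real (Suc (Suc k))"
      "\<forall>\<omega>\<in>space (M N) - A. \<forall>n\<le>k. \<forall>t\<in>{0..T}. \<bar>empirical_moment N (\<lambda>i. x N i t \<omega>) n - m n t\<bar> \<le> 1 / real (Suc (Suc k))"
      using eventually_happens'[OF sequentially_bot] by blast
    interpret prob_space "M N" by (rule M[OF N])
    have "measure (M N) A < 1" using A(2) by (rule le_less_trans) simp
    then have "A \<noteq> space (M N)" using prob_space by auto
    then obtain \<omega> where "\<omega> \<in> space (M N) - A" using sets.sets_into_space[OF A(1)] by blast
    then show ?thesis using A(3) t N by blast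
  qed
  then obtain N \<omega> where N: "\<And>k. N k \<ge> 1" and close: "\<And>k n. n \<le> k \<Longrightarrow> \<bar>empirical_moment (N k) (\<lambda>i. x (N k) i t (\<omega> k)) n - m n t\<bar> \<le> 1 / real (Suc (Suc k))"
    by metis
  have "(\<lambda>k. empirical_moment (N k) (\<lambda>i. x (N k) i t (\<omega> k)) n - m n t) \<longlonglongrightarrow> 0" for n
  proof (rule Lim_null_comparison)
    show "\<forall>\<^sub>F k in sequentially. norm (empirical_moment (N k) (\<lambda>i. x (N k) i t (\<omega> k)) n - m n t) \<le> 1 / real (Suc (Suc k))"
      using eventually_ge_at_top[of n] by eventually_elim (use close in simp)
    show "(\<lambda>k. 1 / real (Suc (Suc k))) \<longlonglongrightarrow> 0"
      using LIMSEQ_Suc[OF LIMSEQ_inverse_real_of_nat] by (simp add: inverse_eq_divide)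
  qed
  then have "(\<lambda>k. empirical_moment (N k) (\<lambda>i. x (N k) i t (\<omega> k)) n) \<longlonglongrightarrow> m n t" for n
    by (rule LIM_zero_cancel)
  then show ?thesis
    using method_of_moments(1)[of "\<lambda>k. empirical_measure (N k) (\<lambda>i. x (N k) i t (\<omega> k))" "\<lambda>n. m n t"]
      empirical_measure_real_distribution[OF N] by (simp add: empirical_measure_moments)
qed

section \<open>Convergence of the beta Laguerre processes\<close>

lemma Dunkl_B_SDE_imp_Dunkl_particles:
  assumes M: "prob_space M" and b: "independent_BMs M N b" and N: "N \<ge> 1" and c: "c > 0" and \<alpha>: "\<alpha> > 1/2"
    and sol: "Dunkl_B_SDE_solution M N b \<alpha> (2 * c / real N) y0 y"
  shows "Dunkl_particles M N b y \<alpha> c y0"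
proof -
  interpret prob_space M by fact
  have ind: "independent_brownian_motions M N b" by unfold_locales (rule b)
  show ?thesis
  proof (intro Dunkl_particles.intro driven_by_brownian_motions.intro ind)
    show "driven_by_brownian_motions_axioms M N b y (\<lambda>i \<omega> s. Dunkl_B_drift N \<alpha> (2 * c / real N) (\<lambda>j. y j s \<omega>) i) y0"
      using sol unfolding Dunkl_B_SDE_solution_def by unfold_locales auto
    show "Dunkl_particles_axioms M N y \<alpha> c"
      using sol N c \<alpha> unfolding Dunkl_B_SDE_solution_def by unfold_locales auto
  qed
qed

text \<open>Both branches of the definition matter here: the modes of convergence ask for random
  elements at every \<open>N \<ge> 1\<close>, also where \<open>2 * c / N\<close> is at least
  1.\<close>

lemma beta_Laguerre_random_element:
  assumes lam: "beta_Laguerre_process M N \<alpha> \<beta> l lam" and M: "prob_space M" and i: "i \<in> {1..N}"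
  shows "0 \<le> t \<Longrightarrow> lam i t \<in> borel_measurable M" "\<omega> \<in> space M \<Longrightarrow> continuous_on {0..} (\<lambda>t. lam i t \<omega>)"
proof -
  interpret prob_space M by fact
  obtain b where b: "independent_BMs M N b" and sol: "if \<beta> \<ge> 1 then Laguerre_SDE_solution M N b \<alpha> \<beta> l lam
         else \<exists>y. Dunkl_B_SDE_solution M N b \<alpha> \<beta> (\<lambda>i. sqrt (2 * l i)) y \<and>
                (\<forall>i\<in>{1..N}. \<forall>t\<ge>0. \<forall>\<omega>\<in>space M. lam i t \<omega> = (y i t \<omega>)\<^sup>2 / 2)"
    using lam unfolding beta_Laguerre_process_def by blast
  interpret independent_brownian_motions M N b by unfold_locales (rule b)
  have gen: "(0 \<le> t \<longrightarrow> z i t \<in> borel_measurable M) \<and> (\<omega> \<in> space M \<longrightarrow> continuous_on {0..} (\<lambda>t. z i t \<omega>))"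
    if "adapted (BM_filtration M N b) (z i)" "continuous_paths M (z i)" for z :: "nat \<Rightarrow> real \<Rightarrow> 'a \<Rightarrow> real" and t \<omega>
    using that measurable_from_subalg[OF subalgebra_BM_filtration] unfolding adapted_def continuous_paths_def by blast
  have "(0 \<le> t \<longrightarrow> lam i t \<in> borel_measurable M) \<and> (\<omega> \<in> space M \<longrightarrow> continuous_on {0..} (\<lambda>t. lam i t \<omega>))" for t \<omega>
  proof (cases "\<beta> \<ge> 1")
    case True
    then show ?thesis using sol i unfolding Laguerre_SDE_solution_def by (intro gen) auto
  next
    case False
    then obtain y where y: "Dunkl_B_SDE_solution M N b \<alpha> \<beta> (\<lambda>i. sqrt (2 * l i)) y"
      "\<forall>i\<in>{1..N}. \<forall>t\<ge>0. \<forall>\<omega>\<in>space M. lam i t \<omega> = (y i t \<omega>)\<^sup>2 / 2" using sol by auto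
    have yi: "(0 \<le> t \<longrightarrow> y i t \<in> borel_measurable M) \<and> (\<omega> \<in> space M \<longrightarrow> continuous_on {0..} (\<lambda>t. y i t \<omega>))"
      using y(1) i unfolding Dunkl_B_SDE_solution_def by (intro gen) auto
    show ?thesis
    proof (intro conjI impI)
      assume t: "0 \<le> t"
      have "(\<lambda>\<omega>. (y i t \<omega>)\<^sup>2 / 2) \<in> borel_measurable M" using yi t by auto
      then show "lam i t \<in> borel_measurable M" by (rule measurable_cong[THEN iffD2, rotated]) (use y(2) i t in auto)
    next
      assume \<omega>: "\<omega> \<in> space M"
      have "continuous_on {0..} (\<lambda>t. (y i t \<omega>)\<^sup>2 / 2)" using yi \<omega> by (intro continuous_intros) auto
      then show "continuous_on {0..} (\<lambda>t. lam i t \<omega>)" by (rule continuous_on_eq) (use y(2) i \<omega> in auto)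
    qed
  qed
  then show "0 \<le> t \<Longrightarrow> lam i t \<in> borel_measurable M" "\<omega> \<in> space M \<Longrightarrow> continuous_on {0..} (\<lambda>t. lam i t \<omega>)" by auto
qed

lemma integral_time_change:
  fixes f :: "real \<Rightarrow> real"
  assumes \<tau>: "\<tau> > 0" and t: "0 \<le> t" and f: "continuous_on {0..t / \<tau>} f"
  shows "integral {0..t} (\<lambda>u. (1 / \<tau>) * f (u / \<tau>)) = integral {0..t / \<tau>} f"
proof -
  have "(f has_integral integral {0..t / \<tau>} f) {0..t / \<tau>}"
    using f by (simp add: integrable_integral integrable_continuous_real)
  from has_integral_stretch_real[OF this, of "1 / \<tau>"]
  have "((\<lambda>u. f (u / \<tau>)) has_integral \<tau> * integral {0..t / \<tau>} f) ((\<lambda>x. \<tau> * x) ` {0..t / \<tau>})"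
    using \<tau> by (simp add: mult.commute)
  moreover have "(\<lambda>x. \<tau> * x) ` {0..t / \<tau>} = {0..t}" using \<tau> t by (simp add: image_mult_atLeastAtMost)
  ultimately have "((\<lambda>u. f (u / \<tau>)) has_integral \<tau> * integral {0..t / \<tau>} f) {0..t}" by simp
  from integral_unique[OF has_integral_mult_right[OF this, of "1 / \<tau>"]] show ?thesis using \<tau> by (simp only:) simp
qed

text \<open>\<open>small\<close> selects the Dunkl branch of the definition. What remains is the
  substitution \<open>u = \<tau> s\<close> in the drift integral and
  \<open>(sqrt (2 l))^2 / 2 = l\<close> for the initial state, valid as
  \<open>l \<ge> 0\<close>.\<close>

lemma rescaled_moment_deviation:
  fixes x :: "nat \<Rightarrow> real \<Rightarrow> 'a \<Rightarrow> real"
  assumes M: "prob_space M" and N: "N \<ge> 1" and c: "c > 0" and \<alpha>: "\<alpha> > 1/2" and small: "2 * c / real N < 1"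
    and lam: "beta_Laguerre_process M N \<alpha> (2 * c / real N) l lam" and l: "\<forall>i\<in>{1..N}. 0 \<le> l i"
    and pos: "\<gamma> > 0" "\<tau> > 0" "E > 0" "T > 0" "A > 0" "e > 0" and r: "r \<ge> 1"
    and x: "\<And>i t \<omega>. x i t \<omega> = \<gamma> * (lam i (t / \<tau>) \<omega> - E)"
    and \<epsilon>: "\<gamma> / \<tau> \<le> 1" and s1: "2 * \<gamma>\<^sup>2 * E / \<tau> \<le> s1"
  defines "C \<equiv> real (2 * r) * \<alpha> + (real (2 * r))\<^sup>2 * (2 + s1) * (1 + 3 * c)"
    and "V0 \<equiv> 1 + empirical_moment N (\<lambda>i. \<gamma> * (l i - E)) (2 * r)"
  defines "K \<equiv> exp (ln V0 + 2 * C * T + 2 * A)"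
  shows "\<exists>Bad\<in>sets M. measure M Bad \<le> 16 * (real r)\<^sup>2 * (2 + s1) * T / A\<^sup>2 + 2 * (real r)\<^sup>2 * (2 + s1) * K * T / (real N * e\<^sup>2) \<and>
    (\<forall>\<omega>\<in>space M - Bad. \<forall>t\<in>{0..T}.
      \<bar>empirical_moment N (\<lambda>i. x i t \<omega>) r - empirical_moment N (\<lambda>i. \<gamma> * (l i - E)) r
         - integral {0..t} (\<lambda>u. moment_drift c \<alpha> N (\<gamma> / \<tau>) (2 * \<gamma>\<^sup>2 * E / \<tau>) (\<lambda>k. empirical_moment N (\<lambda>i. x i u \<omega>) k) r)\<bar> \<le> 2 * e)"
proof -
  define y0 where "y0 i = sqrt (2 * l i)" for i
  obtain b y where b: "independent_BMs M N b" and y: "Dunkl_B_SDE_solution M N b \<alpha> (2 * c / real N) y0 y"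
    and lam_y: "\<And>i t \<omega>. i \<in> {1..N} \<Longrightarrow> 0 \<le> t \<Longrightarrow> \<omega> \<in> space M \<Longrightarrow> lam i t \<omega> = (y i t \<omega>)\<^sup>2 / 2"
    using lam small unfolding beta_Laguerre_process_def y0_def by auto
  interpret Dunkl_particles M N b y \<alpha> c y0 by (rule Dunkl_B_SDE_imp_Dunkl_particles[OF M b N c \<alpha> y])
  have y0_eq: "empirical_moment N (\<lambda>i. \<gamma> * ((y0 i)\<^sup>2 / 2 - E)) n = empirical_moment N (\<lambda>i. \<gamma> * (l i - E)) n" for n
    unfolding empirical_moment_def using l by (intro arg_cong2[where f="(*)"] refl sum.cong) (auto simp: y0_def)
  have x_eq: "empirical_moment N (\<lambda>i. x i t \<omega>) n = moment \<gamma> E n (t / \<tau>) \<omega>" if "0 \<le> t" "\<omega> \<in> space M" for t \<omega> n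
    unfolding moment_def empirical_moment_def
  proof (intro arg_cong2[where f="(*)"] refl sum.cong)
    fix i assume "i \<in> {1..N}"
    moreover have "0 \<le> t / \<tau>" using that(1) pos by simp
    ultimately show "x i t \<omega> ^ n = (\<gamma> * ((y i (t / \<tau>) \<omega>)\<^sup>2 / 2 - E)) ^ n" by (simp only: x lam_y[OF _ _ that(2)])
  qed
  obtain Bad where Bad: "Bad \<in> events"
    "prob Bad \<le> 16 * (real r)\<^sup>2 * (2 + s1) * T / A\<^sup>2 + 2 * (real r)\<^sup>2 * (2 + s1) * K * T / (real N * e\<^sup>2)"
    "\<And>\<omega>. \<omega> \<in> space M - Bad \<Longrightarrow> (\<forall>i\<in>{1..N}. y i 0 \<omega> = y0 i) \<and>
      (\<forall>t\<in>{0..T / \<tau>}. \<bar>moment \<gamma> E r t \<omega> - moment \<gamma> E r 0 \<omega>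
         - integral {0..t} (\<lambda>s. moment_drift c \<alpha> N \<gamma> (2 * \<gamma>\<^sup>2 * E) (\<lambda>k. moment \<gamma> E k s \<omega>) r)\<bar> \<le> 2 * e)"
    using moment_deviation[OF pos(1,2,3,4,5,6) r \<epsilon> s1] unfolding y0_eq C_def[symmetric] V0_def[symmetric] K_def[symmetric]
    by (elim bexE conjE) (erule (1) that, erule (1) bspec)
  show ?thesis
  proof (intro bexI[OF _ Bad(1)] conjI Bad(2) ballI)
    fix \<omega> t assume \<omega>: "\<omega> \<in> space M - Bad" and t: "t \<in> {0..T}"
    have \<omega>M: "\<omega> \<in> space M" using \<omega> by simp
    have t': "t / \<tau> \<in> {0..T / \<tau>}" using t pos by (auto simp: divide_right_mono)
    have init: "moment \<gamma> E r 0 \<omega> = empirical_moment N (\<lambda>i. \<gamma> * (l i - E)) r"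
    proof -
      have "moment \<gamma> E r 0 \<omega> = empirical_moment N (\<lambda>i. \<gamma> * ((y0 i)\<^sup>2 / 2 - E)) r"
        unfolding moment_def empirical_moment_def using Bad(3)[OF \<omega>]
        by (intro arg_cong2[where f="(*)"] refl sum.cong) auto
      then show ?thesis unfolding y0_eq .
    qed
    have "integral {0..t} (\<lambda>u. moment_drift c \<alpha> N (\<gamma> / \<tau>) (2 * \<gamma>\<^sup>2 * E / \<tau>) (\<lambda>k. empirical_moment N (\<lambda>i. x i u \<omega>) k) r)
      = integral {0..t} (\<lambda>u. (1 / \<tau>) * moment_drift c \<alpha> N \<gamma> (2 * \<gamma>\<^sup>2 * E) (\<lambda>k. moment \<gamma> E k (u / \<tau>) \<omega>) r)"
      using x_eq \<omega>M by (intro integral_cong) (simp add: moment_drift_scale)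
    also have "\<dots> = integral {0..t / \<tau>} (\<lambda>s. moment_drift c \<alpha> N \<gamma> (2 * \<gamma>\<^sup>2 * E) (\<lambda>k. moment \<gamma> E k s \<omega>) r)"
      using t pos moment_drift_continuous[OF \<omega>M] by (intro integral_time_change) auto
    finally show "\<bar>empirical_moment N (\<lambda>i. x i t \<omega>) r - empirical_moment N (\<lambda>i. \<gamma> * (l i - E)) r
         - integral {0..t} (\<lambda>u. moment_drift c \<alpha> N (\<gamma> / \<tau>) (2 * \<gamma>\<^sup>2 * E / \<tau>) (\<lambda>k. empirical_moment N (\<lambda>i. x i u \<omega>) k) r)\<bar> \<le> 2 * e"
      using Bad(3)[OF \<omega>] t' t \<omega>M x_eq[of t \<omega> r] init by auto
  qed
qed

lemma empirical_measure_random_element: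
  assumes N: "N \<ge> 1"
    and meas: "\<And>i t. i \<in> {1..N} \<Longrightarrow> t \<in> {0..T} \<Longrightarrow> x i t \<in> borel_measurable M"
    and cont: "\<And>i \<omega>. i \<in> {1..N} \<Longrightarrow> \<omega> \<in> space M \<Longrightarrow> continuous_on {0..T} (\<lambda>t. x i t \<omega>)"
  shows "random_element_CP T M (\<lambda>t \<omega>. empirical_measure N (\<lambda>i. x i t \<omega>))"
  unfolding random_element_CP_def
proof (intro conjI ballI)
  fix t assume t: "t \<in> {0..T}"
  have rd: "real_distribution (empirical_measure N (\<lambda>i. x i t \<omega>))" for \<omega>
    by (rule empirical_measure_real_distribution[OF N])
  show "(\<lambda>\<omega>. empirical_measure N (\<lambda>i. x i t \<omega>)) \<in> M \<rightarrow>\<^sub>M prob_algebra borel"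
  proof (rule measurable_prob_algebraI)
    show "prob_space (empirical_measure N (\<lambda>i. x i t \<omega>))" for \<omega>
      using rd[of \<omega>] by (simp add: real_distribution_def)
    show "(\<lambda>\<omega>. empirical_measure N (\<lambda>i. x i t \<omega>)) \<in> M \<rightarrow>\<^sub>M subprob_algebra borel"
    proof (rule measurable_subprob_algebra)
      show "subprob_space (empirical_measure N (\<lambda>i. x i t \<omega>))" for \<omega>
        using rd[of \<omega>] by (auto simp: real_distribution_def intro: prob_space_imp_subprob_space)
      show "sets (empirical_measure N (\<lambda>i. x i t \<omega>)) = sets borel" for \<omega> by (simp add: empirical_measure_def)
      fix A :: "real set" assume A: "A \<in> sets borel"
      have "emeasure (empirical_measure N (\<lambda>i. x i t \<omega>)) A = ennreal ((1 / real N) * (\<Sum>i=1..N. indicator A (x i t \<omega>)))" for \<omega>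
      proof -
        interpret real_distribution "empirical_measure N (\<lambda>i. x i t \<omega>)" by (rule rd)
        show ?thesis unfolding emeasure_eq_measure measure_empirical_measure[OF N A] ..
      qed
      moreover have "(\<lambda>\<omega>. ennreal ((1 / real N) * (\<Sum>i=1..N. indicator A (x i t \<omega>)))) \<in> borel_measurable M"
      proof -
        have "(\<lambda>\<omega>. indicator A (x i t \<omega>) :: real) \<in> borel_measurable M" if "i \<in> {1..N}" for i
          using measurable_compose[OF meas[OF that t] borel_measurable_indicator[OF A]] .
        then show ?thesis by (intro measurable_compose[OF _ measurable_ennreal] borel_measurable_times borel_measurable_sum) auto
      qed
      ultimately show "(\<lambda>\<omega>. emeasure (empirical_measure N (\<lambda>i. x i t \<omega>)) A) \<in> borel_measurable M" by simp
    qed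
  qed
next
  fix \<omega> assume \<omega>: "\<omega> \<in> space M"
  show "continuous_map (top_of_set {0..T}) weak_topology (\<lambda>t. empirical_measure N (\<lambda>i. x i t \<omega>))"
  proof (rule continuous_map_weak_topology[OF empirical_measure_real_distribution[OF N]])
    fix f :: "real \<Rightarrow> real" assume f: "continuous_on UNIV f" "bounded (range f)"
    have "continuous_on {0..T} (\<lambda>t. f (x i t \<omega>))" if "i \<in> {1..N}" for i
      by (rule continuous_on_compose2[OF f(1) cont[OF that \<omega>]]) auto
    then show "continuous_on {0..T} (\<lambda>t. \<integral>u. f u \<partial>empirical_measure N (\<lambda>i. x i t \<omega>))"
      unfolding integral_empirical_measure(2)[OF borel_measurable_continuous_onI[OF f(1)]]
      by (intro continuous_intros) auto
  qed
qed

theorem theoremV4: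
  fixes c \<alpha> \<sigma>2 :: real
    and M :: "nat \<Rightarrow> 'a measure"
    and lam :: "nat \<Rightarrow> nat \<Rightarrow> real \<Rightarrow> 'a \<Rightarrow> real"
    and x :: "nat \<Rightarrow> nat \<Rightarrow> real \<Rightarrow> 'a \<Rightarrow> real"
    and l :: "nat \<Rightarrow> nat \<Rightarrow> real"
    and \<gamma> \<tau> E :: "nat \<Rightarrow> real"
    and a :: "nat \<Rightarrow> real"
  assumes "c > 0" and "\<alpha> > 1/2" and "\<sigma>2 > 0"
    and "\<And>N. N \<ge> 1 \<Longrightarrow> prob_space (M N)"
    and "\<And>N. N \<ge> 1 \<Longrightarrow> beta_Laguerre_process (M N) N \<alpha> (2 * c / real N) (l N) (lam N)"
    and "\<And>N i. N \<ge> 1 \<Longrightarrow> i \<in> {1..N} \<Longrightarrow> 0 \<le> l N i"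
    and "\<And>N. N \<ge> 1 \<Longrightarrow> \<gamma> N > 0 \<and> \<tau> N > 0 \<and> E N > 0"
    and "\<And>N i t \<omega>. x N i t \<omega> = \<gamma> N * (lam N i (t / \<tau> N) \<omega> - E N)"
    and "(\<lambda>N. \<gamma> N / \<tau> N) \<longlonglongrightarrow> 0"
    and "(\<lambda>N. 2 * (\<gamma> N)\<^sup>2 * E N / \<tau> N) \<longlonglongrightarrow> \<sigma>2"
    and "\<And>n. (\<lambda>N. empirical_moment N (\<lambda>i. \<gamma> N * (l N i - E N)) n) \<longlonglongrightarrow> a n"
  shows
    "(\<forall>n. \<forall>T>0. converges_in_prob_C T M
        (\<lambda>N t \<omega>. empirical_moment N (\<lambda>i. x N i t \<omega>) n) (limit_moment c \<sigma>2 a n))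
     \<and>
     ((\<exists>\<Lambda>>0. \<forall>n\<ge>1. \<bar>a n\<bar> \<le> (\<Lambda> * real n) ^ n) \<longrightarrow>
        (\<forall>t\<ge>0. \<exists>!\<nu>. real_distribution \<nu> \<and> has_moments \<nu> (\<lambda>n. limit_moment c \<sigma>2 a n t)) \<and>
        (\<forall>\<mu>. (\<forall>t\<ge>0. real_distribution (\<mu> t) \<and> has_moments (\<mu> t) (\<lambda>n. limit_moment c \<sigma>2 a n t)) \<longrightarrow>
           continuous_map (top_of_set {0..}) weak_topology \<mu> \<and>
           (\<forall>d. metrizes_weak_topology d \<longrightarrow>
              (\<forall>T>0. converges_in_prob_CP d T M
                 (\<lambda>N t \<omega>. empirical_measure N (\<lambda>i. x N i t \<omega>)) \<mu>))))"
proof -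
  note c = assms(1) and \<alpha> = assms(2) and \<sigma>2 = assms(3) and M = assms(4) and lam = assms(5) and l = assms(6)
    and pos = assms(7) and x = assms(8) and \<epsilon> = assms(9) and s = assms(10) and init = assms(11)
  let ?m = "limit_moment c \<sigma>2 a"
  let ?S = "\<lambda>n N t \<omega>. empirical_moment N (\<lambda>i. x N i t \<omega>) n"
  let ?init = "\<lambda>n N. empirical_moment N (\<lambda>i. \<gamma> N * (l N i - E N)) n"
  have x_meas: "x N i t \<in> borel_measurable (M N)" if "N \<ge> 1" "i \<in> {1..N}" "0 \<le> t" for N i t
  proof -
    have "0 \<le> t / \<tau> N" using pos[OF that(1)] that(3) by simp
    note [measurable] = beta_Laguerre_random_element(1)[OF lam[OF that(1)] M[OF that(1)] that(2) this]
    show ?thesis unfolding x[abs_def] by measurable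
  qed
  have x_cont: "continuous_on {0..T} (\<lambda>t. x N i t \<omega>)" if "N \<ge> 1" "i \<in> {1..N}" "\<omega> \<in> space (M N)" for N i \<omega> T
  proof -
    have "continuous_on {0..T} (\<lambda>t. lam N i (t / \<tau> N) \<omega>)"
      by (rule continuous_on_compose2[OF beta_Laguerre_random_element(2)[OF lam[OF that(1)] M[OF that(1)] that(2,3)]])
        (use pos[OF that(1)] in \<open>auto intro!: continuous_intros\<close>)
    then show ?thesis unfolding x by (intro continuous_intros)
  qed
  have S_cont: "continuous_on {0..T} (\<lambda>t. ?S n N t \<omega>)" if "N \<ge> 1" "\<omega> \<in> space (M N)" for n N \<omega> T
    unfolding empirical_moment_def using x_cont[OF that(1) _ that(2)] by (intro continuous_intros) auto
  have S_conv: "unif_conv_in_prob T M (?S n) (?m n)" if T: "0 < T" for n T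
  proof (rule moments_conv_of_drift_equation[OF T \<epsilon> s _ S_cont init])
    show "?S 0 N t \<omega> = 1" if "N \<ge> 1" for N t \<omega> by (rule empirical_moment_0[OF that])
    fix r :: nat assume r: "r \<ge> 1"
    show "unif_conv_in_prob T M (\<lambda>N t \<omega>. ?S r N t \<omega> - ?init r N
        - integral {0..t} (\<lambda>u. moment_drift c \<alpha> N (\<gamma> N / \<tau> N) (2 * (\<gamma> N)\<^sup>2 * E N / \<tau> N) (\<lambda>k. ?S k N u \<omega>) r)) (\<lambda>_. 0)"
      unfolding unif_conv_in_prob_def
    proof (intro allI impI)
      fix \<eta> :: real assume \<eta>: "0 < \<eta>"
      \<comment> \<open>The order of choice matters: \<open>A\<close> makes the first part of the
        exceptional probability equal to \<open>\<eta> / 2\<close>; \<open>K1\<close>, which depends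
        on \<open>A\<close>, then bounds \<open>K N\<close> for large \<open>N\<close>; finally
        \<open>1 / N\<close> brings the second part below \<open>\<eta> / 2\<close>.
        \<open>V1\<close> is the limit of \<open>1 + S_2r\<close> at time 0, plus 1, and
        \<open>e\<close> is half of \<eta> because the deviation bound is
        \<open>2 * e\<close>.\<close>
      define s1 where "s1 = \<sigma>2 + 1"
      define Q where "Q = 16 * (real r)\<^sup>2 * (2 + s1) * T"
      define A where "A = sqrt (2 * Q / \<eta>)"
      define C where "C = real (2 * r) * \<alpha> + (real (2 * r))\<^sup>2 * (2 + s1) * (1 + 3 * c)"
      define e where "e = \<eta> / 2"
      define V1 where "V1 = 1 + a (2 * r) + 1"
      define K1 where "K1 = V1 * exp (2 * C * T + 2 * A)"
      define K where "K N = exp (ln (1 + ?init (2 * r) N) + 2 * C * T + 2 * A)" for N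
      have Q: "Q > 0" using r \<sigma>2 T by (simp add: Q_def s1_def)
      have A: "A > 0" "Q / A\<^sup>2 = \<eta> / 2" using Q \<eta> by (simp_all add: A_def)
      have e: "e > 0" "2 * e = \<eta>" using \<eta> by (simp_all add: e_def)
      have ev1: "\<forall>\<^sub>F N in sequentially. \<gamma> N / \<tau> N < 1" using \<epsilon> by (rule order_tendstoD) simp
      have ev2: "\<forall>\<^sub>F N in sequentially. 2 * (\<gamma> N)\<^sup>2 * E N / \<tau> N < s1" using s by (rule order_tendstoD) (simp add: s1_def)
      have ev3: "\<forall>\<^sub>F N in sequentially. 2 * c / real N < 1" using lim_const_over_n[of "2 * c"] by (rule order_tendstoD) simp
      have ev4: "\<forall>\<^sub>F N in sequentially. 1 + ?init (2 * r) N < V1"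
        using tendsto_add[OF tendsto_const[of 1] init[of "2 * r"]] by (rule order_tendstoD) (simp add: V1_def)
      have "(\<lambda>N. 2 * (real r)\<^sup>2 * (2 + s1) * K1 * T / e\<^sup>2 / real N) \<longlonglongrightarrow> 0" by (rule lim_const_over_n)
      then have ev5: "\<forall>\<^sub>F N in sequentially. 2 * (real r)\<^sup>2 * (2 + s1) * K1 * T / e\<^sup>2 / real N < \<eta> / 2"
        by (rule order_tendstoD) (use \<eta> in simp)
      from ev1 ev2 ev3 ev4 ev5 eventually_ge_at_top[of 1]
      show "\<forall>\<^sub>F N in sequentially. \<exists>A\<in>sets (M N). measure (M N) A \<le> \<eta> \<and>
        (\<forall>\<omega>\<in>space (M N) - A. \<forall>t\<in>{0..T}. \<bar>?S r N t \<omega> - ?init r N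
        - integral {0..t} (\<lambda>u. moment_drift c \<alpha> N (\<gamma> N / \<tau> N) (2 * (\<gamma> N)\<^sup>2 * E N / \<tau> N) (\<lambda>k. ?S k N u \<omega>) r) - 0\<bar> \<le> \<eta>)"
      proof eventually_elim
        case (elim N)
        have p: "\<gamma> N > 0" "\<tau> N > 0" "E N > 0" using pos[OF elim(6)] by auto
        have l': "\<forall>i\<in>{1..N}. 0 \<le> l N i" using l elim(6) by blast
        obtain Bad where Bad: "Bad \<in> sets (M N)"
          "measure (M N) Bad \<le> 16 * (real r)\<^sup>2 * (2 + s1) * T / A\<^sup>2 + 2 * (real r)\<^sup>2 * (2 + s1) * K N * T / (real N * e\<^sup>2)"
          "\<And>\<omega>. \<omega> \<in> space (M N) - Bad \<Longrightarrow> \<forall>t\<in>{0..T}. \<bar>?S r N t \<omega> - ?init r N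
             - integral {0..t} (\<lambda>u. moment_drift c \<alpha> N (\<gamma> N / \<tau> N) (2 * (\<gamma> N)\<^sup>2 * E N / \<tau> N) (\<lambda>k. ?S k N u \<omega>) r)\<bar> \<le> 2 * e"
          using rescaled_moment_deviation[OF M[OF elim(6)] elim(6) c \<alpha> elim(3) lam[OF elim(6)] l' p T A(1) e(1) r x
              less_imp_le[OF elim(1)] less_imp_le[OF elim(2)]]
          unfolding C_def[symmetric] K_def[symmetric]
          by (elim bexE conjE) (erule (1) that, erule (1) bspec)
        have V0: "0 < 1 + ?init (2 * r) N"
          using empirical_moment_even_nonneg[of "2 * r" N "\<lambda>i. \<gamma> N * (l N i - E N)"] by simp
        have "K N = (1 + ?init (2 * r) N) * exp (2 * C * T + 2 * A)" using V0 by (simp add: K_def exp_add mult.assoc)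
        also have "\<dots> \<le> K1" unfolding K1_def using elim(4) by (intro mult_right_mono) auto
        finally have K: "K N \<le> K1" .
        have "2 * (real r)\<^sup>2 * (2 + s1) * K N * T / (real N * e\<^sup>2) \<le> 2 * (real r)\<^sup>2 * (2 + s1) * K1 * T / (real N * e\<^sup>2)"
          using K T \<sigma>2 by (intro divide_right_mono mult_right_mono mult_left_mono) (auto simp: s1_def)
        also have "\<dots> = 2 * (real r)\<^sup>2 * (2 + s1) * K1 * T / e\<^sup>2 / real N" by (simp add: mult.commute)
        also have "\<dots> \<le> \<eta> / 2" using elim(5) by simp
        finally have "2 * (real r)\<^sup>2 * (2 + s1) * K N * T / (real N * e\<^sup>2) \<le> \<eta> / 2" .
        then have "measure (M N) Bad \<le> \<eta> / 2 + \<eta> / 2"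
          using Bad(2) A(2) unfolding Q_def[symmetric] by (intro order_trans[OF Bad(2)[folded Q_def] add_mono]) auto
        then show ?case using Bad(1,3) e(2) by (intro bexI[of _ Bad]) auto
      qed
    qed
  qed
  have part1: "converges_in_prob_C T M (?S n) (?m n)" if T: "0 < T" for n T
    unfolding converges_in_prob_C_def random_element_C_def
  proof (intro conjI allI impI ballI)
    show "null_in_prob M (\<lambda>N \<omega>. SUP t\<in>{0..T}. \<bar>?S n N t \<omega> - ?m n t\<bar>)"
      using unif_conv_in_prob_imp_null_in_prob[OF S_conv[OF T] _ M] T by simp
    show "continuous_on {0..T} (?m n)" by (rule limit_moment_continuous)
    show "continuous_on {0..T} (\<lambda>t. ?S n N t \<omega>)" if "1 \<le> N" "\<omega> \<in> space (M N)" for N \<omega> by (rule S_cont[OF that])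
    show "?S n N t \<in> borel_measurable (M N)" if "1 \<le> N" "t \<in> {0..T}" for N t
      unfolding empirical_moment_def using x_meas[OF that(1)] that(2) by (intro borel_measurable_times borel_measurable_sum borel_measurable_power) auto
  qed
  have part2: "(\<forall>t\<ge>0. \<exists>!\<nu>. real_distribution \<nu> \<and> has_moments \<nu> (\<lambda>n. ?m n t)) \<and>
        (\<forall>\<mu>. (\<forall>t\<ge>0. real_distribution (\<mu> t) \<and> has_moments (\<mu> t) (\<lambda>n. ?m n t)) \<longrightarrow>
           continuous_map (top_of_set {0..}) weak_topology \<mu> \<and>
           (\<forall>d. metrizes_weak_topology d \<longrightarrow>
              (\<forall>T>0. converges_in_prob_CP d T M (\<lambda>N t \<omega>. empirical_measure N (\<lambda>i. x N i t \<omega>)) \<mu>)))"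
    if growth: "\<exists>\<Lambda>>0. \<forall>n\<ge>1. \<bar>a n\<bar> \<le> (\<Lambda> * real n) ^ n"
  proof (intro conjI allI impI)
    obtain \<Lambda> where \<Lambda>: "\<Lambda> > 0" "\<And>n. n \<ge> 1 \<Longrightarrow> \<bar>a n\<bar> \<le> (\<Lambda> * real n) ^ n" using growth by auto
    have mg: "\<exists>\<Lambda>>0. \<forall>n\<ge>1. \<bar>?m n t\<bar> \<le> (\<Lambda> * real n) ^ n" if "0 \<le> t" for t
      using limit_moment_growth[OF that c \<sigma>2 \<Lambda>] that by auto
    fix t :: real assume t: "0 \<le> t"
    obtain \<Lambda>' where \<Lambda>': "\<Lambda>' > 0" "\<And>n. n \<ge> 1 \<Longrightarrow> \<bar>?m n t\<bar> \<le> (\<Lambda>' * real n) ^ n" using mg[OF t] by auto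
    show "\<exists>!\<nu>. real_distribution \<nu> \<and> has_moments \<nu> (\<lambda>n. ?m n t)"
    proof (rule ex_ex1I)
      \<comment> \<open>The horizon \<open>t + 1\<close> is positive even at \<open>t = 0\<close>,
        as \<open>S_conv\<close> requires.\<close>
      show "\<exists>\<nu>. real_distribution \<nu> \<and> has_moments \<nu> (\<lambda>n. ?m n t)"
        by (rule limiting_moments_exist[OF M, where t=t and T="t + 1" and x=x]) (use t S_conv in auto)
      show "\<nu> = \<nu>'" if "real_distribution \<nu> \<and> has_moments \<nu> (\<lambda>n. ?m n t)" "real_distribution \<nu>' \<and> has_moments \<nu>' (\<lambda>n. ?m n t)" for \<nu> \<nu>'
        using that \<Lambda>' moments_determine_distribution[of \<nu> "\<lambda>n. ?m n t" \<nu>' \<Lambda>'] by auto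
    qed
  next
    obtain \<Lambda> where \<Lambda>: "\<Lambda> > 0" "\<And>n. n \<ge> 1 \<Longrightarrow> \<bar>a n\<bar> \<le> (\<Lambda> * real n) ^ n" using growth by auto
    have mg: "\<exists>\<Lambda>>0. \<forall>n\<ge>1. \<bar>?m n t\<bar> \<le> (\<Lambda> * real n) ^ n" if "0 \<le> t" for t
      using limit_moment_growth[OF that c \<sigma>2 \<Lambda>] that by auto
    fix \<mu> :: "real \<Rightarrow> real measure"
    assume \<mu>: "\<forall>t\<ge>0. real_distribution (\<mu> t) \<and> has_moments (\<mu> t) (\<lambda>n. ?m n t)"
    show "continuous_map (top_of_set {0..}) weak_topology \<mu>"
      by (rule moments_continuous_imp_weakly_continuous[where m="?m"]) (use \<mu> mg limit_moment_continuous_nonneg in auto)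
    fix d assume d: "metrizes_weak_topology d"
    fix T :: real assume T: "0 < T"
    interpret D: Metric_space "{\<nu>. real_distribution \<nu>}" d using d by (simp add: metrizes_weak_topology_def)
    have "unif_conv_in_prob T M (\<lambda>N t \<omega>. d (empirical_measure N (\<lambda>i. x N i t \<omega>)) (\<mu> t)) (\<lambda>_. 0)"
      unfolding unif_conv_in_prob_def
    proof (intro allI impI)
      fix e :: real assume e: "0 < e"
      have "\<exists>n0. \<exists>\<delta>>0. \<forall>t\<in>{0..T}. \<forall>\<nu>. real_distribution \<nu> \<longrightarrow> (\<forall>n. integrable \<nu> (\<lambda>x. x ^ n)) \<longrightarrow>
        (\<forall>n\<le>n0. \<bar>(\<integral>x. x ^ n \<partial>\<nu>) - ?m n t\<bar> \<le> \<delta>) \<longrightarrow> d \<nu> (\<mu> t) \<le> e"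
        by (rule moments_close_imp_dist_small[OF d _ _ limit_moment_continuous _ e]) (use \<mu> mg in auto)
      then obtain n0 \<delta> where \<delta>: "\<delta> > 0" and close: "\<And>t \<nu>. t \<in> {0..T} \<Longrightarrow> real_distribution \<nu> \<Longrightarrow>
        (\<forall>n. integrable \<nu> (\<lambda>x. x ^ n)) \<Longrightarrow> (\<forall>n\<le>n0. \<bar>(\<integral>x. x ^ n \<partial>\<nu>) - ?m n t\<bar> \<le> \<delta>) \<Longrightarrow> d \<nu> (\<mu> t) \<le> e"
        by blast
      \<comment> \<open>The outer form of convergence uses one number twice: \<delta> is the
        accuracy of the moments, \<open>e\<close> the bound for the probability.\<close>
      have "0 < min \<delta> e" using \<delta> e by simp
      from unif_conv_in_prob_finite[where X="?S" and x="?m" and K=n0, OF S_conv[OF T] this] eventually_ge_at_top[of 1]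
      show "\<forall>\<^sub>F N in sequentially. \<exists>A\<in>sets (M N). measure (M N) A \<le> e \<and>
        (\<forall>\<omega>\<in>space (M N) - A. \<forall>t\<in>{0..T}. \<bar>d (empirical_measure N (\<lambda>i. x N i t \<omega>)) (\<mu> t) - 0\<bar> \<le> e)"
      proof eventually_elim
        case (elim N)
        then obtain A where A: "A \<in> sets (M N)" "measure (M N) A \<le> min \<delta> e"
          "\<And>\<omega> n t. \<omega> \<in> space (M N) - A \<Longrightarrow> n \<le> n0 \<Longrightarrow> t \<in> {0..T} \<Longrightarrow> \<bar>?S n N t \<omega> - ?m n t\<bar> \<le> min \<delta> e" by blast
        show ?case
        proof (intro bexI[OF _ A(1)] conjI ballI)
          show "measure (M N) A \<le> e" using A(2) by simp
          fix \<omega> t assume \<omega>: "\<omega> \<in> space (M N) - A" and t: "t \<in> {0..T}"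
          have "d (empirical_measure N (\<lambda>i. x N i t \<omega>)) (\<mu> t) \<le> e"
            using A(3)[OF \<omega> _ t]
            by (intro close[OF t empirical_measure_real_distribution[OF elim(2)]]) (simp_all add: empirical_measure_moments)
          then show "\<bar>d (empirical_measure N (\<lambda>i. x N i t \<omega>)) (\<mu> t) - 0\<bar> \<le> e" by (simp add: D.nonneg)
        qed
      qed
    qed
    from unif_conv_in_prob_imp_null_in_prob[OF this less_imp_le[OF T] M]
    have "null_in_prob M (\<lambda>N \<omega>. SUP t\<in>{0..T}. d (empirical_measure N (\<lambda>i. x N i t \<omega>)) (\<mu> t))"
      by (simp add: D.nonneg)
    moreover have "continuous_map (top_of_set {0..T}) weak_topology \<mu>"
      by (rule moments_continuous_imp_weakly_continuous[where m="?m"]) (use \<mu> mg limit_moment_continuous in auto)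
    moreover have "random_element_CP T (M N) (\<lambda>t \<omega>. empirical_measure N (\<lambda>i. x N i t \<omega>))" if "N \<ge> 1" for N
      by (rule empirical_measure_random_element[OF that]) (use x_meas[OF that] x_cont[OF that] in auto)
    ultimately show "converges_in_prob_CP d T M (\<lambda>N t \<omega>. empirical_measure N (\<lambda>i. x N i t \<omega>)) \<mu>"
      unfolding converges_in_prob_CP_def by blast
  qed
  from part1 part2 show ?thesis by blast
qed

end
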